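(* Suppose that conditions (A3), (A4), (A5) listed in the context hold. Let $c_n=b_n/a_n$ where $a_n,b_n$ are positive sequences with $a_n=O(\lambda_n^{-1})$, $b_n\to\infty$ and $b_n=o(a_n)$, with $\lambda_n=k_n/n+k_n^{-2\alpha/(d+1)}+\eta_n^2$, and let $\widehat\Delta_0=\{\delta\in\Delta_n:Q_n(\delta)\le c_n\}$. Then, as $n\to\infty$, $$d_H(\widehat\Delta_0,\Delta_0,\|\cdot\|_\infty)=o_p(1)\quad\text{and}\quad d_H(\widehat\Delta_0,\Delta_0,\|\cdot\|_w)=O_p(c_n^{1/2}).$$
   Context: Setting. $X\in\mathbb{R}^d$ are fully observed covariates, $Y\in\mathbb{R}$ an outcome, $R\in\{0,1\}$ the missingness indicator ($Y$ observed iff $R=1$), $Z\in\mathbb{R}$ a fully observed variable with support $\mathcal{Z}$, and $\tau(x,y)$ a given real function. $(R_i,X_i,Y_i,Z_i)$, $i=1,\dots,n$, are i.i.d. copies of $(R,X,Y,Z)$, with $Y_i$ missing when $R_i=0$. Smoothness norm. For $\rho$ defined on a subset of a Euclidean space and $\alpha>0$, with $\underline\alpha$ the largest integer smaller than $\alpha$, $$\|\rho\|_{\infty,\alpha}=\max_{|\lambda|\le\underline\alpha}\sup_w|D^\lambda\rho(w)|+\max_{|\lambda|=\underline\alpha}\sup_{w\ne w'}\frac{|D^\lambda\rho(w)-D^\lambda\rho(w')|}{\|w-w'\|^{\alpha-\underline\alpha}},$$ where $\lambda$ is a multi-index of nonnegative integers, $|\lambda|=\sum_i\lambda_i$, $D^\lambda$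 the corresponding partial derivative. $\|\cdot\|_\infty$ is the supremum norm. Sets and criterion. $\Delta$ is a set of functions $\delta(x,z)$, and $\Delta_0=\{\delta\in\Delta:E\{\delta(X,Z)\mid R=1,X,Y\}=\tau(X,Y)\}$. Given known functions $\{\psi_q(x,z)\}_{q\ge1}$ and integers $q_n$, $\Delta_n=\{\delta\in\Delta:\delta=\sum_{q=1}^{q_n}\beta_q\psi_q\text{ for some real }\beta_q\}$. Given known functions $\{\phi_k(x,y)\}_{k\ge1}$ and integers $k_n$, let $\boldsymbol\phi=(\phi_1,\dots,\phi_{k_n})^{T}$, $\boldsymbol\Phi=(\boldsymbol\phi(X_1,Y_1),\dots,\boldsymbol\phi(X_n,Y_n))^{T}$, $\boldsymbol\Lambda=\mathrm{diag}(R_1,\dots,R_n)$. For $B=B(X,Y,Z)$ with values $B_i=B(X_i,Y_i,Z_i)$, $$\widehat E(B\mid R=1,X,Y)=\boldsymbol\phi^{T}(X,Y)(\boldsymbol\Phi^{T}\boldsymbol\Lambda\boldsymbol\Phi)^{-1}\sum_{i=1}^nR_i\boldsymbol\phi(X_i,Y_i)B_i.$$ Let $\widehat e(X_i,Y_i,\delta)=\widehat E\{\tau(X,Y)-\delta(X,Z)\mid R=1,X_i,Y_i\}$ and $Q_n(\delta)=n^{-1}\sum_{i=1}^nR_i\widehat e^2(X_i,Y_i,\delta)$. Metrics. $\|\delta\|_w^2=E[R\{E(\delta(X,Z)\mid R=1,X,Y)\}^2]$ (a pseudo-norm). For a (pseudo-)norm $\|\cdot\|$, $d_H(\Delta_1,\Delta_2,\|\cdot\|)=\max\{d(\Delta_1,\Delta_2),d(\Delta_2,\Delta_1)\}$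 with $d(\Delta_1,\Delta_2)=\sup_{\delta_1\in\Delta_1}\inf_{\delta_2\in\Delta_2}\|\delta_1-\delta_2\|$. Conditions. (A3) $X$ has support $[0,1]^d$; $Y$ and $Z$ have compact supports. (A4) (i) $\sup_{\delta\in\Delta}\|\delta\|_{\infty,\alpha}<\infty$ for some $\alpha>(d+1)/2$; $\Delta_0\neq\emptyset$; both $\Delta_n$ and $\Delta$ are closed (with respect to $\|\cdot\|_\infty$). (ii) For every $\delta\in\Delta$ there is $\Pi_n\delta\in\Delta_n$ such that $\sup_{\delta\in\Delta}\|\delta-\Pi_n\delta\|_\infty=O(\eta_n)$ for some $\eta_n=o(1)$. (A5) (i) The smallest and largest eigenvalues of $E\{R\boldsymbol\phi(X,Y)\boldsymbol\phi(X,Y)^{T}\}$ are bounded above and away from zero for all $k_n$. (ii) For every $\delta\in\Delta$ there is $\boldsymbol\pi_n(\delta)\in\mathbb{R}^{k_n}$ with $\sup_{\delta\in\Delta}\|E\{\delta(X,Z)\mid R=1,x,y\}-\boldsymbol\phi^{T}(x,y)\boldsymbol\pi_n(\delta)\|_\infty=O(k_n^{-\alpha/(d+1)})$. (iii) $\xi_n^2k_n=o(n)$, where $\xi_n=\sup_{x,y}\|\boldsymbol\phi(x,y)\|_2$. *)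

theory Defs
  imports "HOL-Probability.Probability"
    "Jordan_Normal_Form.Char_Poly"
    "Jordan_Normal_Form.Gauss_Jordan_Elimination"
begin

definition msupport :: "'b::topological_space measure \<Rightarrow> 'b set" where
  "msupport \<mu> = {x. \<forall>U. open U \<and> x \<in> U \<longrightarrow> 0 < emeasure \<mu> U}"

definition multi_indices :: "('a::euclidean_space \<Rightarrow> nat) set" where
  "multi_indices = {l. \<forall>b. b \<notin> Basis \<longrightarrow> l b = 0}"

definition mi_size :: "('a::euclidean_space \<Rightarrow> nat) \<Rightarrow> nat" where
  "mi_size l = (\<Sum>b\<in>Basis. l b)"

text \<open>The largest integer strictly smaller than \<open>\<alpha>\<close>, for positive \<open>\<alpha>\<close>.\<close>

definition lower_int :: "real \<Rightarrow> nat" where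
  "lower_int \<alpha> = nat (\<lceil>\<alpha>\<rceil> - 1)"

text \<open>\<open>D\<close> is a family of partial derivatives up to order \<open>p\<close> of the function \<open>D (\<lambda>_. 0)\<close> on \<open>W\<close>:
  increasing a multi-index in one direction means differentiating once in that direction, with
  increments that stay in \<open>W\<close> (so the derivatives are one-sided at the boundary).\<close>

definition partial_derivs_on ::
    "'a::euclidean_space set \<Rightarrow> nat \<Rightarrow> (('a \<Rightarrow> nat) \<Rightarrow> 'a \<Rightarrow> real) \<Rightarrow> bool" where
  "partial_derivs_on W p D \<longleftrightarrow>
     (\<forall>l\<in>multi_indices. mi_size l < p \<longrightarrow> (\<forall>b\<in>Basis. \<forall>w\<in>W.
        ((\<lambda>t. D l (w + t *\<^sub>R b)) has_real_derivative D (l(b := Suc (l b))) w)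
          (at 0 within {t. w + t *\<^sub>R b \<in> W})))"

definition derivs_norm ::
    "'a::euclidean_space set \<Rightarrow> real \<Rightarrow> (('a \<Rightarrow> nat) \<Rightarrow> 'a \<Rightarrow> real) \<Rightarrow> ennreal" where
  "derivs_norm W \<alpha> D =
     (SUP l\<in>{l\<in>multi_indices. mi_size l \<le> lower_int \<alpha>}. SUP w\<in>W. ennreal \<bar>D l w\<bar>) +
     (SUP l\<in>{l\<in>multi_indices. mi_size l = lower_int \<alpha>}.
        SUP (w, w')\<in>{(w, w'). w \<in> W \<and> w' \<in> W \<and> w \<noteq> w'}.
          ennreal (\<bar>D l w - D l w'\<bar> / norm (w - w') powr (\<alpha> - real (lower_int \<alpha>))))"

text \<open>The smoothness norm of \<open>\<rho>\<close> on \<open>S\<close>. If \<open>S\<close> is convex with nonempty interior, the partial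
  derivatives on \<open>S\<close> are unique, so the infimum ranges over a single value (the derivative formula
  evaluated at \<open>\<rho>\<close>), or over the empty set if some derivative fails to exist (value \<open>\<infinity>\<close>).
  Partial derivatives are not determined by the values of \<open>\<rho>\<close> on an arbitrary set \<open>S\<close>, for instance
  at isolated points. There the norm is that of the restriction space: the infimum of the same
  formula over the extensions of \<open>\<rho>\<close> to the convex hull of \<open>S\<close>.\<close>

definition smooth_norm :: "'a::euclidean_space set \<Rightarrow> real \<Rightarrow> ('a \<Rightarrow> real) \<Rightarrow> ennreal" where
  "smooth_norm S \<alpha> \<rho> =
     (INF D\<in>{D. partial_derivs_on (convex hull S) (lower_int \<alpha>) D \<and>
                (\<forall>w\<in>S. D (\<lambda>_. 0) w = \<rho> w)}.
        derivs_norm (convex hull S) \<alpha> D)"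

definition sup_norm :: "'a set \<Rightarrow> ('a \<Rightarrow> real) \<Rightarrow> ennreal" where
  "sup_norm S f = (SUP w\<in>S. ennreal \<bar>f w\<bar>)"

text \<open>Functions on \<open>S\<close> are represented by members of \<open>extensional S\<close>, so that functions agreeing
  on \<open>S\<close> are equal.\<close>

definition sup_closed :: "'a set \<Rightarrow> ('a \<Rightarrow> real) set \<Rightarrow> bool" where
  "sup_closed S F \<longleftrightarrow>
     (\<forall>f g. (\<forall>j::nat. f j \<in> F) \<and> g \<in> extensional S \<and> uniform_limit S f g sequentially \<longrightarrow> g \<in> F)"

definition sieve :: "'a set \<Rightarrow> ('a \<Rightarrow> real) set \<Rightarrow> (nat \<Rightarrow> 'a \<Rightarrow> real) \<Rightarrow> nat \<Rightarrow> ('a \<Rightarrow> real) set" where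
  "sieve S \<Delta> \<psi> q = {\<delta>\<in>\<Delta>. \<exists>\<beta>. \<forall>w\<in>S. \<delta> w = (\<Sum>j<q. \<beta> j * \<psi> j w)}"

definition hausdorff_semidist ::
    "(('a \<Rightarrow> real) \<Rightarrow> ennreal) \<Rightarrow> ('a \<Rightarrow> real) set \<Rightarrow> ('a \<Rightarrow> real) set \<Rightarrow> ennreal" where
  "hausdorff_semidist N F G = (SUP f\<in>F. INF g\<in>G. N (\<lambda>w. f w - g w))"

definition hausdorff_dist ::
    "(('a \<Rightarrow> real) \<Rightarrow> ennreal) \<Rightarrow> ('a \<Rightarrow> real) set \<Rightarrow> ('a \<Rightarrow> real) set \<Rightarrow> ennreal" where
  "hausdorff_dist N F G = max (hausdorff_semidist N F G) (hausdorff_semidist N G F)"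

definition ennreal_bigo :: "(nat \<Rightarrow> ennreal) \<Rightarrow> (nat \<Rightarrow> real) \<Rightarrow> bool" where
  "ennreal_bigo f r \<longleftrightarrow> (\<exists>C>0. \<forall>\<^sub>F n in sequentially. f n \<le> ennreal (C * \<bar>r n\<bar>))"

text \<open>Outer probability is used because Hausdorff distances between random sets involve suprema
  over uncountable families; it equals the probability on every measurable event.\<close>

definition oP_one :: "'s measure \<Rightarrow> (nat \<Rightarrow> 's \<Rightarrow> ennreal) \<Rightarrow> bool" where
  "oP_one M T \<longleftrightarrow>
     (\<forall>\<epsilon>>0. (\<lambda>n. outer_measure_of M {\<omega>\<in>space M. ennreal \<epsilon> < T n \<omega>}) \<longlonglongrightarrow> 0)"

definition OP :: "'s measure \<Rightarrow> (nat \<Rightarrow> 's \<Rightarrow> ennreal) \<Rightarrow> (nat \<Rightarrow> real) \<Rightarrow> bool" where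
  "OP M T r \<longleftrightarrow>
     (\<forall>\<epsilon>>0. \<exists>C>0. \<forall>\<^sub>F n in sequentially.
        outer_measure_of M {\<omega>\<in>space M. ennreal (C * \<bar>r n\<bar>) < T n \<omega>} \<le> ennreal \<epsilon>)"

text \<open>\<open>E(B | R, X, Y)\<close>; its values on the event \<open>R = 1\<close> are those of \<open>E(B | R = 1, X, Y)\<close>, and it is
  only used on that event below.\<close>

definition cond_mean :: "'s measure \<Rightarrow> ('s \<Rightarrow> real) \<Rightarrow> ('s \<Rightarrow> 'x::euclidean_space) \<Rightarrow> ('s \<Rightarrow> real) \<Rightarrow>
    ('s \<Rightarrow> real) \<Rightarrow> 's \<Rightarrow> real" where
  "cond_mean M R X Y B =
     real_cond_exp M (vimage_algebra (space M) (\<lambda>\<omega>. (R \<omega>, X \<omega>, Y \<omega>)) borel) B"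

text \<open>\<open>g\<close> is a version of the function \<open>(x, y) \<mapsto> E(B | R = 1, X = x, Y = y)\<close>.\<close>

definition is_regression :: "'s measure \<Rightarrow> ('s \<Rightarrow> real) \<Rightarrow> ('s \<Rightarrow> 'x::euclidean_space) \<Rightarrow>
    ('s \<Rightarrow> real) \<Rightarrow> ('s \<Rightarrow> real) \<Rightarrow> ('x \<times> real \<Rightarrow> real) \<Rightarrow> bool" where
  "is_regression M R X Y B g \<longleftrightarrow>
     g \<in> borel_measurable borel \<and>
     (AE \<omega> in M. R \<omega> = 1 \<longrightarrow> cond_mean M R X Y B \<omega> = g (X \<omega>, Y \<omega>))"

definition weak_norm :: "'s measure \<Rightarrow> ('s \<Rightarrow> real) \<Rightarrow> ('s \<Rightarrow> 'x::euclidean_space) \<Rightarrow> ('s \<Rightarrow> real) \<Rightarrow>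
    ('s \<Rightarrow> real) \<Rightarrow> ('x \<times> real \<Rightarrow> real) \<Rightarrow> ennreal" where
  "weak_norm M R X Y Z \<delta> =
     ennreal (sqrt (\<integral>\<omega>. R \<omega> * (cond_mean M R X Y (\<lambda>\<omega>. \<delta> (X \<omega>, Z \<omega>)) \<omega>)\<^sup>2 \<partial>M))"

text \<open>Samples \<open>r, x, y, z\<close> and basis functions are indexed from \<open>0\<close>: observations are \<open>i < n\<close> and
  basis functions \<open>j < k\<close>.\<close>

definition basis_vec :: "(nat \<Rightarrow> 'w \<Rightarrow> real) \<Rightarrow> nat \<Rightarrow> 'w \<Rightarrow> real Matrix.vec" where
  "basis_vec \<phi> k w = Matrix.vec k (\<lambda>j. \<phi> j w)"

definition design_mat :: "(nat \<Rightarrow> 'w \<Rightarrow> real) \<Rightarrow> nat \<Rightarrow> nat \<Rightarrow> (nat \<Rightarrow> 'w) \<Rightarrow> real Matrix.mat" where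
  "design_mat \<phi> k n w = Matrix.mat n k (\<lambda>(i, j). \<phi> j (w i))"

text \<open>The value for singular matrices is a convention.\<close>

definition mat_inv_or_zero :: "real Matrix.mat \<Rightarrow> real Matrix.mat" where
  "mat_inv_or_zero A =
     (case mat_inverse A of Some B \<Rightarrow> B | None \<Rightarrow> zero_mat (dim_row A) (dim_col A))"

definition series_reg :: "(nat \<Rightarrow> 'w \<Rightarrow> real) \<Rightarrow> nat \<Rightarrow> nat \<Rightarrow> (nat \<Rightarrow> real) \<Rightarrow> (nat \<Rightarrow> 'w) \<Rightarrow>
    (nat \<Rightarrow> real) \<Rightarrow> 'w \<Rightarrow> real" where
  "series_reg \<phi> k n r w B v =
     (let P = design_mat \<phi> k n w; L = mat_diag n r in
      scalar_prod (basis_vec \<phi> k v)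
        (mult_mat_vec (mat_inv_or_zero (transpose_mat P * L * P))
           (Matrix.vec k (\<lambda>j. \<Sum>i<n. r i * \<phi> j (w i) * B i))))"

definition criterion :: "(nat \<Rightarrow> 'x \<times> real \<Rightarrow> real) \<Rightarrow> nat \<Rightarrow> ('x \<times> real \<Rightarrow> real) \<Rightarrow> nat \<Rightarrow>
    (nat \<Rightarrow> real) \<Rightarrow> (nat \<Rightarrow> 'x) \<Rightarrow> (nat \<Rightarrow> real) \<Rightarrow> (nat \<Rightarrow> real) \<Rightarrow> ('x \<times> real \<Rightarrow> real) \<Rightarrow> real" where
  "criterion \<phi> k \<tau> n r x y z \<delta> =
     (\<Sum>i<n. r i * (series_reg \<phi> k n r (\<lambda>l. (x l, y l))
                     (\<lambda>l. \<tau> (x l, y l) - \<delta> (x l, z l)) (x i, y i))\<^sup>2) / real n"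

text \<open>The matrix \<open>E(R \<phi>(X,Y) \<phi>(X,Y)\<^sup>T)\<close>. If some \<open>R \<phi>\<^sub>i(X,Y)\<^sup>2\<close> is not integrable, the corresponding
  diagonal entry is \<open>0\<close>, and the smallest eigenvalue is then not positive.\<close>

definition gram_mat :: "'s measure \<Rightarrow> ('s \<Rightarrow> real) \<Rightarrow> ('s \<Rightarrow> 'x) \<Rightarrow> ('s \<Rightarrow> real) \<Rightarrow>
    (nat \<Rightarrow> 'x \<times> real \<Rightarrow> real) \<Rightarrow> nat \<Rightarrow> real Matrix.mat" where
  "gram_mat M R X Y \<phi> k =
     Matrix.mat k k (\<lambda>(i, j). \<integral>\<omega>. R \<omega> * \<phi> i (X \<omega>, Y \<omega>) * \<phi> j (X \<omega>, Y \<omega>) \<partial>M)"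

end

theory Submission
  imports Defs "HOL-Complex_Analysis.Great_Picard"
begin

text \<open>Write \<open>w(\<delta>)\<close> for the squared weak distance \<open>E[R (\<tau> - E(\<delta> | R, X, Y))\<^sup>2]\<close> of \<open>\<delta>\<close> from the solution set,
\<open>h(\<delta>)\<close> for the vector of sample moments of \<open>R \<phi>\<^sub>j (\<tau> - \<delta>)\<close> over \<open>j < k\<^sub>n\<close>, \<open>H(\<delta>)\<close> for its expectation,
\<open>G\<close> for the sample version of the matrix \<open>\<Gamma> = E[R \<phi> \<phi>\<^sup>T]\<close>, and \<open>r\<^sub>n\<close> for the rate \<open>k\<^sub>n\<close> to the power
\<open>-\<alpha>/(d+1)\<close>. The theorem holds because, with high probability, the criterion \<open>Q\<^sub>n\<close> and \<open>w\<close> are equivalent on the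
whole of \<open>\<Delta>\<close> up to constant factors and an additive error of order at most \<open>\<lambda>\<^sub>n\<close> (lemma \<open>criterion_comparable\<close>):

  \<^item> The normal equations turn the criterion into \<open>h\<^sup>T G\<^sup>-\<^sup>1 h\<close>. As \<open>\<Gamma>\<close> has its eigenvalues in \<open>[l, u]\<close> and \<open>G\<close>
    is close to \<open>\<Gamma>\<close> in Frobenius norm with high probability (this needs \<open>\<xi>\<^sub>n\<^sup>2 k\<^sub>n = o(n)\<close>), the criterion is
    comparable to \<open>|h|\<^sup>2\<close>.

  \<^item> Uniformly over \<open>\<Delta>\<close>, \<open>|h - H|\<^sup>2\<close> is of order \<open>k\<^sub>n/n\<close> (\<open>expected_moment_dev_bound\<close>).

  \<^item> Bessel's inequality gives \<open>|H|\<^sup>2 \<le> u w\<close>, and if the residual \<open>\<tau> - E(\<delta> | R, X, Y)\<close> is within \<open>r\<close> of the span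
    of the \<open>\<phi>\<^sub>j\<close> then \<open>w \<le> 4 |H|\<^sup>2 / l + 6 r\<^sup>2\<close> (\<open>projection_coefficients_bounds\<close>).

Since \<open>c\<^sub>n / \<lambda>\<^sub>n \<rightarrow> \<infinity>\<close>, the sieve approximations of all solutions eventually lie in the estimated set, while
every \<open>\<delta>\<close> in the estimated set has \<open>w(\<delta>) = O(c\<^sub>n)\<close>; this is the rate in the weak norm. The class \<open>\<Delta>\<close> is compact
in the supremum norm by Arzela--Ascoli and \<open>w\<close> is continuous with zero set \<open>\<Delta>\<^sub>0\<close>, so a small value of \<open>w\<close>
forces a small uniform distance to \<open>\<Delta>\<^sub>0\<close> (\<open>well_separated_zeros\<close>); this is the consistency.

The uniform bound on \<open>h - H\<close> is where \<open>\<alpha> > (d+1)/2\<close> enters. A smooth function on a box in \<open>D = d + 1\<close> dimensions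
is expanded in a tensor product Haar system. Its component at levels \<open>J = (J\<^sub>1, \<dots>, J\<^sub>D)\<close> is a mixed first
difference, constant on \<open>2\<close> to the power \<open>|J| = J\<^sub>1 + \<dots> + J\<^sub>D\<close> cells, and differentiating once in each of the
directions with the largest levels bounds it by \<open>2\<close> to the power \<open>-\<kappa>|J|\<close>, where
\<open>\<kappa> = min(\<alpha>, D)/D > 1/2\<close> (\<open>mixed_diff_decay\<close>, \<open>decay_exponent_sorted\<close>). So all of \<open>\<Delta>\<close> is spanned by one
sequence of indicator functions with coefficients that decay fast enough for a weighted Cauchy--Schwarz
inequality to bound the supremum over \<open>\<Delta>\<close> of an empirical deviation by a series of squared deviations of
single functions (\<open>emp_dev_series_bound\<close>). The expectation of that series is a sum of variances.\<close>

section \<open>Mixed dyadic differences of smooth functions\<close>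

definition grid_round :: "real \<Rightarrow> real \<Rightarrow> nat \<Rightarrow> real \<Rightarrow> real" where
  "grid_round lo L j t = lo + L * of_int \<lfloor>2 ^ j * (t - lo) / L\<rfloor> / 2 ^ j"

lemma grid_round_le: "0 < L \<Longrightarrow> grid_round lo L j t \<le> t"
proof -
  assume L: "0 < L"
  have "L * of_int \<lfloor>2 ^ j * (t - lo) / L\<rfloor> \<le> L * (2 ^ j * (t - lo) / L)"
    using L by (intro mult_left_mono) auto
  also have "\<dots> = (t - lo) * 2 ^ j" using L by simp
  finally have "L * of_int \<lfloor>2 ^ j * (t - lo) / L\<rfloor> / 2 ^ j \<le> t - lo"
    by (simp add: divide_le_eq)
  then show ?thesis by (simp add: grid_round_def)
qed

lemma grid_round_ge: "0 < L \<Longrightarrow> t - L / 2 ^ j \<le> grid_round lo L j t"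
proof -
  assume L: "0 < L"
  have "L * (2 ^ j * (t - lo) / L) \<le> L * (of_int \<lfloor>2 ^ j * (t - lo) / L\<rfloor> + 1)"
    using L by (intro mult_left_mono) linarith+
  moreover have "L * (2 ^ j * (t - lo) / L) = (t - lo) * 2 ^ j"
    using L by simp
  ultimately have "(t - lo) * 2 ^ j \<le> L * of_int \<lfloor>2 ^ j * (t - lo) / L\<rfloor> + L"
    by (simp only: distrib_left mult_1_right)
  then have "t - lo \<le> (L * of_int \<lfloor>2 ^ j * (t - lo) / L\<rfloor> + L) / 2 ^ j"
    by (simp add: le_divide_eq)
  then show ?thesis by (simp add: grid_round_def add_divide_distrib)
qed

lemma grid_round_ge_lower: "0 < L \<Longrightarrow> lo \<le> t \<Longrightarrow> lo \<le> grid_round lo L j t"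
  by (simp add: grid_round_def)

text \<open>Dyadic grids are nested, so the finer cell of a point determines its coarser cell.\<close>

lemma grid_round_pred_determined:
  assumes "\<lfloor>2 ^ j * (t - lo) / L\<rfloor> = \<lfloor>2 ^ j * (t' - lo) / L\<rfloor>"
  shows "grid_round lo L (j - 1) t = grid_round lo L (j - 1) t'"
proof (cases j)
  case 0
  then show ?thesis using assms by (simp add: grid_round_def)
next
  case (Suc i)
  have "\<lfloor>2 ^ i * (u - lo) / L\<rfloor> = \<lfloor>2 ^ j * (u - lo) / L\<rfloor> div 2" for u
  proof -
    have "2 ^ i * (u - lo) / L = (2 ^ j * (u - lo) / L) / real_of_int 2"
      by (simp add: Suc)
    then show ?thesis using floor_divide_real_eq_div[of 2] by (metis zero_le_numeral)
  qed
  then show ?thesis using assms by (simp add: grid_round_def Suc)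
qed

text \<open>With \<open>s\<close> derivatives that are \<open>\<gamma>\<close>-Hoelder, a mixed difference gains one full factor \<open>2\<close> to the power \<open>-j\<close> from each of
the first \<open>s\<close> directions, a fractional one from the next direction, and nothing from the others.\<close>

fun decay_exponent :: "real \<Rightarrow> nat \<Rightarrow> nat list \<Rightarrow> real" where
  "decay_exponent \<gamma> s [] = 0"
| "decay_exponent \<gamma> 0 (j # js) = \<gamma> * real j"
| "decay_exponent \<gamma> (Suc s) (j # js) = real j + decay_exponent \<gamma> s js"

lemma sum_list_le_length_times:
  fixes j :: nat
  shows "(\<And>x. x \<in> set js \<Longrightarrow> x \<le> j) \<Longrightarrow> sum_list js \<le> length js * j"
  by (induction js) (auto simp: add_mono)

text \<open>If the levels are decreasing, the weights \<open>1, \<dots>, 1, \<gamma>, 0, \<dots>, 0\<close> are largest where the levels are largest, so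
the weighted sum is at least the product of the mean weight and the sum of the levels.\<close>

lemma decay_exponent_sorted:
  assumes "sorted_wrt (\<ge>) js" "0 < \<gamma>" "\<gamma> \<le> 1"
  shows "min (real s + \<gamma>) (real (length js)) * real (sum_list js)
    \<le> real (length js) * decay_exponent \<gamma> s js"
  using assms(1)
proof (induction js arbitrary: s)
  case Nil
  then show ?case by simp
next
  case (Cons j js)
  define m S' where "m = real (length js)" and "S' = real (sum_list js)"
  have S': "S' \<le> m * real j"
    using Cons.prems sum_list_le_length_times[of js j] unfolding S'_def m_def
    by (metis of_nat_le_iff of_nat_mult sorted_wrt.simps(2))
  have m0: "0 \<le> m" and S0: "0 \<le> S'" by (auto simp: m_def S'_def)
  show ?case
  proof (cases s)
    case 0
    have "\<gamma> * (real j + S') \<le> \<gamma> * (real j + m * real j)"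
      using S' assms by (intro mult_left_mono) auto
    moreover have "min \<gamma> (m + 1) = \<gamma>" using assms m0 by simp
    ultimately show ?thesis
      using 0 by (simp add: m_def[symmetric] S'_def[symmetric] algebra_simps)
  next
    case (Suc s')
    define q d where "q = min (real s' + \<gamma>) m" and "d = decay_exponent \<gamma> s' js"
    have IH: "q * S' \<le> m * d"
      using Cons by (simp add: q_def m_def S'_def d_def)
    have q: "min (real s + \<gamma>) (m + 1) = q + 1" by (simp add: Suc q_def)
    have goal: "(q + 1) * (real j + S') \<le> (m + 1) * (real j + d)"
    proof (cases "js = []")
      case True
      then show ?thesis using assms by (simp add: m_def S'_def d_def q_def)
    next
      case False
      then have mpos: "0 < m" by (simp add: m_def)
      have "0 \<le> (m - q) * (m * real j - S')"
        using S' by (intro mult_nonneg_nonneg) (auto simp: q_def)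
      moreover have "(m + 1) * (q * S') \<le> (m + 1) * (m * d)"
        using IH m0 by (intro mult_left_mono) auto
      ultimately have "m * ((q + 1) * (real j + S')) \<le> m * ((m + 1) * (real j + d))"
        by (simp add: algebra_simps)
      then show ?thesis using mpos by simp
    qed
    show ?thesis
      using goal q Suc by (simp add: m_def[symmetric] S'_def[symmetric] d_def add.commute)
  qed
qed

text \<open>A Haar component in one direction: the difference of two consecutive dyadic discretisations of the argument. At
level \<open>0\<close> it is the coarsest discretisation itself, so that the components telescope.\<close>

definition level_diff ::
    "('i \<Rightarrow> nat \<Rightarrow> real \<Rightarrow> real) \<Rightarrow> ('i \<Rightarrow> nat) \<Rightarrow> 'i \<Rightarrow> (('i \<Rightarrow> real) \<Rightarrow> real) \<Rightarrow> ('i \<Rightarrow> real) \<Rightarrow> real" where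
  "level_diff r J b F v = F (v(b := r b (J b) (v b)))
     - (if J b = 0 then 0 else F (v(b := r b (J b - 1) (v b))))"

definition mixed_diff ::
    "('i \<Rightarrow> nat \<Rightarrow> real \<Rightarrow> real) \<Rightarrow> ('i \<Rightarrow> nat) \<Rightarrow> 'i list \<Rightarrow> (('i \<Rightarrow> real) \<Rightarrow> real) \<Rightarrow> ('i \<Rightarrow> real) \<Rightarrow> real" where
  "mixed_diff r J xs F = foldr (level_diff r J) xs F"

lemma mixed_diff_Nil [simp]: "mixed_diff r J [] F = F"
  by (simp add: mixed_diff_def)

lemma mixed_diff_Cons: "mixed_diff r J (b # xs) F = level_diff r J b (mixed_diff r J xs F)"
  by (simp add: mixed_diff_def)

lemma level_diff_commute:
  "level_diff r J b (level_diff r J b' F) = level_diff r J b' (level_diff r J b F)"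
proof (cases "b = b'")
  case False
  show ?thesis
    by (rule ext) (use False in \<open>simp add: level_diff_def fun_upd_twist algebra_simps\<close>)
qed simp

text \<open>The operators of different directions commute; this allows each level vector its own ordering of the directions.\<close>

lemma mixed_diff_perm:
  assumes "mset xs = mset ys"
  shows "mixed_diff r J xs F = mixed_diff r J ys F"
proof -
  have "List.fold (level_diff r J) (rev xs) = List.fold (level_diff r J) (rev ys)"
    by (rule fold_multiset_equiv) (use assms in \<open>auto simp: fun_eq_iff level_diff_commute[THEN fun_cong]\<close>)
  then show ?thesis
    by (simp add: mixed_diff_def foldr_conv_fold)
qed

lemma mixed_diff_cong_levels:
  assumes "\<And>b. b \<in> set xs \<Longrightarrow> J b = J' b"
  shows "mixed_diff r J xs F = mixed_diff r J' xs F"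
  using assms by (induction xs) (auto simp: mixed_diff_Cons level_diff_def fun_eq_iff)

lemma sum_mixed_diff:
  assumes "distinct xs"
  shows "(\<Sum>J\<in>PiE (set xs) (\<lambda>_. {..N}). mixed_diff r J xs F v)
    = F (\<lambda>b. if b \<in> set xs then r b N (v b) else v b)"
  using assms
proof (induction xs arbitrary: v)
  case Nil
  then show ?case by simp
next
  case (Cons b xs)
  have inj: "inj_on (\<lambda>(j, J). J(b := j)) ({..N} \<times> PiE (set xs) (\<lambda>_. {..N}))"
    using Cons.prems by (intro inj_combinator) auto
  have eq: "mixed_diff r (J(b := j)) (b # xs) F v
     = mixed_diff r J xs F (v(b := r b j (v b)))
       - (if j = 0 then 0 else mixed_diff r J xs F (v(b := r b (j - 1) (v b))))" for J j
  proof -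
    have "mixed_diff r (J(b := j)) xs F = mixed_diff r J xs F"
      using Cons.prems by (intro mixed_diff_cong_levels) auto
    then show ?thesis by (simp add: mixed_diff_Cons level_diff_def)
  qed
  have tele: "(\<Sum>j\<le>N. h j - (if j = 0 then 0 else h (j - 1))) = h N" for h :: "nat \<Rightarrow> real"
    by (induction N) auto
  have "(\<Sum>J\<in>PiE (set (b # xs)) (\<lambda>_. {..N}). mixed_diff r J (b # xs) F v)
    = (\<Sum>(j, J)\<in>{..N} \<times> PiE (set xs) (\<lambda>_. {..N}). mixed_diff r (J(b := j)) (b # xs) F v)"
    using sum.reindex[OF inj, of "\<lambda>J. mixed_diff r J (b # xs) F v"]
    by (simp add: PiE_insert_eq case_prod_unfold comp_def)
  also have "\<dots> = (\<Sum>J\<in>PiE (set xs) (\<lambda>_. {..N}). \<Sum>j\<le>N. mixed_diff r (J(b := j)) (b # xs) F v)"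
    by (subst sum.cartesian_product[symmetric], rule sum.swap)
  also have "\<dots> = (\<Sum>J\<in>PiE (set xs) (\<lambda>_. {..N}). mixed_diff r J xs F (v(b := r b N (v b))))"
    unfolding eq by (intro sum.cong refl tele)
  also have "\<dots> = F (\<lambda>b'. if b' \<in> set xs then r b' N ((v(b := r b N (v b))) b') else (v(b := r b N (v b))) b')"
    using Cons by simp
  also have "\<dots> = F (\<lambda>b'. if b' \<in> set (b # xs) then r b' N (v b') else v b')"
    using Cons.prems by (intro arg_cong[where f = F]) auto
  finally show ?case .
qed

text \<open>A box with sides shorter than \<open>L\<close>, so that at level \<open>0\<close> every point is rounded to the lower corner. Points are
coordinate functions on the index set \<open>I\<close>, which makes replacing one coordinate a function update.\<close>

locale dyadic_box =
  fixes I :: "'i set" and lo hi :: "'i \<Rightarrow> real" and L :: real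
  assumes finite_I: "finite I"
    and lo_le_hi: "\<And>b. b \<in> I \<Longrightarrow> lo b \<le> hi b"
    and side: "\<And>b. b \<in> I \<Longrightarrow> hi b - lo b < L"
    and L_ge_1: "1 \<le> L"
begin

definition box_coords :: "('i \<Rightarrow> real) set" where
  "box_coords = {v. \<forall>b\<in>I. v b \<in> {lo b..hi b}}"

definition rnd :: "'i \<Rightarrow> nat \<Rightarrow> real \<Rightarrow> real" where
  "rnd b = grid_round (lo b) L"

lemma L_pos: "0 < L" using L_ge_1 by simp

lemma rnd_in:
  assumes "b \<in> I" "t \<in> {lo b..hi b}"
  shows "rnd b j t \<in> {lo b..hi b}"
  using grid_round_le[OF L_pos, of "lo b" j t] grid_round_ge_lower[OF L_pos, of "lo b" t j] assms
  by (auto simp: rnd_def)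

lemma upd_box: "v \<in> box_coords \<Longrightarrow> (b \<in> I \<Longrightarrow> t \<in> {lo b..hi b}) \<Longrightarrow> v(b := t) \<in> box_coords"
  by (auto simp: box_coords_def)

lemma upd_rnd_box: "v \<in> box_coords \<Longrightarrow> b \<in> I \<Longrightarrow> v(b := rnd b j (v b)) \<in> box_coords"
  using rnd_in[of b "v b" j] by (intro upd_box) (auto simp: box_coords_def)

lemma rnd_levels_close:
  assumes "0 < j"
  shows "\<bar>rnd b j t - rnd b (j - 1) t\<bar> \<le> 2 * L * 2 powr (- real j)"
proof -
  have "L / 2 ^ (j - 1) = 2 * L * 2 powr (- real j)"
  proof (cases j)
    case (Suc i)
    have "(2::real) powr (- real (Suc i)) = inverse (2 ^ Suc i)"
      by (simp only: powr_minus powr_realpow[of 2 "Suc i"] zero_less_numeral)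
    then show ?thesis by (simp add: Suc field_simps)
  qed (use assms in simp)
  moreover have "L / 2 ^ j \<le> L / 2 ^ (j - 1)"
    using L_pos by (intro divide_left_mono power_increasing) auto
  ultimately show ?thesis
    using grid_round_le[OF L_pos, of "lo b" j t] grid_round_ge[OF L_pos, of t j "lo b"]
      grid_round_le[OF L_pos, of "lo b" "j - 1" t] grid_round_ge[OF L_pos, of t "j - 1" "lo b"]
    unfolding rnd_def by linarith
qed

lemma mixed_diff_bounded:
  assumes "set xs \<subseteq> I" "\<And>v. v \<in> box_coords \<Longrightarrow> \<bar>F v\<bar> \<le> M" "v \<in> box_coords"
  shows "\<bar>mixed_diff rnd J xs F v\<bar> \<le> 2 ^ length xs * M"
  using assms(1,3)
proof (induction xs arbitrary: v)
  case Nil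
  then show ?case using assms by simp
next
  case (Cons b xs)
  have "\<bar>mixed_diff rnd J xs F (v(b := rnd b j (v b)))\<bar> \<le> 2 ^ length xs * M" for j
    using Cons by (intro Cons.IH upd_rnd_box) auto
  note H = this[of "J b"] this[of "J b - 1"]
  show ?case using H by (auto simp: mixed_diff_Cons level_diff_def)
qed

lemma mixed_diff_increment:
  assumes "set xs \<subseteq> I" "b \<in> I" "b \<notin> set xs"
    and "\<And>v t t'. v \<in> box_coords \<Longrightarrow> t \<in> {lo b..hi b} \<Longrightarrow> t' \<in> {lo b..hi b} \<Longrightarrow>
      \<bar>F (v(b := t)) - F (v(b := t'))\<bar> \<le> M t t'"
    and "v \<in> box_coords" "t \<in> {lo b..hi b}" "t' \<in> {lo b..hi b}"
  shows "\<bar>mixed_diff rnd J xs F (v(b := t)) - mixed_diff rnd J xs F (v(b := t'))\<bar>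
    \<le> 2 ^ length xs * M t t'"
  using assms(1,3,5)
proof (induction xs arbitrary: v)
  case Nil
  then show ?case using assms by (simp del: fun_upd_apply)
next
  case (Cons b' xs)
  have "\<bar>mixed_diff rnd J xs F (v(b' := rnd b' j (v b'), b := t))
      - mixed_diff rnd J xs F (v(b' := rnd b' j (v b'), b := t'))\<bar> \<le> 2 ^ length xs * M t t'" for j
    using Cons by (intro Cons.IH upd_rnd_box) auto
  note H = this[of "J b'"] this[of "J b' - 1"]
  have ne: "b \<noteq> b'" using Cons by auto
  have "\<bar>p\<bar> \<le> c \<Longrightarrow> \<bar>q\<bar> \<le> c \<Longrightarrow> \<bar>p - q\<bar> \<le> 2 * c" for p q c :: real by linarith
  note T = this[OF H]
  have "0 \<le> 2 ^ length xs * M t t'" using H(1) by linarith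
  then show ?case
    using H(1) T ne
    by (cases "J b' = 0") (simp_all add: mixed_diff_Cons level_diff_def fun_upd_twist[OF ne]
        fun_upd_other algebra_simps del: fun_upd_apply)
qed

text \<open>Differences in other directions only shift other coordinates, so they commute with differentiation.\<close>

lemma mixed_diff_has_derivative:
  assumes "set xs \<subseteq> I" "b \<in> I" "b \<notin> set xs"
    and "\<And>v t. v \<in> box_coords \<Longrightarrow> t \<in> {lo b..hi b} \<Longrightarrow>
      ((\<lambda>t. F (v(b := t))) has_real_derivative F' (v(b := t))) (at t within {lo b..hi b})"
    and "v \<in> box_coords" "t \<in> {lo b..hi b}"
  shows "((\<lambda>t. mixed_diff rnd J xs F (v(b := t))) has_real_derivative
    mixed_diff rnd J xs F' (v(b := t))) (at t within {lo b..hi b})"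
  using assms(1,3,5)
proof (induction xs arbitrary: v)
  case Nil
  then show ?case using assms(4)[OF _ assms(6)] by (simp del: fun_upd_apply)
next
  case (Cons b' xs)
  have "((\<lambda>t. mixed_diff rnd J xs F (v(b' := rnd b' j (v b'), b := t))) has_real_derivative
      mixed_diff rnd J xs F' (v(b' := rnd b' j (v b'), b := t))) (at t within {lo b..hi b})" for j
    using Cons by (intro Cons.IH upd_rnd_box) auto
  note H = this[of "J b'"] this[of "J b' - 1"]
  have ne: "b' \<noteq> b" using Cons by auto
  show ?case
    using H[unfolded fun_upd_twist[OF ne]] ne
    by (cases "J b' = 0")
      (auto simp: mixed_diff_Cons level_diff_def fun_upd_other simp del: fun_upd_apply intro!: DERIV_diff)
qed

lemma increment_le_of_derivative_bound:
  assumes "\<And>v t. v \<in> box_coords \<Longrightarrow> t \<in> {lo b..hi b} \<Longrightarrow>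
      ((\<lambda>t. F (v(b := t))) has_real_derivative F' (v(b := t))) (at t within {lo b..hi b})"
    and "b \<in> I" "\<And>v. v \<in> box_coords \<Longrightarrow> \<bar>F' v\<bar> \<le> M"
    and "v \<in> box_coords" "t \<in> {lo b..hi b}" "t' \<in> {lo b..hi b}"
  shows "\<bar>F (v(b := t)) - F (v(b := t'))\<bar> \<le> M * \<bar>t - t'\<bar>"
proof -
  have "norm (F (v(b := t)) - F (v(b := t'))) \<le> M * norm (t - t')"
    by (rule field_differentiable_bound[where S = "{lo b..hi b}" and f' = "\<lambda>t. F' (v(b := t))"])
      (use assms upd_box[OF assms(4)] in \<open>auto simp del: fun_upd_apply\<close>)
  then show ?thesis by simp
qed

text \<open>\<open>F l\<close> is the partial derivative with multi-index \<open>l\<close>, and \<open>s\<close> bounds the number of derivatives still available.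
Going through the directions in the given order, the mean value theorem trades a derivative for a factor of the mesh
size. When none is left, the Hoelder condition is used once, and every later direction costs a factor \<open>2\<close>.\<close>

lemma mixed_diff_decay:
  fixes F :: "('i \<Rightarrow> nat) \<Rightarrow> ('i \<Rightarrow> real) \<Rightarrow> real"
  assumes \<gamma>: "0 < \<gamma>" "\<gamma> \<le> 1" and K: "0 \<le> K"
    and deriv: "\<And>l b v t. (\<forall>b. b \<notin> I \<longrightarrow> l b = 0) \<Longrightarrow> sum l I < p \<Longrightarrow> b \<in> I \<Longrightarrow> v \<in> box_coords \<Longrightarrow>
      t \<in> {lo b..hi b} \<Longrightarrow> ((\<lambda>t. F l (v(b := t))) has_real_derivative F (l(b := Suc (l b))) (v(b := t)))
        (at t within {lo b..hi b})"
    and bound: "\<And>l v. (\<forall>b. b \<notin> I \<longrightarrow> l b = 0) \<Longrightarrow> sum l I \<le> p \<Longrightarrow> v \<in> box_coords \<Longrightarrow> \<bar>F l v\<bar> \<le> K"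
    and holder: "\<And>l b v t t'. (\<forall>b. b \<notin> I \<longrightarrow> l b = 0) \<Longrightarrow> sum l I \<le> p \<Longrightarrow> b \<in> I \<Longrightarrow> v \<in> box_coords \<Longrightarrow>
      t \<in> {lo b..hi b} \<Longrightarrow> t' \<in> {lo b..hi b} \<Longrightarrow> \<bar>F l (v(b := t)) - F l (v(b := t'))\<bar> \<le> K * \<bar>t - t'\<bar> powr \<gamma>"
    and "set xs \<subseteq> I" "distinct xs" "v \<in> box_coords" "\<forall>b. b \<notin> I \<longrightarrow> l b = 0" "sum l I + s \<le> p"
  shows "\<bar>mixed_diff rnd J xs (F l) v\<bar>
    \<le> K * (2 * L) ^ length xs * 2 powr (- decay_exponent \<gamma> s (map J xs))"
  using assms(7-)
proof (induction xs arbitrary: v l s)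
  case Nil
  then show ?case using bound[of l v] by simp
next
  case (Cons b xs)
  have bI: "b \<in> I" and b_xs: "b \<notin> set xs" and xsI: "set xs \<subseteq> I" and dist: "distinct xs"
    using Cons.prems by auto
  have vb: "v b \<in> {lo b..hi b}" using Cons.prems bI by (auto simp: box_coords_def)
  have r: "rnd b j (v b) \<in> {lo b..hi b}" for j using rnd_in[OF bI vb] .
  have pow_le: "(2::real) ^ n \<le> (2 * L) ^ n" for n
    using L_ge_1 by (intro power_mono) auto
  let ?c = "(2 * L) ^ length xs"
  have c0: "0 \<le> ?c" using L_pos by simp
  have head: "\<bar>mixed_diff rnd J (b # xs) (F l) v\<bar> = (if J b = 0
      then \<bar>mixed_diff rnd J xs (F l) (v(b := rnd b 0 (v b)))\<bar>
      else \<bar>mixed_diff rnd J xs (F l) (v(b := rnd b (J b) (v b)))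
         - mixed_diff rnd J xs (F l) (v(b := rnd b (J b - 1) (v b)))\<bar>)"
    by (simp add: mixed_diff_Cons level_diff_def)
  show ?case
  proof (cases s)
    case 0
    show ?thesis
    proof (cases "J b = 0")
      case True
      have "\<bar>mixed_diff rnd J xs (F l) (v(b := rnd b 0 (v b)))\<bar> \<le> 2 ^ length xs * K"
        using Cons.prems bI by (intro mixed_diff_bounded upd_rnd_box bound) auto
      also have "\<dots> \<le> ?c * K" using K by (intro mult_right_mono pow_le)
      also have "\<dots> \<le> K * (2 * L) ^ length (b # xs)"
        using L_ge_1 K c0 mult_right_mono[of 1 "2 * L" "?c * K"] by (simp add: algebra_simps)
      finally show ?thesis using head True 0 by simp
    next
      case False
      let ?d = "\<bar>rnd b (J b) (v b) - rnd b (J b - 1) (v b)\<bar>"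
      have "\<bar>mixed_diff rnd J xs (F l) (v(b := rnd b (J b) (v b)))
         - mixed_diff rnd J xs (F l) (v(b := rnd b (J b - 1) (v b)))\<bar>
        \<le> 2 ^ length xs * (K * ?d powr \<gamma>)"
        by (rule mixed_diff_increment[OF xsI bI b_xs, where M = "\<lambda>t t'. K * \<bar>t - t'\<bar> powr \<gamma>"])
          (use Cons.prems bI r holder in auto)
      also have "\<dots> \<le> ?c * (K * (2 * L * 2 powr (- \<gamma> * real (J b))))"
      proof -
        have "?d powr \<gamma> \<le> (2 * L * 2 powr (- real (J b))) powr \<gamma>"
          using False \<gamma> by (intro powr_mono2 rnd_levels_close) auto
        also have "\<dots> = (2 * L) powr \<gamma> * 2 powr (- \<gamma> * real (J b))"
          using L_pos by (simp add: powr_mult powr_powr mult.commute)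
        also have "\<dots> \<le> (2 * L) powr 1 * 2 powr (- \<gamma> * real (J b))"
          using L_ge_1 \<gamma> by (intro mult_right_mono powr_mono) auto
        finally have "?d powr \<gamma> \<le> 2 * L * 2 powr (- \<gamma> * real (J b))" using L_pos by simp
        then show ?thesis using K c0 by (intro mult_mono pow_le mult_left_mono) auto
      qed
      finally show ?thesis using head False 0 by (simp add: algebra_simps)
    qed
  next
    case (Suc s')
    show ?thesis
    proof (cases "J b = 0")
      case True
      have "\<bar>mixed_diff rnd J xs (F l) (v(b := rnd b 0 (v b)))\<bar>
        \<le> K * ?c * 2 powr (- decay_exponent \<gamma> s' (map J xs))"
        using Cons.prems bI Suc by (intro Cons.IH upd_rnd_box) auto
      also have "\<dots> \<le> K * (2 * L) ^ length (b # xs) * 2 powr (- decay_exponent \<gamma> s' (map J xs))"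
        using L_ge_1 K c0 mult_right_mono[of 1 "2 * L" "K * ?c"]
        by (intro mult_right_mono) (simp_all add: algebra_simps)
      finally show ?thesis using head True Suc by simp
    next
      case False
      let ?d = "\<bar>rnd b (J b) (v b) - rnd b (J b - 1) (v b)\<bar>"
      let ?l = "l(b := Suc (l b))"
      let ?M = "K * ?c * 2 powr (- decay_exponent \<gamma> s' (map J xs))"
      have suml: "sum ?l I = Suc (sum l I)"
        using finite_I bI by (simp add: sum.remove[OF finite_I bI])
      have "\<bar>mixed_diff rnd J xs (F l) (v(b := rnd b (J b) (v b)))
         - mixed_diff rnd J xs (F l) (v(b := rnd b (J b - 1) (v b)))\<bar> \<le> ?M * ?d"
      proof (rule increment_le_of_derivative_bound[where F' = "mixed_diff rnd J xs (F ?l)"])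
        show "\<bar>mixed_diff rnd J xs (F ?l) w\<bar> \<le> ?M" if "w \<in> box_coords" for w
          using Cons.prems bI Suc suml that by (intro Cons.IH) auto
        show "((\<lambda>t. mixed_diff rnd J xs (F l) (w(b := t))) has_real_derivative
            mixed_diff rnd J xs (F ?l) (w(b := t))) (at t within {lo b..hi b})"
          if "w \<in> box_coords" "t \<in> {lo b..hi b}" for w t
          by (rule mixed_diff_has_derivative[OF xsI bI b_xs])
            (use Cons.prems Suc bI that deriv[of l b] in auto)
      qed (use Cons.prems bI r in auto)
      also have "\<dots> \<le> ?M * (2 * L * 2 powr (- real (J b)))"
        using K c0 False by (intro mult_left_mono rnd_levels_close) auto
      also have "\<dots> = K * (2 * L) ^ length (b # xs) * (2 powr (- real (J b)) * 2 powr (- decay_exponent \<gamma> s' (map J xs)))"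
        by simp
      finally show ?thesis
        unfolding head using False by (simp only: Suc powr_add[symmetric] list.map decay_exponent.simps minus_add_distrib if_False)
    qed
  qed
qed

end

context dyadic_box
begin

definition cell :: "('i \<Rightarrow> nat) \<Rightarrow> ('i \<Rightarrow> real) \<Rightarrow> 'i \<Rightarrow> nat" where
  "cell J v = (\<lambda>b\<in>I. nat \<lfloor>2 ^ J b * (v b - lo b) / L\<rfloor>)"

lemma floor_nonneg_box: "v \<in> box_coords \<Longrightarrow> b \<in> I \<Longrightarrow> 0 \<le> \<lfloor>2 ^ j * (v b - lo b) / L\<rfloor>"
  using L_pos by (auto simp: box_coords_def)

lemma cell_in:
  assumes "v \<in> box_coords"
  shows "cell J v \<in> PiE I (\<lambda>b. {..<2 ^ J b})"
proof -
  have "nat \<lfloor>2 ^ J b * (v b - lo b) / L\<rfloor> < 2 ^ J b" if b: "b \<in> I" for b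
  proof -
    have "(v b - lo b) < L" using side[OF b] b assms by (force simp: box_coords_def)
    then have "2 ^ J b * (v b - lo b) / L < 2 ^ J b"
      using L_pos by (simp add: divide_less_eq)
    then have "\<lfloor>2 ^ J b * (v b - lo b) / L\<rfloor> < 2 ^ J b"
      by (simp add: floor_less_iff)
    then show ?thesis by (simp add: nat_less_iff floor_nonneg_box[OF assms b])
  qed
  then show ?thesis by (auto simp: cell_def)
qed

text \<open>The cell of a point at the given levels determines all rounded coordinates that enter the mixed difference.\<close>

lemma mixed_diff_const_on_cells:
  assumes "\<And>b. b \<in> set xs \<Longrightarrow> \<lfloor>2 ^ J b * (v b - lo b) / L\<rfloor> = \<lfloor>2 ^ J b * (v' b - lo b) / L\<rfloor>"
    and "\<And>b. b \<notin> set xs \<Longrightarrow> v b = v' b" and "distinct xs"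
  shows "mixed_diff rnd J xs F v = mixed_diff rnd J xs F v'"
  using assms
proof (induction xs arbitrary: v v')
  case Nil
  then have "v = v'" by auto
  then show ?case by simp
next
  case (Cons b xs)
  have r: "rnd b (J b) (v b) = rnd b (J b) (v' b)" "rnd b (J b - 1) (v b) = rnd b (J b - 1) (v' b)"
    using Cons.prems(1)[of b] grid_round_pred_determined[of "J b" "v b" "lo b" L "v' b"]
    by (simp_all add: rnd_def grid_round_def)
  have "mixed_diff rnd J xs F (v(b := t)) = mixed_diff rnd J xs F (v'(b := t))" for t
    using Cons.prems by (intro Cons.IH) auto
  then show ?case by (simp add: mixed_diff_Cons level_diff_def r[simplified] del: fun_upd_apply)
qed

text \<open>Change the coordinates one after the other; a box contains the resulting axis-parallel path.\<close>

lemma coordinatewise_lipschitz: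
  assumes lip: "\<And>b v t t'. b \<in> I \<Longrightarrow> v \<in> box_coords \<Longrightarrow> t \<in> {lo b..hi b} \<Longrightarrow> t' \<in> {lo b..hi b} \<Longrightarrow>
      \<bar>F (v(b := t)) - F (v(b := t'))\<bar> \<le> K * \<bar>t - t'\<bar>"
    and "set xs \<subseteq> I" "distinct xs" "v \<in> box_coords" "v' \<in> box_coords"
  shows "\<bar>F (\<lambda>b. if b \<in> set xs then v' b else v b) - F v\<bar> \<le> K * (\<Sum>b\<in>set xs. \<bar>v' b - v b\<bar>)"
  using assms(2-)
proof (induction xs)
  case Nil
  then show ?case by simp
next
  case (Cons b xs)
  define u where "u = (\<lambda>b. if b \<in> set xs then v' b else v b)"
  have bI: "b \<in> I" and b_xs: "b \<notin> set xs" using Cons.prems by auto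
  have u: "u \<in> box_coords"
    using Cons.prems unfolding u_def box_coords_def by auto
  have 1: "\<bar>F (u(b := v' b)) - F (u(b := v b))\<bar> \<le> K * \<bar>v' b - v b\<bar>"
    using u bI Cons.prems by (intro lip) (auto simp: box_coords_def)
  have 2: "u(b := v b) = u" using b_xs by (auto simp: u_def)
  have 3: "(\<lambda>b'. if b' \<in> set (b # xs) then v' b' else v b') = u(b := v' b)"
    by (auto simp: u_def)
  have "\<bar>F u - F v\<bar> \<le> K * (\<Sum>b\<in>set xs. \<bar>v' b - v b\<bar>)"
    using Cons unfolding u_def by auto
  then have "\<bar>F (u(b := v' b)) - F v\<bar> \<le> K * \<bar>v' b - v b\<bar> + K * (\<Sum>b\<in>set xs. \<bar>v' b - v b\<bar>)"
    using 1 unfolding 2 by linarith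
  then show ?case unfolding 3 using b_xs by (simp add: distrib_left)
qed

end

lemma summable_on_geometric_PiE:
  fixes q :: real
  assumes "finite I" "0 < q" "q < 1"
  shows "(\<lambda>J. q ^ sum J I) summable_on PiE I (\<lambda>_. UNIV :: nat set)"
proof (rule nonneg_bdd_above_summable_on)
  show "bdd_above (sum (\<lambda>J. q ^ sum J I) ` {F. F \<subseteq> PiE I (\<lambda>_. UNIV) \<and> finite F})"
  proof (rule bdd_aboveI2)
    fix F :: "('a \<Rightarrow> nat) set"
    assume F: "F \<in> {F. F \<subseteq> PiE I (\<lambda>_. UNIV) \<and> finite F}"
    define N where "N = Max (insert 0 ((\<lambda>(J, b). J b) ` (F \<times> I)))"
    have "J b \<le> N" if "J \<in> F" "b \<in> I" for J b
      unfolding N_def using that F assms by (intro Max_ge) auto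
    then have "F \<subseteq> PiE I (\<lambda>_. {..N})"
      using F by (intro subsetI PiE_I) (auto dest!: subsetD PiE_arb)
    then have "(\<Sum>J\<in>F. q ^ sum J I) \<le> (\<Sum>J\<in>PiE I (\<lambda>_. {..N}). q ^ sum J I)"
      using assms by (intro sum_mono2 finite_PiE) auto
    also have "\<dots> = (\<Prod>b\<in>I. \<Sum>j\<le>N. q ^ j)"
      using assms(1) by (subst prod_sum_PiE) (auto simp: power_sum)
    also have "\<dots> \<le> (\<Prod>b\<in>I. 1 / (1 - q))"
    proof (rule prod_mono, intro conjI)
      fix b
      show "0 \<le> (\<Sum>j\<le>N. q ^ j)" using assms by (intro sum_nonneg) auto
      show "(\<Sum>j\<le>N. q ^ j) \<le> 1 / (1 - q)"
        using assms sum_le_suminf[of "\<lambda>j. q ^ j" "{..N}"] by (simp add: suminf_geometric summable_geometric)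
    qed
    finally show "(\<Sum>J\<in>F. q ^ sum J I) \<le> (\<Prod>b\<in>I. 1 / (1 - q))" .
  qed
qed (use assms in auto)

lemma has_sum_of_exhausting_finite_sums:
  fixes f :: "'a \<Rightarrow> real"
  assumes "f summable_on A" "\<And>N. finite (E N)" "\<And>N. E N \<subseteq> A"
    and "\<And>X. finite X \<Longrightarrow> X \<subseteq> A \<Longrightarrow> \<exists>N0. \<forall>N\<ge>N0. X \<subseteq> E N"
    and "(\<lambda>N::nat. sum f (E N)) \<longlonglongrightarrow> x"
  shows "(f has_sum x) A"
proof -
  have "filterlim E (finite_subsets_at_top A) sequentially"
    unfolding filterlim_finite_subsets_at_top eventually_sequentially using assms by auto
  moreover have "(sum f \<longlongrightarrow> infsum f A) (finite_subsets_at_top A)"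
    using assms(1) by (simp add: has_sum_infsum[unfolded has_sum_def])
  ultimately have "(\<lambda>N. sum f (E N)) \<longlonglongrightarrow> infsum f A"
    by (rule filterlim_compose[rotated])
  then have "infsum f A = x" using assms(5) LIMSEQ_unique by blast
  then show ?thesis using assms(1) has_sum_infsum by blast
qed

context dyadic_box
begin

text \<open>For each level vector the directions are sorted by decreasing level, which makes the available derivatives act
where they gain most. The bound then depends on the sum of the levels only, and since it is summable the series can be
evaluated along the exhausting cubes of level vectors, on which it telescopes.\<close>

lemma haar_series:
  fixes F :: "('i \<Rightarrow> nat) \<Rightarrow> ('i \<Rightarrow> real) \<Rightarrow> real"
  assumes \<gamma>: "0 < \<gamma>" "\<gamma> \<le> 1" and K: "0 \<le> K"
    and deriv: "\<And>l b v t. (\<forall>b. b \<notin> I \<longrightarrow> l b = 0) \<Longrightarrow> sum l I < p \<Longrightarrow> b \<in> I \<Longrightarrow> v \<in> box_coords \<Longrightarrow>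
      t \<in> {lo b..hi b} \<Longrightarrow> ((\<lambda>t. F l (v(b := t))) has_real_derivative F (l(b := Suc (l b))) (v(b := t)))
        (at t within {lo b..hi b})"
    and bound: "\<And>l v. (\<forall>b. b \<notin> I \<longrightarrow> l b = 0) \<Longrightarrow> sum l I \<le> p \<Longrightarrow> v \<in> box_coords \<Longrightarrow> \<bar>F l v\<bar> \<le> K"
    and holder: "\<And>l b v t t'. (\<forall>b. b \<notin> I \<longrightarrow> l b = 0) \<Longrightarrow> sum l I \<le> p \<Longrightarrow> b \<in> I \<Longrightarrow> v \<in> box_coords \<Longrightarrow>
      t \<in> {lo b..hi b} \<Longrightarrow> t' \<in> {lo b..hi b} \<Longrightarrow> \<bar>F l (v(b := t)) - F l (v(b := t'))\<bar> \<le> K * \<bar>t - t'\<bar> powr \<gamma>"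
    and xs: "set xs = I" "distinct xs" and v: "v \<in> box_coords" and I: "I \<noteq> {}" and p: "1 \<le> p"
  defines "\<kappa> \<equiv> min (real p + \<gamma>) (real (card I)) / real (card I)"
  shows "\<bar>mixed_diff rnd J xs (F (\<lambda>_. 0)) v\<bar> \<le> K * (2 * L) ^ card I * (2 powr (- \<kappa>)) ^ sum J I"
    and "((\<lambda>J. mixed_diff rnd J xs (F (\<lambda>_. 0)) v) has_sum F (\<lambda>_. 0) v) (PiE I (\<lambda>_. UNIV))"
proof -
  have n: "0 < card I" "length xs = card I"
    using I finite_I xs distinct_card by (force simp: card_gt_0_iff)+
  show B: "\<bar>mixed_diff rnd J xs (F (\<lambda>_. 0)) v\<bar> \<le> K * (2 * L) ^ card I * (2 powr (- \<kappa>)) ^ sum J I" for J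
  proof -
    define ys where "ys = rev (sort_key J xs)"
    have ys: "mset ys = mset xs" "set ys = I" "distinct ys" "length ys = card I"
      using xs n by (simp_all add: ys_def)
    have "sorted_wrt (\<ge>) (map J ys)"
      unfolding ys_def rev_map[symmetric] sorted_wrt_rev by (simp add: sorted_sort_key)
    then have "min (real p + \<gamma>) (real (card I)) * real (sum_list (map J ys))
      \<le> real (card I) * decay_exponent \<gamma> p (map J ys)"
      using decay_exponent_sorted[of "map J ys" \<gamma> p] \<gamma> ys by simp
    moreover have "sum_list (map J ys) = sum J I"
      using ys by (metis sum_list_distinct_conv_sum_set)
    ultimately have e: "\<kappa> * real (sum J I) \<le> decay_exponent \<gamma> p (map J ys)"
      using n by (simp add: \<kappa>_def divide_le_eq mult.commute)
    have "\<bar>mixed_diff rnd J xs (F (\<lambda>_. 0)) v\<bar> = \<bar>mixed_diff rnd J ys (F (\<lambda>_. 0)) v\<bar>"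
      using mixed_diff_perm[OF ys(1)] by metis
    also have "\<dots> \<le> K * (2 * L) ^ length ys * 2 powr (- decay_exponent \<gamma> p (map J ys))"
      by (rule mixed_diff_decay[OF \<gamma> K deriv bound holder]) (use ys v in auto)
    also have "\<dots> \<le> K * (2 * L) ^ length ys * 2 powr (- \<kappa> * real (sum J I))"
      using e K L_pos by (intro mult_left_mono powr_mono) auto
    also have "2 powr (- \<kappa> * real (sum J I)) = (2 powr (- \<kappa>)) ^ sum J I"
      by (simp only: powr_powr[symmetric], rule powr_realpow) simp
    finally show ?thesis using ys by simp
  qed
  have \<kappa>: "0 < \<kappa>" using n \<gamma> by (auto simp: \<kappa>_def)
  have sm: "(\<lambda>J. mixed_diff rnd J xs (F (\<lambda>_. 0)) v) summable_on PiE I (\<lambda>_. UNIV)"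
  proof (rule abs_summable_summable, rule summable_on_comparison_test)
    have "2 powr (- \<kappa>) < (1::real)" using \<kappa> by (simp add: powr_less_one)
    then show "(\<lambda>J. K * (2 * L) ^ card I * (2 powr (- \<kappa>)) ^ sum J I) summable_on PiE I (\<lambda>_. UNIV)"
      by (intro summable_on_cmult_right) (rule summable_on_geometric_PiE[OF finite_I], auto)
    show "norm (mixed_diff rnd J xs (F (\<lambda>_. 0)) v) \<le> K * (2 * L) ^ card I * (2 powr (- \<kappa>)) ^ sum J I" for J
      using B[of J] by simp
  qed simp
  show "((\<lambda>J. mixed_diff rnd J xs (F (\<lambda>_. 0)) v) has_sum F (\<lambda>_. 0) v) (PiE I (\<lambda>_. UNIV))"
  proof (rule has_sum_of_exhausting_finite_sums[OF sm, where E = "\<lambda>N. PiE I (\<lambda>_. {..N})"])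
    fix X assume X: "finite X" "X \<subseteq> PiE I (\<lambda>_. UNIV :: nat set)"
    define N where "N = Max (insert 0 ((\<lambda>(J, b). J b) ` (X \<times> I)))"
    have "J b \<le> N" if "J \<in> X" "b \<in> I" for J b
      unfolding N_def using that X finite_I by (intro Max_ge) auto
    then have "X \<subseteq> PiE I (\<lambda>_. {..N'})" if "N \<le> N'" for N'
      using X that by (intro subsetI PiE_I) (auto dest!: subsetD PiE_arb intro: order_trans)
    then show "\<exists>N0. \<forall>N\<ge>N0. X \<subseteq> PiE I (\<lambda>_. {..N})" by blast
  next
    have lip: "\<bar>F (\<lambda>_. 0) (v(b := t)) - F (\<lambda>_. 0) (v(b := t'))\<bar> \<le> K * \<bar>t - t'\<bar>"
      if "b \<in> I" "v \<in> box_coords" "t \<in> {lo b..hi b}" "t' \<in> {lo b..hi b}" for b v t t'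
    proof (rule increment_le_of_derivative_bound[where F' = "F ((\<lambda>_. 0)(b := Suc 0))"])
      have s: "sum ((\<lambda>_. 0)(b := Suc 0)) I = 1"
        using that finite_I by (simp add: sum.remove)
      show "\<bar>F ((\<lambda>_. 0)(b := Suc 0)) v\<bar> \<le> K" if "v \<in> box_coords" for v
        using p s that \<open>b \<in> I\<close> by (intro bound) auto
      show "((\<lambda>t. F (\<lambda>_. 0) (v(b := t))) has_real_derivative F ((\<lambda>_. 0)(b := Suc 0)) (v(b := t)))
           (at t within {lo b..hi b})" if "v \<in> box_coords" "t \<in> {lo b..hi b}" for v t
        using deriv[of "\<lambda>_. 0" b v t] p that \<open>b \<in> I\<close> by simp
    qed (use that in auto)
    have "(\<lambda>N. real (card I) * (K * L / 2 ^ N)) \<longlonglongrightarrow> 0"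
      by (rule tendsto_mult_right_zero, rule LIMSEQ_divide_realpow_zero) simp
    then have "(\<lambda>N. F (\<lambda>_. 0) (\<lambda>b. if b \<in> set xs then rnd b N (v b) else v b) - F (\<lambda>_. 0) v) \<longlonglongrightarrow> 0"
    proof (rule Lim_null_comparison[rotated], intro always_eventually allI)
      fix N
      have close: "\<bar>rnd b N (v b) - v b\<bar> \<le> L / 2 ^ N" for b
        using grid_round_le[OF L_pos, of "lo b" N "v b"] grid_round_ge[OF L_pos, of "v b" N "lo b"]
        by (simp add: rnd_def)
      have "(\<lambda>b. rnd b N (v b)) \<in> box_coords"
        using v rnd_in by (simp add: box_coords_def)
      then have "\<bar>F (\<lambda>_. 0) (\<lambda>b. if b \<in> set xs then rnd b N (v b) else v b) - F (\<lambda>_. 0) v\<bar>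
          \<le> K * (\<Sum>b\<in>set xs. \<bar>rnd b N (v b) - v b\<bar>)"
        using xs v by (intro coordinatewise_lipschitz lip) auto
      also have "\<dots> \<le> K * (\<Sum>b\<in>set xs. L / 2 ^ N)"
        using K by (intro mult_left_mono sum_mono close) auto
      finally show "norm (F (\<lambda>_. 0) (\<lambda>b. if b \<in> set xs then rnd b N (v b) else v b) - F (\<lambda>_. 0) v)
          \<le> real (card I) * (K * L / 2 ^ N)"
        using xs(1) by (simp add: algebra_simps)
    qed
    then have "(\<lambda>N. F (\<lambda>_. 0) (\<lambda>b. if b \<in> set xs then rnd b N (v b) else v b)) \<longlonglongrightarrow> F (\<lambda>_. 0) v"
      by (simp add: LIM_zero_iff)
    then show "(\<lambda>N. \<Sum>J\<in>PiE I (\<lambda>_. {..N}). mixed_diff rnd J xs (F (\<lambda>_. 0)) v) \<longlonglongrightarrow> F (\<lambda>_. 0) v"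
      using sum_mixed_diff[OF xs(2), where r = rnd and F = "F (\<lambda>_. 0)" and v = v] xs by simp
  qed (use finite_I in \<open>auto intro!: finite_PiE\<close>)
qed

end

section \<open>Expansion of a smoothness class in indicator functions\<close>

text \<open>Turns a sum over a countable index set into an ordinary series, padded with zeros outside the range of the enumeration.\<close>

lemma has_sum_imp_sums_enumeration:
  fixes g :: "'a \<Rightarrow> real"
  assumes "inj_on e Idx" "(g has_sum x) Idx"
  shows "(\<lambda>i::nat. if i \<in> e ` Idx then g (inv_into Idx e i) else 0) sums x"
proof -
  have "((g \<circ> inv_into Idx e) has_sum x) (e ` Idx)"
    using assms by (subst has_sum_reindex) (auto intro: has_sum_cong[THEN iffD2, rotated])
  then have "((\<lambda>i. if i \<in> e ` Idx then g (inv_into Idx e i) else 0) has_sum x) UNIV"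
    by (rule has_sum_cong_neutral[THEN iffD1, rotated -1]) auto
  then show ?thesis by (rule has_sum_imp_sums)
qed

lemma lower_int_fraction:
  assumes "0 < \<alpha>"
  shows "0 < \<alpha> - real (lower_int \<alpha>)" "\<alpha> - real (lower_int \<alpha>) \<le> 1"
proof -
  have "real (lower_int \<alpha>) = real_of_int (\<lceil>\<alpha>\<rceil> - 1)"
    using assms by (simp add: lower_int_def of_nat_nat)
  then show "0 < \<alpha> - real (lower_int \<alpha>)" "\<alpha> - real (lower_int \<alpha>) \<le> 1"
    by linarith+
qed

lemma derivs_norm_bounds:
  assumes "derivs_norm W \<alpha> D \<le> ennreal K" "0 \<le> K" "l \<in> multi_indices" "w \<in> W"
  shows "mi_size l \<le> lower_int \<alpha> \<Longrightarrow> \<bar>D l w\<bar> \<le> K"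
    and "mi_size l = lower_int \<alpha> \<Longrightarrow> w' \<in> W \<Longrightarrow>
      \<bar>D l w - D l w'\<bar> \<le> K * norm (w - w') powr (\<alpha> - real (lower_int \<alpha>))"
proof -
  assume "mi_size l \<le> lower_int \<alpha>"
  then have "ennreal \<bar>D l w\<bar> \<le>
      (SUP l\<in>{l\<in>multi_indices. mi_size l \<le> lower_int \<alpha>}. SUP w\<in>W. ennreal \<bar>D l w\<bar>)"
    using assms by (intro SUP_upper2[of l] SUP_upper2[of w]) auto
  also have "\<dots> \<le> derivs_norm W \<alpha> D"
    unfolding derivs_norm_def by (rule add_increasing2) auto
  finally show "\<bar>D l w\<bar> \<le> K" using assms by (metis ennreal_le_iff order_trans)
next
  assume l: "mi_size l = lower_int \<alpha>" and w': "w' \<in> W"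
  let ?\<gamma> = "\<alpha> - real (lower_int \<alpha>)"
  show "\<bar>D l w - D l w'\<bar> \<le> K * norm (w - w') powr ?\<gamma>"
  proof (cases "w = w'")
    case False
    have "ennreal (\<bar>D l w - D l w'\<bar> / norm (w - w') powr ?\<gamma>) \<le>
       (SUP l\<in>{l\<in>multi_indices. mi_size l = lower_int \<alpha>}.
        SUP (w, w')\<in>{(w, w'). w \<in> W \<and> w' \<in> W \<and> w \<noteq> w'}.
          ennreal (\<bar>D l w - D l w'\<bar> / norm (w - w') powr (\<alpha> - real (lower_int \<alpha>))))"
      using assms l w' False by (intro SUP_upper2[of l] SUP_upper2[of "(w, w')"]) auto
    also have "\<dots> \<le> derivs_norm W \<alpha> D"
      unfolding derivs_norm_def by (rule add_increasing) auto
    finally have "\<bar>D l w - D l w'\<bar> / norm (w - w') powr ?\<gamma> \<le> K"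
      using assms by (metis ennreal_le_iff order_trans)
    then show ?thesis using False by (simp add: divide_le_eq)
  qed (use assms in auto)
qed

definition point_of :: "('a::euclidean_space \<Rightarrow> real) \<Rightarrow> 'a" where
  "point_of v = (\<Sum>b\<in>Basis. v b *\<^sub>R b)"

lemma point_of_inner: "b \<in> Basis \<Longrightarrow> point_of v \<bullet> b = v b"
  by (simp add: point_of_def inner_sum_left_Basis)

lemma point_of_upd: "b \<in> Basis \<Longrightarrow> point_of (v(b := t)) = point_of v + (t - v b) *\<^sub>R b"
  by (rule euclidean_eqI) (auto simp: point_of_inner inner_add_left inner_Basis)

lemma point_of_coords: "point_of (\<lambda>b\<in>Basis. w \<bullet> b) = w"
  by (simp add: point_of_def euclidean_representation)

text \<open>Restates the one-sided partial derivatives on a box in terms of updates of a single coordinate.\<close>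

lemma partial_deriv_along_coordinate:
  fixes lo hi :: "'a::euclidean_space"
  assumes pd: "partial_derivs_on (cbox lo hi) p D" and l: "l \<in> multi_indices" "mi_size l < p" and b: "b \<in> Basis"
    and v: "\<forall>b\<in>Basis. v b \<in> {lo \<bullet> b..hi \<bullet> b}" and t: "t \<in> {lo \<bullet> b..hi \<bullet> b}"
  shows "((\<lambda>t. D l (point_of (v(b := t)))) has_real_derivative D (l(b := Suc (l b))) (point_of (v(b := t))))
    (at t within {lo \<bullet> b..hi \<bullet> b})"
proof -
  define w where "w = point_of (v(b := t))"
  have in_box: "point_of (v(b := u)) \<in> cbox lo hi" if "u \<in> {lo \<bullet> b..hi \<bullet> b}" for u
    using v that by (simp add: mem_box point_of_inner)
  have eq: "point_of (v(b := u)) = w + (u - t) *\<^sub>R b" for u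
    using point_of_upd[OF b, of "v(b := t)" u] by (simp add: w_def)
  have d1: "((\<lambda>u. D l (w + u *\<^sub>R b)) has_real_derivative D (l(b := Suc (l b))) w)
      (at 0 within {u. w + u *\<^sub>R b \<in> cbox lo hi})"
    using pd l b in_box[OF t] by (auto simp: partial_derivs_on_def w_def)
  have sub: "(\<lambda>u. u - t) ` {lo \<bullet> b..hi \<bullet> b} \<subseteq> {u. w + u *\<^sub>R b \<in> cbox lo hi}"
    using in_box unfolding eq by blast
  have d2: "((\<lambda>u. D l (w + u *\<^sub>R b)) has_real_derivative D (l(b := Suc (l b))) w)
      (at (t - t) within (\<lambda>u. u - t) ` {lo \<bullet> b..hi \<bullet> b})"
    using has_field_derivative_subset[OF d1 sub] by simp
  have "((\<lambda>u. u - t) has_real_derivative 1) (at t within {lo \<bullet> b..hi \<bullet> b})"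
    by (auto intro!: derivative_eq_intros)
  from DERIV_image_chain[OF d2 this] show ?thesis
    by (simp add: eq comp_def del: fun_upd_apply)
qed

lemma smooth_function_lipschitz:
  fixes lo hi :: "'a::euclidean_space"
  assumes pd: "partial_derivs_on (cbox lo hi) (lower_int \<alpha>) D" and dn: "derivs_norm (cbox lo hi) \<alpha> D \<le> ennreal K"
    and K: "0 \<le> K" and p: "1 \<le> lower_int \<alpha>" and w: "w \<in> cbox lo hi" "w' \<in> cbox lo hi"
  shows "\<bar>D (\<lambda>_. 0) w' - D (\<lambda>_. 0) w\<bar> \<le> K * real DIM('a) * norm (w' - w)"
proof -
  define L where "L = 1 + (\<Sum>b\<in>Basis. hi \<bullet> b - lo \<bullet> b)"
  have lohi: "lo \<bullet> b \<le> hi \<bullet> b" if "b \<in> Basis" for b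
    using w(1) that by (force simp: mem_box intro: order_trans)
  have side_less: "hi \<bullet> b - lo \<bullet> b < L" if "b \<in> Basis" for b
    using member_le_sum[of b Basis "\<lambda>b. hi \<bullet> b - lo \<bullet> b"] lohi that unfolding L_def by force
  interpret dyadic_box "Basis :: 'a set" "\<lambda>b. lo \<bullet> b" "\<lambda>b. hi \<bullet> b" L
  proof
    show "1 \<le> L" unfolding L_def using lohi by (simp add: sum_nonneg)
  qed (use lohi side_less in auto)
  define F where "F v = D (\<lambda>_. 0) (point_of v)" for v
  have zero: "(\<lambda>_. 0) \<in> (multi_indices :: ('a \<Rightarrow> nat) set)" by (simp add: multi_indices_def)
  have lip: "\<bar>F (v(b := t)) - F (v(b := t'))\<bar> \<le> K * \<bar>t - t'\<bar>"
    if b: "b \<in> Basis" and "v \<in> box_coords" "t \<in> {lo \<bullet> b..hi \<bullet> b}" "t' \<in> {lo \<bullet> b..hi \<bullet> b}" for b v t t'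
  proof (rule increment_le_of_derivative_bound[where F' = "\<lambda>v. D ((\<lambda>_. 0)(b := Suc 0)) (point_of v)"])
    show "((\<lambda>t. F (v(b := t))) has_real_derivative D ((\<lambda>_. 0)(b := Suc 0)) (point_of (v(b := t))))
        (at t within {lo \<bullet> b..hi \<bullet> b})" if "v \<in> box_coords" "t \<in> {lo \<bullet> b..hi \<bullet> b}" for v t
      unfolding F_def using partial_deriv_along_coordinate[OF pd zero _ b _ that(2), of v] p that(1)
      by (simp add: mi_size_def box_coords_def del: fun_upd_apply)
    show "\<bar>D ((\<lambda>_. 0)(b := Suc 0)) (point_of v)\<bar> \<le> K" if "v \<in> box_coords" for v
    proof (rule derivs_norm_bounds(1)[OF dn K])
      show "(\<lambda>_. 0)(b := Suc 0) \<in> multi_indices" using b by (auto simp: multi_indices_def)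
      show "point_of v \<in> cbox lo hi" using that by (simp add: mem_box box_coords_def point_of_inner)
      show "mi_size ((\<lambda>_. 0)(b := Suc 0)) \<le> lower_int \<alpha>"
        using p b by (simp add: mi_size_def sum.remove[OF finite_Basis b])
    qed
  qed (use that in auto)
  obtain xs :: "'a list" where xs: "set xs = Basis" "distinct xs"
    using finite_distinct_list[OF finite_Basis] by blast
  define coords where "coords w = (\<lambda>b. w \<bullet> b)" for w :: 'a
  have pt: "point_of (\<lambda>b. if b \<in> set xs then coords w' b else coords w b) = w'" "point_of (coords w) = w"
    by (auto simp: euclidean_eq_iff[where 'a = 'a] point_of_inner coords_def xs)
  have "\<bar>F (\<lambda>b. if b \<in> set xs then coords w' b else coords w b) - F (coords w)\<bar>
      \<le> K * (\<Sum>b\<in>set xs. \<bar>coords w' b - coords w b\<bar>)"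
    by (rule coordinatewise_lipschitz[OF lip]) (use xs w in \<open>auto simp: box_coords_def coords_def mem_box\<close>)
  also have "(\<Sum>b\<in>set xs. \<bar>coords w' b - coords w b\<bar>) \<le> (\<Sum>b\<in>set xs. norm (w' - w))"
    unfolding xs coords_def inner_diff_left[symmetric] by (intro sum_mono Basis_le_norm) auto
  finally show ?thesis
    unfolding F_def pt using K by (simp add: xs mult_left_mono mult.assoc)
qed

text \<open>The index \<open>i\<close> runs through all pairs of a level vector \<open>J\<close> and a cell of that level. The coefficient bound is
\<open>B i = M \<beta>\<^bsup>|J|\<^esup>\<close> and the weight is \<open>s i = \<rho>\<^bsup>|J|\<^esup>\<close> with \<open>\<rho> = sqrt 2\<close> and \<open>\<beta> \<rho> < 1\<close>. Because there are \<open>\<rho>\<^bsup>2|J|\<^esup>\<close> cells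
at level \<open>J\<close> and each point lies in exactly one of them, both \<open>\<Sum> B/s\<close> and \<open>\<Sum> B s 1\<^sub>A\<close> reduce to the same geometric
series. These two sums are what the weighted Cauchy--Schwarz inequality of \<open>emp_dev_series_bound\<close> consumes.\<close>

lemma smooth_class_expansion:
  fixes lo hi :: "'a::euclidean_space"
  assumes box: "cbox lo hi \<noteq> {}" and \<alpha>: "\<alpha> > real DIM('a) / 2" and p: "1 \<le> lower_int \<alpha>" and K: "0 \<le> K"
  obtains A :: "nat \<Rightarrow> 'a set" and B s :: "nat \<Rightarrow> real" and C :: real
  where "\<And>i. A i \<in> sets borel" "\<And>i. 0 \<le> B i" "\<And>i. 0 < s i" "summable (\<lambda>i. B i / s i)"
    "\<And>w. (\<lambda>i. B i * s i * indicator (A i) w) sums (if w \<in> cbox lo hi then C else 0)"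
    "\<And>D. partial_derivs_on (cbox lo hi) (lower_int \<alpha>) D \<Longrightarrow> derivs_norm (cbox lo hi) \<alpha> D \<le> ennreal K \<Longrightarrow>
      \<exists>c. (\<forall>i. \<bar>c i\<bar> \<le> B i) \<and> (\<forall>w\<in>cbox lo hi. (\<lambda>i. c i * indicator (A i) w) sums D (\<lambda>_. 0) w)"
proof -
  define p \<gamma> n where "p = lower_int \<alpha>" and "\<gamma> = \<alpha> - real p" and "n = DIM('a)"
  have n: "0 < n" "card (Basis :: 'a set) = n" by (auto simp: n_def)
  have \<alpha>0: "0 < \<alpha>"
    using \<alpha> by (rule le_less_trans[rotated]) simp
  have \<gamma>: "0 < \<gamma>" "\<gamma> \<le> 1" using lower_int_fraction[OF \<alpha>0] by (auto simp: \<gamma>_def p_def)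
  define L where "L = 1 + (\<Sum>b\<in>Basis. hi \<bullet> b - lo \<bullet> b)"
  have lohi: "lo \<bullet> b \<le> hi \<bullet> b" if "b \<in> Basis" for b
    using box that by (simp add: box_ne_empty)
  have side_le: "hi \<bullet> b - lo \<bullet> b \<le> (\<Sum>b\<in>Basis. hi \<bullet> b - lo \<bullet> b)" if "b \<in> Basis" for b
    using lohi that by (intro member_le_sum) auto
  have side_less: "hi \<bullet> b - lo \<bullet> b < L" if "b \<in> Basis" for b
    using side_le[OF that] unfolding L_def by linarith
  interpret dyadic_box "Basis :: 'a set" "\<lambda>b. lo \<bullet> b" "\<lambda>b. hi \<bullet> b" L
  proof
    show "1 \<le> L" unfolding L_def using lohi by (simp add: sum_nonneg)
  qed (use lohi side_less in auto)
  define coords where "coords w = (\<lambda>b\<in>Basis. w \<bullet> b)" for w :: 'a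
  have coords_box: "coords w \<in> box_coords \<longleftrightarrow> w \<in> cbox lo hi" for w
    by (simp add: coords_def box_coords_def mem_box)
  have point_box: "point_of v \<in> cbox lo hi \<longleftrightarrow> v \<in> box_coords" for v
    by (simp add: box_coords_def mem_box point_of_inner)
  define \<kappa> where "\<kappa> = min (real p + \<gamma>) (real n) / real n"
  have \<kappa>: "1 / 2 < \<kappa>" using \<alpha> n by (simp add: \<kappa>_def \<gamma>_def less_divide_eq n_def[symmetric])
  \<comment> \<open>Below the top order the Hoelder bound comes from the next derivative, which costs a factor \<open>L\<close>.\<close>
  define K' M \<beta> \<rho> where "K' = K * L" and "M = K' * (2 * L) ^ n"
    and "\<beta> = 2 powr (- \<kappa>)" and "\<rho> = (2::real) powr (1 / 2)"
  have K': "K \<le> K'" "0 \<le> K'" using K L_ge_1 mult_left_mono[of 1 L K] by (auto simp: K'_def)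
  have M: "0 \<le> M" using K' L_pos by (simp add: M_def)
  have \<rho>: "0 < \<rho>" "\<rho> * \<rho> = 2" by (simp_all add: \<rho>_def powr_add[symmetric])
  have \<beta>: "0 < \<beta>" "\<beta> * \<rho> < 1"
    using \<kappa> by (simp_all add: \<beta>_def \<rho>_def powr_add[symmetric] powr_less_one)
  obtain xs :: "'a list" where xs: "set xs = Basis" "distinct xs"
    using finite_distinct_list[OF finite_Basis] by blast
  define Js where "Js = PiE (Basis :: 'a set) (\<lambda>_. UNIV :: nat set)"
  define Idx where "Idx = Sigma Js (\<lambda>J. PiE Basis (\<lambda>b. {..<(2::nat) ^ J b}))"
  have "countable Idx"
    unfolding Idx_def Js_def by (intro countable_SIGMA countable_PiE finite_Basis) auto
  define e where "e = to_nat_on Idx"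
  have e: "inj_on e Idx" unfolding e_def by (rule inj_on_to_nat_on[OF \<open>countable Idx\<close>])
  define d where "d = inv_into Idx e"
  define on where "on i \<longleftrightarrow> i \<in> e ` Idx" for i
  define tot where "tot J = sum J (Basis :: 'a set)" for J :: "'a \<Rightarrow> nat"
  define A where "A i = (if on i then {w \<in> cbox lo hi. cell (fst (d i)) (coords w) = snd (d i)} else {})" for i
  define B where "B i = (if on i then M * \<beta> ^ tot (fst (d i)) else 0)" for i
  define s where "s i = \<rho> ^ tot (fst (d i))" for i
  define C where "C = infsum (\<lambda>J. M * (\<beta> * \<rho>) ^ tot J) Js"
  have sumC: "((\<lambda>J. M * (\<beta> * \<rho>) ^ tot J) has_sum C) Js"
    unfolding C_def Js_def tot_def
    by (intro has_sum_infsum summable_on_cmult_right summable_on_geometric_PiE) (use \<beta> \<rho> in auto)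
  have cell_Idx: "(J, cell J (coords w)) \<in> Idx" if "w \<in> cbox lo hi" "J \<in> Js" for J w
    using that cell_in coords_box by (auto simp: Idx_def)
  have series: "(\<lambda>i. if on i then g (d i) * indicator (A i) w else 0) sums x"
    if w: "w \<in> cbox lo hi" and "((\<lambda>J. g (J, cell J (coords w))) has_sum x) Js"
    for g :: "('a \<Rightarrow> nat) \<times> ('a \<Rightarrow> nat) \<Rightarrow> real" and w x
  proof -
    define h where "h J = (J, cell J (coords w))" for J
    have "((g \<circ> h) has_sum x) Js" using that by (simp add: h_def comp_def)
    then have "(g has_sum x) (h ` Js)" by (subst has_sum_reindex) (auto simp: h_def inj_on_def)
    then have "((\<lambda>\<iota>. g \<iota> * (if cell (fst \<iota>) (coords w) = snd \<iota> then 1 else 0)) has_sum x) Idx"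
      by (rule has_sum_cong_neutral[THEN iffD1, rotated -1])
        (use cell_Idx[OF w] in \<open>auto simp: h_def Idx_def image_iff\<close>)
    from has_sum_imp_sums_enumeration[OF e this] show ?thesis
      by (rule sums_cong[THEN iffD1, rotated]) (auto simp: on_def d_def A_def w)
  qed
  show ?thesis
  proof (rule that[of A B s C])
    show "0 \<le> B i" "0 < s i" for i using M \<beta> \<rho> by (auto simp: B_def s_def)
    show "A i \<in> sets borel" for i
    proof -
      let ?J = "fst (d i)" and ?m = "snd (d i)"
      have "A i = (if on i \<and> ?m \<in> extensional Basis then
          cbox lo hi \<inter> (\<Inter>b\<in>Basis. (\<lambda>w. nat \<lfloor>2 ^ ?J b * (w \<bullet> b - lo \<bullet> b) / L\<rfloor>) -` {?m b} \<inter> space borel)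
          else {})"
        by (auto simp: A_def cell_def coords_def fun_eq_iff extensional_def restrict_def)
      also have "\<dots> \<in> sets borel"
      proof -
        have "(\<lambda>w. nat \<lfloor>2 ^ ?J b * (w \<bullet> b - lo \<bullet> b) / L\<rfloor>) -` {?m b} \<inter> space borel \<in> sets borel" for b :: 'a
          by (rule measurable_sets[where A = "count_space UNIV"]) auto
        then show ?thesis by (auto intro!: sets.Int sets.finite_INT)
      qed
      finally show ?thesis .
    qed
    have "((\<lambda>\<iota>. M * \<beta> ^ tot (fst \<iota>) / \<rho> ^ tot (fst \<iota>)) summable_on Idx)"
      unfolding Idx_def
    proof (rule summable_on_SigmaI)
      show "((\<lambda>m. M * \<beta> ^ tot (fst (J, m)) / \<rho> ^ tot (fst (J, m))) has_sum M * (\<beta> * \<rho>) ^ tot J)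
          (PiE Basis (\<lambda>b. {..<(2::nat) ^ J b}))" if "J \<in> Js" for J
      proof -
        have "2 ^ tot J * (M * \<beta> ^ tot J / \<rho> ^ tot J) = M * (\<beta> * \<rho>) ^ tot J"
          using \<rho>(1) by (simp add: \<rho>(2)[symmetric] power_mult_distrib field_simps)
        moreover have "card (PiE (Basis::'a set) (\<lambda>b. {..<(2::nat) ^ J b})) = 2 ^ tot J"
          by (simp add: card_PiE tot_def power_sum)
        ultimately show ?thesis
          by (intro has_sum_finiteI finite_PiE) auto
      qed
      show "(\<lambda>J. M * (\<beta> * \<rho>) ^ tot J) summable_on Js" using sumC summable_on_def by blast
    qed (use M \<beta> \<rho> in auto)
    then obtain x where "((\<lambda>\<iota>. M * \<beta> ^ tot (fst \<iota>) / \<rho> ^ tot (fst \<iota>)) has_sum x) Idx"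
      by (auto simp: summable_on_def)
    from has_sum_imp_sums_enumeration[OF e this] have "(\<lambda>i. B i / s i) sums x"
      by (rule sums_cong[THEN iffD1, rotated]) (auto simp: B_def s_def on_def d_def)
    then show "summable (\<lambda>i. B i / s i)" by (rule sums_summable)
    show "(\<lambda>i. B i * s i * indicator (A i) w) sums (if w \<in> cbox lo hi then C else 0)" for w
    proof (cases "w \<in> cbox lo hi")
      case True
      have "(\<lambda>i. if on i then M * (\<beta> * \<rho>) ^ tot (fst (d i)) * indicator (A i) w else 0) sums C"
        by (rule series[OF True]) (use sumC in simp)
      then have "(\<lambda>i. B i * s i * indicator (A i) w) sums C"
        by (rule sums_cong[THEN iffD1, rotated]) (auto simp: B_def s_def power_mult_distrib)
      then show ?thesis using True by simp
    next
      case False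
      then have "indicator (A i) w = (0::real)" for i by (auto simp: A_def)
      then show ?thesis using False by simp
    qed
    fix D :: "('a \<Rightarrow> nat) \<Rightarrow> 'a \<Rightarrow> real"
    assume pd: "partial_derivs_on (cbox lo hi) (lower_int \<alpha>) D" and dn: "derivs_norm (cbox lo hi) \<alpha> D \<le> ennreal K"
    define F where "F l v = D l (point_of v)" for l v
    have mi: "l \<in> multi_indices" if "\<forall>b. b \<notin> Basis \<longrightarrow> l b = 0" for l :: "'a \<Rightarrow> nat"
      using that by (auto simp: multi_indices_def)
    have deriv: "((\<lambda>t. F l (v(b := t))) has_real_derivative F (l(b := Suc (l b))) (v(b := t)))
        (at t within {lo \<bullet> b..hi \<bullet> b})"
      if l: "\<forall>b. b \<notin> Basis \<longrightarrow> l b = 0" "sum l Basis < p" and b: "b \<in> Basis" and v: "v \<in> box_coords"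
        and t: "t \<in> {lo \<bullet> b..hi \<bullet> b}" for l b v t
      unfolding F_def
      by (rule partial_deriv_along_coordinate[OF pd mi[OF l(1)] _ b _ t])
        (use l(2) v in \<open>simp_all add: mi_size_def p_def box_coords_def\<close>)
    have bound: "\<bar>F l v\<bar> \<le> K" if "\<forall>b. b \<notin> Basis \<longrightarrow> l b = 0" "sum l Basis \<le> p" "v \<in> box_coords" for l v
      unfolding F_def
      by (rule derivs_norm_bounds(1)[OF dn K]) (use that mi point_box in \<open>auto simp: mi_size_def p_def\<close>)
    have holder: "\<bar>F l (v(b := t)) - F l (v(b := t'))\<bar> \<le> K' * \<bar>t - t'\<bar> powr \<gamma>"
      if l: "\<forall>b. b \<notin> Basis \<longrightarrow> l b = 0" "sum l Basis \<le> p" and b: "b \<in> Basis" and v: "v \<in> box_coords"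
        and t: "t \<in> {lo \<bullet> b..hi \<bullet> b}" "t' \<in> {lo \<bullet> b..hi \<bullet> b}" for l b v t t'
    proof (cases "sum l Basis = p")
      case True
      have m: "point_of (v(b := t)) \<in> cbox lo hi" "point_of (v(b := t')) \<in> cbox lo hi"
        using v t by (auto simp: point_box box_coords_def)
      have "norm (point_of (v(b := t)) - point_of (v(b := t'))) = \<bar>t - t'\<bar>"
        using b by (simp add: point_of_upd scaleR_diff_left[symmetric] del: fun_upd_apply)
      then have "\<bar>F l (v(b := t)) - F l (v(b := t'))\<bar> \<le> K * \<bar>t - t'\<bar> powr \<gamma>"
        using derivs_norm_bounds(2)[OF dn K mi[OF l(1)] m(1) _ m(2)] True
        by (simp add: F_def \<gamma>_def p_def mi_size_def)
      also have "\<dots> \<le> K' * \<bar>t - t'\<bar> powr \<gamma>" using K' by (intro mult_right_mono) auto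
      finally show ?thesis .
    next
      case False
      have suml: "sum (l(b := Suc (l b))) Basis = Suc (sum l Basis)"
        using b by (simp add: sum.remove[OF finite_Basis b])
      have "\<bar>F l (v(b := t)) - F l (v(b := t'))\<bar> \<le> K * \<bar>t - t'\<bar>"
      proof (rule increment_le_of_derivative_bound[where F' = "F (l(b := Suc (l b)))"])
        show "\<bar>F (l(b := Suc (l b))) v\<bar> \<le> K" if "v \<in> box_coords" for v
          using l b False suml that by (intro bound) auto
        show "((\<lambda>t. F l (v(b := t))) has_real_derivative F (l(b := Suc (l b))) (v(b := t)))
            (at t within {lo \<bullet> b..hi \<bullet> b})" if "v \<in> box_coords" "t \<in> {lo \<bullet> b..hi \<bullet> b}" for v t
          using l b False that by (intro deriv) auto
      qed (use b v t in auto)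
      also have "\<bar>t - t'\<bar> \<le> L * \<bar>t - t'\<bar> powr \<gamma>"
      proof (cases "t = t'")
        case False
        have "\<bar>t - t'\<bar> \<le> L" using side[OF b] t by (auto simp: abs_le_iff)
        have "\<bar>t - t'\<bar> = \<bar>t - t'\<bar> powr (1 - \<gamma>) * \<bar>t - t'\<bar> powr \<gamma>"
          using False by (simp add: powr_add[symmetric])
        also have "\<dots> \<le> L powr (1 - \<gamma>) * \<bar>t - t'\<bar> powr \<gamma>"
          using \<gamma> \<open>\<bar>t - t'\<bar> \<le> L\<close> by (intro mult_right_mono powr_mono2) auto
        also have "\<dots> \<le> L powr 1 * \<bar>t - t'\<bar> powr \<gamma>"
          using \<gamma> L_ge_1 by (intro mult_right_mono powr_mono) auto
        finally show ?thesis using L_pos by simp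
      qed simp
      finally show ?thesis using K by (simp add: K'_def mult_left_mono mult.assoc)
    qed
    have p1: "1 \<le> p" using p by (simp add: p_def)
    have haar_bound: "\<bar>mixed_diff rnd J xs (F (\<lambda>_. 0)) v\<bar> \<le> M * \<beta> ^ tot J" if "v \<in> box_coords" for v J
      unfolding M_def \<beta>_def \<kappa>_def tot_def n(2)[symmetric]
      by (rule haar_series(1)[where F = F and p = p and \<gamma> = \<gamma> and K = K'],
        rule \<gamma>(1), rule \<gamma>(2), rule K'(2), rule deriv, assumption+,
        rule order_trans[OF bound K'(1)], assumption+, rule holder, assumption+,
        rule xs(1), rule xs(2), rule that, rule nonempty_Basis, rule p1)
    have haar_sum: "((\<lambda>J. mixed_diff rnd J xs (F (\<lambda>_. 0)) v) has_sum F (\<lambda>_. 0) v) Js" if "v \<in> box_coords" for v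
      unfolding Js_def
      by (rule haar_series(2)[where F = F and p = p and \<gamma> = \<gamma> and K = K'],
        rule \<gamma>(1), rule \<gamma>(2), rule K'(2), rule deriv, assumption+,
        rule order_trans[OF bound K'(1)], assumption+, rule holder, assumption+,
        rule xs(1), rule xs(2), rule that, rule nonempty_Basis, rule p1)
    \<comment> \<open>The Haar component is constant on the cell \<open>A i\<close>, so any point of the cell gives its value.\<close>
    define c where "c i = (if on i \<and> A i \<noteq> {} then
        mixed_diff rnd (fst (d i)) xs (F (\<lambda>_. 0)) (coords (SOME w. w \<in> A i)) else 0)" for i
    have c: "\<bar>c i\<bar> \<le> B i" for i
    proof (cases "on i \<and> A i \<noteq> {}")
      case True
      then have "(SOME w. w \<in> A i) \<in> A i" by (meson all_not_in_conv someI_ex)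
      then have "coords (SOME w. w \<in> A i) \<in> box_coords" by (auto simp: coords_box A_def split: if_splits)
      from haar_bound[OF this] show ?thesis using True by (simp add: c_def B_def)
    qed (use M \<beta> in \<open>auto simp: c_def B_def\<close>)
    have c_eq: "c i = mixed_diff rnd (fst (d i)) xs (F (\<lambda>_. 0)) (coords w)" if "on i" "w \<in> A i" for i w
    proof -
      define u where "u = (SOME w. w \<in> A i)"
      have "u \<in> A i" using that(2) unfolding u_def by (rule someI)
      then have u: "u \<in> cbox lo hi" "w \<in> cbox lo hi" "cell (fst (d i)) (coords u) = cell (fst (d i)) (coords w)"
        using that by (auto simp: A_def)
      have "mixed_diff rnd (fst (d i)) xs (F (\<lambda>_. 0)) (coords u) = mixed_diff rnd (fst (d i)) xs (F (\<lambda>_. 0)) (coords w)"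
      proof (rule mixed_diff_const_on_cells)
        fix b assume "b \<in> set xs"
        then have b: "b \<in> Basis" using xs by simp
        have "nat \<lfloor>2 ^ fst (d i) b * (coords u b - lo \<bullet> b) / L\<rfloor> = nat \<lfloor>2 ^ fst (d i) b * (coords w b - lo \<bullet> b) / L\<rfloor>"
          using fun_cong[OF u(3), of b] b unfolding cell_def by (simp only: restrict_apply if_True)
        then show "\<lfloor>2 ^ fst (d i) b * (coords u b - lo \<bullet> b) / L\<rfloor> = \<lfloor>2 ^ fst (d i) b * (coords w b - lo \<bullet> b) / L\<rfloor>"
          by (rule eq_nat_nat_iff[THEN iffD1, rotated 2])
            (rule floor_nonneg_box[OF _ b], simp only: coords_box u)+
      qed (use xs in \<open>auto simp: coords_def\<close>)
      then show ?thesis using that by (auto simp: c_def u_def)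
    qed
    have "(\<lambda>i. c i * indicator (A i) w) sums D (\<lambda>_. 0) w" if w: "w \<in> cbox lo hi" for w
    proof -
      have "((\<lambda>J. mixed_diff rnd J xs (F (\<lambda>_. 0)) (coords w)) has_sum F (\<lambda>_. 0) (coords w)) Js"
        by (rule haar_sum) (simp only: coords_box w)
      moreover have "F (\<lambda>_. 0) (coords w) = D (\<lambda>_. 0) w"
        by (simp add: F_def coords_def point_of_coords)
      ultimately have "(\<lambda>i. if on i then mixed_diff rnd (fst (d i)) xs (F (\<lambda>_. 0)) (coords w) * indicator (A i) w else 0)
          sums D (\<lambda>_. 0) w"
        using series[OF w, of "\<lambda>\<iota>. mixed_diff rnd (fst \<iota>) xs (F (\<lambda>_. 0)) (coords w)"] by simp
      then show ?thesis
        by (rule sums_cong[THEN iffD1, rotated]) (auto simp: c_eq indicator_def A_def)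
    qed
    with c show "\<exists>c. (\<forall>i. \<bar>c i\<bar> \<le> B i) \<and> (\<forall>w\<in>cbox lo hi. (\<lambda>i. c i * indicator (A i) w) sums D (\<lambda>_. 0) w)"
      by blast
  qed
qed

section \<open>Quadratic forms and the normal equations\<close>

definition bilin :: "nat \<Rightarrow> (nat \<Rightarrow> nat \<Rightarrow> real) \<Rightarrow> (nat \<Rightarrow> real) \<Rightarrow> (nat \<Rightarrow> real) \<Rightarrow> real" where
  "bilin k a x y = (\<Sum>i<k. \<Sum>j<k. x i * a i j * y j)"

lemma bilin_add_left: "bilin k a (\<lambda>i. x i + y i) z = bilin k a x z + bilin k a y z"
  by (simp add: bilin_def sum.distrib distrib_right)

lemma bilin_add_right: "bilin k a z (\<lambda>i. x i + y i) = bilin k a z x + bilin k a z y"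
  by (simp add: bilin_def sum.distrib distrib_left)

lemma bilin_scale_left: "bilin k a (\<lambda>i. t * x i) z = t * bilin k a x z"
  by (simp add: bilin_def sum_distrib_left mult_ac)

lemma bilin_scale_right: "bilin k a z (\<lambda>i. t * x i) = t * bilin k a z x"
  by (simp add: bilin_def sum_distrib_left mult_ac)

lemma bilin_commute:
  assumes "\<And>i j. i < k \<Longrightarrow> j < k \<Longrightarrow> a i j = a j i"
  shows "bilin k a x y = bilin k a y x"
  unfolding bilin_def by (subst sum.swap) (use assms in \<open>auto intro!: sum.cong\<close>)

lemma bilin_right: "bilin k a x y = (\<Sum>i<k. x i * (\<Sum>j<k. a i j * y j))"
  by (simp add: bilin_def sum_distrib_left mult.assoc)

lemma linear_term_zero:
  fixes r c :: real
  assumes "\<And>t. 0 \<le> 2 * t * r + t\<^sup>2 * c" "0 \<le> c"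
  shows "r = 0"
proof -
  define s where "s = c + 1"
  have s: "0 < s" "c = s - 1" using assms(2) by (auto simp: s_def)
  have "0 \<le> s\<^sup>2 * (2 * (- r / s) * r + (- r / s)\<^sup>2 * c)"
    by (intro mult_nonneg_nonneg assms) auto
  also have "\<dots> = - (r\<^sup>2 * (s + 1))"
    using s(1) unfolding s(2) by (simp add: power2_eq_square field_simps)
  finally show ?thesis using s(1) by (simp add: mult_le_0_iff)
qed

text \<open>The Rayleigh quotient attains its minimum \<open>\<mu>\<close> on the compact unit sphere. The form shifted by \<open>\<mu>\<close> is positive
semidefinite and vanishes at the minimiser \<open>v\<close>, hence its linear part at \<open>v\<close> vanishes, which says that \<open>v\<close> is an
eigenvector.\<close>

lemma rayleigh_minimizer:
  assumes sym: "\<And>i j. i < k \<Longrightarrow> j < k \<Longrightarrow> a i j = a j i" and k: "0 < k"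
  obtains \<mu> v where "\<exists>i<k. v i \<noteq> 0" "\<And>i. i < k \<Longrightarrow> (\<Sum>j<k. a i j * v j) = \<mu> * v i"
    "\<And>x. \<mu> * (\<Sum>i<k. (x i)\<^sup>2) \<le> bilin k a x x"
proof -
  define cube where "cube = PiE UNIV (\<lambda>i. if i < k then {-1..1} else {0::real})"
  define sphere where "sphere = cube \<inter> {v. (\<Sum>i<k. (v i)\<^sup>2) = 1}"
  have "compactin (product_topology (\<lambda>_. euclidean) (UNIV :: nat set)) cube"
    unfolding cube_def by (subst compactin_PiE) auto
  then have "compact cube" by (simp add: euclidean_product_topology)
  moreover have "closed {v :: nat \<Rightarrow> real. (\<Sum>i<k. (v i)\<^sup>2) = 1}"
    by (intro closed_Collect_eq continuous_intros continuous_on_product_coordinates)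
  ultimately have cpt: "compact sphere"
    unfolding sphere_def by (rule compact_Int_closed)
  have "(\<lambda>i. if i = 0 then 1 else 0) \<in> sphere"
  proof -
    have "(\<Sum>i<k. (if i = 0 then 1 else 0 :: real)\<^sup>2) = (\<Sum>i<k. if i = 0 then 1 else 0)"
      by (intro sum.cong) auto
    then show ?thesis using k by (auto simp: sphere_def cube_def)
  qed
  then have ne: "sphere \<noteq> {}" by auto
  have "continuous_on sphere (\<lambda>v. bilin k a v v)"
    unfolding bilin_def
    by (intro continuous_intros continuous_on_subset[OF continuous_on_product_coordinates]) auto
  from continuous_attains_inf[OF cpt ne this] obtain v where v: "v \<in> sphere"
    and min: "\<And>x. x \<in> sphere \<Longrightarrow> bilin k a v v \<le> bilin k a x x" by blast
  have v1: "(\<Sum>i<k. (v i)\<^sup>2) = 1" using v by (simp add: sphere_def)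
  define \<mu> where "\<mu> = bilin k a v v"
  have ray: "\<mu> * (\<Sum>i<k. (x i)\<^sup>2) \<le> bilin k a x x" for x
  proof (cases "(\<Sum>i<k. (x i)\<^sup>2) = 0")
    case True
    then have "x i = 0" if "i < k" for i
      using that by (subst (asm) sum_nonneg_eq_0_iff) auto
    then have "bilin k a x x = 0" by (simp add: bilin_def)
    then show ?thesis using True by simp
  next
    case False
    define N where "N = sqrt (\<Sum>i<k. (x i)\<^sup>2)"
    have N: "0 < N" "N\<^sup>2 = (\<Sum>i<k. (x i)\<^sup>2)"
      using False by (auto simp: N_def sum_nonneg less_le)
    define y where "y i = (if i < k then (1 / N) * x i else 0)" for i
    have y1: "(\<Sum>i<k. (y i)\<^sup>2) = 1"
    proof -
      have "(\<Sum>i<k. (y i)\<^sup>2) = (\<Sum>i<k. (x i)\<^sup>2) / N\<^sup>2"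
        by (simp add: y_def power_divide sum_divide_distrib)
      then show ?thesis using N False by simp
    qed
    have y_le: "\<bar>y i\<bar> \<le> 1" if "i < k" for i
    proof -
      have "(y i)\<^sup>2 \<le> (\<Sum>i<k. (y i)\<^sup>2)" using that by (intro member_le_sum) auto
      then show ?thesis using y1 by (simp add: abs_le_square_iff[of _ 1, simplified] )
    qed
    have "y i \<in> (if i < k then {-1..1} else {0})" for i
    proof (cases "i < k")
      case True
      then show ?thesis using y_le[OF True] by (simp add: abs_le_iff)
    qed (simp add: y_def)
    then have "y \<in> sphere"
      using y1 unfolding sphere_def cube_def by (intro IntI CollectI PiE_I) auto
    then have "\<mu> \<le> bilin k a y y" unfolding \<mu>_def by (rule min)
    also have "bilin k a y y = bilin k a (\<lambda>i. (1 / N) * x i) (\<lambda>i. (1 / N) * x i)"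
      by (simp add: bilin_def y_def)
    also have "\<dots> = bilin k a x x / N\<^sup>2"
      by (simp only: bilin_scale_left bilin_scale_right) (simp add: power2_eq_square)
    finally have "\<mu> * N\<^sup>2 \<le> bilin k a x x" using N(1) by (simp add: le_divide_eq)
    then show ?thesis unfolding N(2) .
  qed
  define b where "b i j = a i j - (if i = j then \<mu> else 0)" for i j
  have b: "bilin k b x y = bilin k a x y - \<mu> * (\<Sum>i<k. x i * y i)" for x y
  proof -
    have "(\<Sum>j<k. x i * b i j * y j) = (\<Sum>j<k. x i * a i j * y j) - \<mu> * (x i * y i)" if "i < k" for i
    proof -
      have "(\<Sum>j<k. x i * b i j * y j) = (\<Sum>j<k. x i * a i j * y j - (if i = j then \<mu> * (x i * y i) else 0))"
        by (intro sum.cong) (auto simp: b_def algebra_simps)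
      then show ?thesis using that by (simp add: sum_subtractf)
    qed
    then show ?thesis by (simp add: bilin_def sum_subtractf sum_distrib_left)
  qed
  have psd: "0 \<le> bilin k b x x" for x using ray[of x] by (simp add: b power2_eq_square)
  have bv: "bilin k b v v = 0" using v1 by (simp add: b \<mu>_def power2_eq_square)
  have bsym: "bilin k b x y = bilin k b y x" for x y
    by (rule bilin_commute) (auto simp: b_def sym)
  define r where "r i = (\<Sum>j<k. b i j * v j)" for i
  have "bilin k b r v = 0"
  proof (rule linear_term_zero[where c = "bilin k b r r"])
    fix t :: real
    \<comment> \<open>Perturb the minimiser in the direction of the residual \<open>r\<close> of the eigenvalue equation.\<close>
    have "0 \<le> bilin k b (\<lambda>i. v i + t * r i) (\<lambda>i. v i + t * r i)" by (rule psd)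
    also have "\<dots> = 2 * t * bilin k b r v + t\<^sup>2 * bilin k b r r"
      by (simp only: bilin_add_left bilin_add_right bilin_scale_left bilin_scale_right bv bsym[of v r])
        (simp add: power2_eq_square)
    finally show "0 \<le> 2 * t * bilin k b r v + t\<^sup>2 * bilin k b r r" .
  qed (rule psd)
  then have "(\<Sum>i<k. r i * r i) = 0" by (simp add: bilin_right r_def)
  then have r0: "r i = 0" if "i < k" for i
    using that by (subst (asm) sum_nonneg_eq_0_iff) auto
  show ?thesis
  proof (rule that[of v \<mu>])
    show "\<exists>i<k. v i \<noteq> 0"
    proof (rule ccontr)
      assume "\<not> ?thesis"
      then have "(\<Sum>i<k. (v i)\<^sup>2) = 0" by (intro sum.neutral) auto
      then show False using v1 by simp
    qed
    show "(\<Sum>j<k. a i j * v j) = \<mu> * v i" if "i < k" for i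
    proof -
      have "r i = (\<Sum>j<k. a i j * v j - (if i = j then \<mu> * v i else 0))"
        unfolding r_def by (intro sum.cong) (auto simp: b_def algebra_simps)
      then show ?thesis using r0[OF that] that by (simp add: sum_subtractf)
    qed
  qed (rule ray)
qed

text \<open>The extreme values of the quadratic form are eigenvalues; the upper bound applies the minimisation to \<open>-A\<close>.\<close>

lemma eigenvalue_bounds_imp_form_bounds:
  fixes A :: "real mat"
  assumes A: "A \<in> carrier_mat k k" and k: "0 < k"
    and sym: "\<And>i j. i < k \<Longrightarrow> j < k \<Longrightarrow> A $$ (i, j) = A $$ (j, i)"
    and ev: "\<And>v. eigenvalue A v \<Longrightarrow> l \<le> v \<and> v \<le> u"
  shows "l * (\<Sum>i<k. (x i)\<^sup>2) \<le> bilin k (\<lambda>i j. A $$ (i, j)) x x"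
    and "bilin k (\<lambda>i j. A $$ (i, j)) x x \<le> u * (\<Sum>i<k. (x i)\<^sup>2)"
proof -
  have eig: "eigenvalue A \<mu>"
    if "\<exists>i<k. v i \<noteq> 0" "\<And>i. i < k \<Longrightarrow> (\<Sum>j<k. A $$ (i, j) * v j) = \<mu> * v i" for v \<mu>
  proof -
    have "eigenvector A (Matrix.vec k v) \<mu>"
      unfolding eigenvector_def
    proof (intro conjI)
      show "A *\<^sub>v Matrix.vec k v = \<mu> \<cdot>\<^sub>v Matrix.vec k v"
        using A that(2) by (intro eq_vecI) (auto simp: scalar_prod_def lessThan_atLeast0)
      show "Matrix.vec k v \<noteq> 0\<^sub>v (dim_row A)"
      proof
        assume *: "Matrix.vec k v = 0\<^sub>v (dim_row A)"
        have "v i = 0" if "i < k" for i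
          using arg_cong[OF *, of "\<lambda>w. w $ i"] that A by auto
        then show False using that(1) by auto
      qed
    qed (use A in auto)
    then show ?thesis by (auto simp: eigenvalue_def)
  qed
  have sq: "0 \<le> (\<Sum>i<k. (x i)\<^sup>2)" by (intro sum_nonneg) auto
  obtain \<mu> v where *: "\<exists>i<k. v i \<noteq> 0" "\<And>i. i < k \<Longrightarrow> (\<Sum>j<k. A $$ (i, j) * v j) = \<mu> * v i"
    "\<And>x. \<mu> * (\<Sum>i<k. (x i)\<^sup>2) \<le> bilin k (\<lambda>i j. A $$ (i, j)) x x"
    by (rule rayleigh_minimizer[of k "\<lambda>i j. A $$ (i, j)"]) (use sym k in auto)
  have "l \<le> \<mu>" using eig[OF *(1,2)] ev by auto
  from mult_right_mono[OF this sq] show "l * (\<Sum>i<k. (x i)\<^sup>2) \<le> bilin k (\<lambda>i j. A $$ (i, j)) x x"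
    using *(3)[of x] by linarith
  obtain \<mu>' v' where **: "\<exists>i<k. v' i \<noteq> 0" "\<And>i. i < k \<Longrightarrow> (\<Sum>j<k. - A $$ (i, j) * v' j) = \<mu>' * v' i"
    "\<And>x. \<mu>' * (\<Sum>i<k. (x i)\<^sup>2) \<le> bilin k (\<lambda>i j. - A $$ (i, j)) x x"
    by (rule rayleigh_minimizer[of k "\<lambda>i j. - A $$ (i, j)"]) (use sym k in auto)
  have "eigenvalue A (- \<mu>')"
    by (rule eig[OF **(1)]) (use **(2) in \<open>auto simp: sum_negf minus_equation_iff[of _ "_ * _"]\<close>)
  then have "- u \<le> \<mu>'" using ev by force
  moreover have "bilin k (\<lambda>i j. - A $$ (i, j)) x x = - bilin k (\<lambda>i j. A $$ (i, j)) x x"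
    by (simp add: bilin_def sum_negf)
  ultimately show "bilin k (\<lambda>i j. A $$ (i, j)) x x \<le> u * (\<Sum>i<k. (x i)\<^sup>2)"
    using **(3)[of x] mult_right_mono[OF \<open>- u \<le> \<mu>'\<close> sq] by simp
qed

text \<open>An injective square matrix is invertible, so the conventional value for singular matrices does not occur.\<close>

lemma mat_inv_or_zero_inverse:
  fixes A :: "real mat"
  assumes A: "A \<in> carrier_mat k k"
    and inj: "\<And>v. v \<in> carrier_vec k \<Longrightarrow> A *\<^sub>v v = 0\<^sub>v k \<Longrightarrow> v = 0\<^sub>v k"
  shows "mat_inv_or_zero A \<in> carrier_mat k k" "A * mat_inv_or_zero A = 1\<^sub>m k"
proof -
  have "det A \<noteq> 0" using det_0_iff_vec_prod_zero[OF A] inj by auto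
  then have "A \<in> Units (ring_mat TYPE(real) k undefined)"
    by (rule det_non_zero_imp_unit[OF A])
  then obtain B where B: "mat_inverse A = Some B"
    using mat_inverse(1)[OF A, of undefined] by (cases "mat_inverse A") auto
  show "mat_inv_or_zero A \<in> carrier_mat k k" "A * mat_inv_or_zero A = 1\<^sub>m k"
    using mat_inverse(2)[OF A B] B by (auto simp: mat_inv_or_zero_def)
qed

text \<open>With \<open>\<beta> = G\<^sup>-\<^sup>1 h\<close> the fitted values are \<open>\<phi>\<^sup>T \<beta>\<close>, so their mean square is \<open>\<beta>\<^sup>T G \<beta>\<close>.\<close>

lemma criterion_solves_normal_equations:
  fixes \<phi> :: "nat \<Rightarrow> 'x \<times> real \<Rightarrow> real"
  defines "G \<equiv> \<lambda>r x y n i j. (\<Sum>a<n. r a * \<phi> i (x a, y a) * \<phi> j (x a, y a)) / real n"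
    and "h \<equiv> \<lambda>\<tau> \<delta> r x y z n j. (\<Sum>a<n. r a * \<phi> j (x a, y a) * (\<tau> (x a, y a) - \<delta> (x a, z a))) / real n"
  assumes n: "0 < n" and c: "0 < c" and pos: "\<And>v. c * (\<Sum>i<k. (v i)\<^sup>2) \<le> bilin k (G r x y n) v v"
  obtains \<beta> where "\<And>i. i < k \<Longrightarrow> (\<Sum>j<k. G r x y n i j * \<beta> j) = h \<tau> \<delta> r x y z n i"
    "criterion \<phi> k \<tau> n r x y z \<delta> = bilin k (G r x y n) \<beta> \<beta>"
proof -
  define w where "w l = (x l, y l)" for l
  define U where "U l = \<tau> (x l, y l) - \<delta> (x l, z l)" for l
  define P where "P = design_mat \<phi> k n w"
  define N where "N = transpose_mat P * mat_diag n r * P"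
  have P: "P \<in> carrier_mat n k" by (simp add: P_def design_mat_def)
  have N: "N \<in> carrier_mat k k"
    unfolding N_def by (intro mult_carrier_mat[OF mult_carrier_mat[OF transpose_carrier_mat[THEN iffD2, OF P] mat_diag_dim] P])
  have N_ij: "N $$ (i, j) = real n * G r x y n i j" if "i < k" "j < k" for i j
  proof -
    have "(transpose_mat P * mat_diag n r) $$ (i, a) = \<phi> i (w a) * r a" if "a < n" for a
      using \<open>i < k\<close> that P by (subst mat_diag_mult_right[of _ k]) (auto simp: P_def design_mat_def)
    moreover have "N $$ (i, j) = (\<Sum>a<n. (transpose_mat P * mat_diag n r) $$ (i, a) * P $$ (a, j))"
    proof -
      have Q: "transpose_mat P * mat_diag n r \<in> carrier_mat k n"
        by (intro mult_carrier_mat[OF transpose_carrier_mat[THEN iffD2, OF P] mat_diag_dim])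
      show ?thesis
        unfolding N_def using that P carrier_matD[OF Q]
        by (subst index_mult_mat(1)) (auto simp del: index_mult_mat(2,3) simp: scalar_prod_def lessThan_atLeast0 intro!: sum.cong)
    qed
    ultimately have "N $$ (i, j) = (\<Sum>a<n. \<phi> i (w a) * r a * \<phi> j (w a))"
      using that by (simp add: P_def design_mat_def)
    then show ?thesis using n by (simp add: G_def w_def mult_ac)
  qed
  have Nv: "(N *\<^sub>v v) $ i = real n * (\<Sum>j<k. G r x y n i j * v $ j)" if "i < k" "v \<in> carrier_vec k" for i v
    using that N N_ij by (simp add: scalar_prod_def lessThan_atLeast0 sum_distrib_left mult.assoc)
  have inj: "v = 0\<^sub>v k" if v: "v \<in> carrier_vec k" "N *\<^sub>v v = 0\<^sub>v k" for v
  proof -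
    have "(\<Sum>j<k. G r x y n i j * v $ j) = 0" if "i < k" for i
      using Nv[OF that v(1)] v(2) that n by simp
    then have "bilin k (G r x y n) (\<lambda>i. v $ i) (\<lambda>i. v $ i) = 0"
      by (simp add: bilin_right)
    then have "c * (\<Sum>i<k. (v $ i)\<^sup>2) \<le> 0" using pos[of "\<lambda>i. v $ i"] by simp
    then have "(\<Sum>i<k. (v $ i)\<^sup>2) = 0"
      using c by (simp add: mult_le_0_iff sum_nonneg order_antisym)
    then have "v $ i = 0" if "i < k" for i
      using that by (subst (asm) sum_nonneg_eq_0_iff) auto
    then show ?thesis using v(1) by (intro eq_vecI) auto
  qed
  note inv = mat_inv_or_zero_inverse[OF N inj]
  define s where "s = Matrix.vec k (\<lambda>j. \<Sum>a<n. r a * \<phi> j (w a) * U a)"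
  define \<beta>v where "\<beta>v = mat_inv_or_zero N *\<^sub>v s"
  have s: "s \<in> carrier_vec k" by (simp add: s_def)
  have \<beta>v: "\<beta>v \<in> carrier_vec k" unfolding \<beta>v_def by (rule mult_mat_vec_carrier[OF inv(1) s])
  have "N *\<^sub>v \<beta>v = s"
    unfolding \<beta>v_def using assoc_mult_mat_vec[OF N inv(1) s] inv(2) s by simp
  then have normal: "(\<Sum>j<k. G r x y n i j * \<beta>v $ j) = h \<tau> \<delta> r x y z n i" if "i < k" for i
    using Nv[OF that \<beta>v] that n by (simp add: s_def h_def w_def U_def field_simps)
  have reg: "series_reg \<phi> k n r (\<lambda>l. (x l, y l)) (\<lambda>l. \<tau> (x l, y l) - \<delta> (x l, z l)) v = (\<Sum>j<k. \<phi> j v * \<beta>v $ j)" for v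
  proof -
    have w_eq: "w = (\<lambda>l. (x l, y l))" by (simp add: w_def fun_eq_iff)
    have "series_reg \<phi> k n r (\<lambda>l. (x l, y l)) (\<lambda>l. \<tau> (x l, y l) - \<delta> (x l, z l)) v = scalar_prod (basis_vec \<phi> k v) \<beta>v"
      unfolding series_reg_def Let_def \<beta>v_def s_def N_def P_def U_def w_eq ..
    then show ?thesis using carrier_vecD[OF \<beta>v] by (simp add: basis_vec_def scalar_prod_def lessThan_atLeast0)
  qed
  have "criterion \<phi> k \<tau> n r x y z \<delta> = (\<Sum>a<n. r a * ((\<Sum>i<k. \<phi> i (x a, y a) * \<beta>v $ i) * (\<Sum>j<k. \<phi> j (x a, y a) * \<beta>v $ j))) / real n"
    by (simp add: criterion_def reg power2_eq_square)
  also have "\<dots> = (\<Sum>a<n. \<Sum>i<k. \<Sum>j<k. \<beta>v $ i * (r a * \<phi> i (x a, y a) * \<phi> j (x a, y a) / real n) * \<beta>v $ j)"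
    by (simp add: sum_product sum_distrib_left sum_divide_distrib mult_ac)
  also have "\<dots> = (\<Sum>i<k. \<Sum>j<k. \<Sum>a<n. \<beta>v $ i * (r a * \<phi> i (x a, y a) * \<phi> j (x a, y a) / real n) * \<beta>v $ j)"
    by (subst sum.swap, rule sum.cong[OF refl], rule sum.swap)
  also have "\<dots> = bilin k (G r x y n) (\<lambda>i. \<beta>v $ i) (\<lambda>i. \<beta>v $ i)"
    by (simp add: bilin_def G_def sum_distrib_left sum_distrib_right sum_divide_distrib)
  finally show ?thesis using normal by (intro that[of "\<lambda>i. \<beta>v $ i"]) auto
qed

text \<open>Since \<open>\<beta>\<^sup>T G \<beta> = \<beta>\<^sup>T h\<close> and \<open>|h|\<^sup>2 = h\<^sup>T G \<beta>\<close>, both bounds follow by completing a square.\<close>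

lemma normal_equations_bounds:
  assumes sym: "\<And>i j. i < k \<Longrightarrow> j < k \<Longrightarrow> G i j = G j i" and c: "0 < c" and C: "0 < C"
    and lower: "\<And>v. c * (\<Sum>i<k. (v i)\<^sup>2) \<le> bilin k G v v" and upper: "\<And>v. bilin k G v v \<le> C * (\<Sum>i<k. (v i)\<^sup>2)"
    and normal: "\<And>i. i < k \<Longrightarrow> (\<Sum>j<k. G i j * \<beta> j) = h i"
  shows "bilin k G \<beta> \<beta> \<le> (\<Sum>i<k. (h i)\<^sup>2) / c" "(\<Sum>i<k. (h i)\<^sup>2) \<le> C * bilin k G \<beta> \<beta>"
proof -
  have psd: "0 \<le> bilin k G v v" for v
    using lower[of v] c by (intro order_trans[OF mult_nonneg_nonneg lower]) (auto intro: sum_nonneg)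
  have \<beta>h: "bilin k G \<beta> \<beta> = (\<Sum>i<k. \<beta> i * h i)" by (simp add: bilin_right normal)
  have "\<beta> i * h i \<le> c / 2 * (\<beta> i)\<^sup>2 + (h i)\<^sup>2 / (2 * c)" for i
  proof -
    have "0 \<le> (c * \<beta> i - h i)\<^sup>2 / (2 * c)" using c by simp
    also have "\<dots> = c / 2 * (\<beta> i)\<^sup>2 + (h i)\<^sup>2 / (2 * c) - \<beta> i * h i"
      using c by (simp add: power2_eq_square field_simps)
    finally show ?thesis by simp
  qed
  then have "bilin k G \<beta> \<beta> \<le> (\<Sum>i<k. c / 2 * (\<beta> i)\<^sup>2 + (h i)\<^sup>2 / (2 * c))"
    unfolding \<beta>h by (intro sum_mono)
  also have "\<dots> = (c * (\<Sum>i<k. (\<beta> i)\<^sup>2)) / 2 + (\<Sum>i<k. (h i)\<^sup>2) / c / 2"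
    by (simp add: sum.distrib sum_distrib_left sum_divide_distrib mult.commute)
  also have "\<dots> \<le> bilin k G \<beta> \<beta> / 2 + (\<Sum>i<k. (h i)\<^sup>2) / c / 2"
    using lower[of \<beta>] by simp
  finally show "bilin k G \<beta> \<beta> \<le> (\<Sum>i<k. (h i)\<^sup>2) / c" by simp
  have "0 \<le> bilin k G (\<lambda>i. h i + (- C) * \<beta> i) (\<lambda>i. h i + (- C) * \<beta> i)" by (rule psd)
  also have "\<dots> = bilin k G h h - 2 * C * bilin k G h \<beta> + C\<^sup>2 * bilin k G \<beta> \<beta>"
    by (simp only: bilin_add_left bilin_add_right bilin_scale_left bilin_scale_right bilin_commute[OF sym, where x = \<beta> and y = h])
      (simp add: power2_eq_square algebra_simps)
  also have "bilin k G h \<beta> = (\<Sum>i<k. (h i)\<^sup>2)"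
    by (simp add: bilin_right normal power2_eq_square)
  finally have "2 * C * (\<Sum>i<k. (h i)\<^sup>2) \<le> C * (\<Sum>i<k. (h i)\<^sup>2) + C\<^sup>2 * bilin k G \<beta> \<beta>"
    using upper[of h] by linarith
  then have "C * (\<Sum>i<k. (h i)\<^sup>2) \<le> C * (C * bilin k G \<beta> \<beta>)" by (simp add: power2_eq_square)
  then show "(\<Sum>i<k. (h i)\<^sup>2) \<le> C * bilin k G \<beta> \<beta>" using C by simp
qed

section \<open>Conditional means and projection coefficients\<close>

locale missing_outcome = prob_space M for M :: "'s measure" +
  fixes R Y Z :: "'s \<Rightarrow> real" and X :: "'s \<Rightarrow> 'x::euclidean_space"
  assumes R_meas[measurable]: "R \<in> borel_measurable M" and X_meas[measurable]: "X \<in> borel_measurable M"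
    and Y_meas[measurable]: "Y \<in> borel_measurable M" and Z_meas[measurable]: "Z \<in> borel_measurable M"
    and R01: "\<And>\<omega>. \<omega> \<in> space M \<Longrightarrow> R \<omega> \<in> {0, 1}"
begin

definition info :: "'s measure" where
  "info = vimage_algebra (space M) (\<lambda>\<omega>. (R \<omega>, X \<omega>, Y \<omega>)) borel"

lemma cond_mean_info: "cond_mean M R X Y B = real_cond_exp M info B"
  by (simp add: cond_mean_def info_def)

lemma subalgebra_info: "subalgebra M info"
proof -
  have "sets info \<subseteq> sets M"
    unfolding info_def
    by (rule sets_image_in_sets) (auto intro!: borel_measurable_Pair)
  then show ?thesis by (simp add: subalgebra_def info_def)
qed

sublocale info: finite_measure_subalgebra M info
  by unfold_locales (rule subalgebra_info)

lemma measurable_info: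
  assumes "f \<in> borel_measurable borel"
  shows "(\<lambda>\<omega>. f (R \<omega>, X \<omega>, Y \<omega>)) \<in> borel_measurable info"
  unfolding info_def by (rule measurable_compose[OF measurable_vimage_algebra1 assms]) auto

lemma measurable_info_XY:
  assumes "f \<in> borel_measurable borel"
  shows "(\<lambda>\<omega>. R \<omega> * f (X \<omega>, Y \<omega>)) \<in> borel_measurable info"
proof -
  note [measurable] = assms
  have "(\<lambda>t :: real \<times> 'x \<times> real. fst t * f (snd t)) \<in> borel_measurable borel"
    by (intro borel_measurable_times measurable_compose[OF _ assms] borel_measurable_continuous_onI continuous_intros)
  from measurable_info[OF this] show ?thesis by simp
qed

lemma cond_mean_measurable[measurable]: "cond_mean M R X Y B \<in> borel_measurable M"
  unfolding cond_mean_info by (rule borel_measurable_cond_exp2)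

lemma cond_mean_bounded:
  assumes [measurable]: "B \<in> borel_measurable M" and b: "AE \<omega> in M. \<bar>B \<omega>\<bar> \<le> K"
  shows "AE \<omega> in M. \<bar>cond_mean M R X Y B \<omega>\<bar> \<le> K"
proof -
  have int: "integrable M B" by (rule integrable_const_bound[of _ K]) (use b in auto)
  have "AE \<omega> in M. - K \<le> real_cond_exp M info B \<omega>"
    by (rule info.real_cond_exp_ge_c[OF int]) (use b in \<open>auto elim: eventually_mono\<close>)
  moreover have "AE \<omega> in M. real_cond_exp M info B \<omega> \<le> K"
    by (rule info.real_cond_exp_le_c[OF int]) (use b in \<open>auto elim: eventually_mono\<close>)
  ultimately show ?thesis
    unfolding cond_mean_info by eventually_elim (simp add: abs_le_iff)
qed

lemma cond_mean_diff:
  assumes "B \<in> borel_measurable M" "AE \<omega> in M. \<bar>B \<omega>\<bar> \<le> K"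
    and "B' \<in> borel_measurable M" "AE \<omega> in M. \<bar>B' \<omega>\<bar> \<le> K'"
  shows "AE \<omega> in M. cond_mean M R X Y (\<lambda>\<omega>. B \<omega> - B' \<omega>) \<omega> = cond_mean M R X Y B \<omega> - cond_mean M R X Y B' \<omega>"
  unfolding cond_mean_info
  by (rule info.real_cond_exp_diff; rule integrable_const_bound[where B = K] integrable_const_bound[where B = K'])
    (use assms in simp_all)

lemma integral_cond_mean:
  assumes f: "f \<in> borel_measurable borel" "integrable M (\<lambda>\<omega>. R \<omega> * f (X \<omega>, Y \<omega>))"
    and B[measurable]: "B \<in> borel_measurable M" and b: "AE \<omega> in M. \<bar>B \<omega>\<bar> \<le> K"
  shows "(\<integral>\<omega>. R \<omega> * f (X \<omega>, Y \<omega>) * cond_mean M R X Y B \<omega> \<partial>M) = (\<integral>\<omega>. R \<omega> * f (X \<omega>, Y \<omega>) * B \<omega> \<partial>M)"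
proof -
  note [measurable] = f(1)
  have "integrable M (\<lambda>\<omega>. R \<omega> * f (X \<omega>, Y \<omega>) * B \<omega>)"
  proof (rule Bochner_Integration.integrable_bound)
    show "integrable M (\<lambda>\<omega>. K * (R \<omega> * f (X \<omega>, Y \<omega>)))" using f by auto
    show "AE \<omega> in M. norm (R \<omega> * f (X \<omega>, Y \<omega>) * B \<omega>) \<le> norm (K * (R \<omega> * f (X \<omega>, Y \<omega>)))"
      using b by eventually_elim (auto simp: abs_mult mult.commute intro!: mult_right_mono)
  qed measurable
  then show ?thesis
    unfolding cond_mean_info by (intro info.real_cond_exp_intg measurable_info_XY f B)
qed

lemma R_nonneg: "\<omega> \<in> space M \<Longrightarrow> 0 \<le> R \<omega>"
  using R01 by fastforce

lemma integrable_R_times_product: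
  fixes f g :: "'s \<Rightarrow> real"
  assumes [measurable]: "f \<in> borel_measurable M" "g \<in> borel_measurable M"
    and "integrable M (\<lambda>\<omega>. R \<omega> * (f \<omega>)\<^sup>2)" "integrable M (\<lambda>\<omega>. R \<omega> * (g \<omega>)\<^sup>2)"
  shows "integrable M (\<lambda>\<omega>. R \<omega> * (f \<omega> * g \<omega>))"
proof (rule Bochner_Integration.integrable_bound)
  show "integrable M (\<lambda>\<omega>. R \<omega> * (f \<omega>)\<^sup>2 + R \<omega> * (g \<omega>)\<^sup>2)" using assms by auto
  have "\<bar>a * b\<bar> \<le> a\<^sup>2 + b\<^sup>2" for a b :: real
  proof -
    have "2 * (\<bar>a\<bar> * \<bar>b\<bar>) \<le> a\<^sup>2 + b\<^sup>2"
      using sum_squares_bound[of "\<bar>a\<bar>" "\<bar>b\<bar>"] by simp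
    moreover have "0 \<le> \<bar>a\<bar> * \<bar>b\<bar>" by simp
    ultimately show ?thesis unfolding abs_mult by linarith
  qed
  then show "AE \<omega> in M. norm (R \<omega> * (f \<omega> * g \<omega>)) \<le> norm (R \<omega> * (f \<omega>)\<^sup>2 + R \<omega> * (g \<omega>)\<^sup>2)"
    using R_nonneg by (intro AE_I2) (simp add: abs_mult distrib_left[symmetric] mult_left_mono)
qed measurable

lemma form_eq_integral:
  assumes [measurable]: "\<And>j. j < k \<Longrightarrow> f j \<in> borel_measurable M"
    and f2: "\<And>j. j < k \<Longrightarrow> integrable M (\<lambda>\<omega>. R \<omega> * (f j \<omega>)\<^sup>2)"
  shows "integrable M (\<lambda>\<omega>. R \<omega> * (\<Sum>j<k. v j * f j \<omega>)\<^sup>2)"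
    and "bilin k (\<lambda>i j. \<integral>\<omega>. R \<omega> * (f i \<omega> * f j \<omega>) \<partial>M) v v = (\<integral>\<omega>. R \<omega> * (\<Sum>j<k. v j * f j \<omega>)\<^sup>2 \<partial>M)"
proof -
  have int: "integrable M (\<lambda>\<omega>. R \<omega> * (f i \<omega> * f j \<omega>))" if "i < k" "j < k" for i j
    using that assms by (intro integrable_R_times_product) auto
  have eq: "R \<omega> * (\<Sum>j<k. v j * f j \<omega>)\<^sup>2 = (\<Sum>i<k. \<Sum>j<k. v i * (R \<omega> * (f i \<omega> * f j \<omega>)) * v j)" for \<omega>
  proof -
    have "R \<omega> * (\<Sum>j<k. v j * f j \<omega>)\<^sup>2 = R \<omega> * (\<Sum>i<k. \<Sum>j<k. (v i * f i \<omega>) * (v j * f j \<omega>))"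
      by (simp only: power2_eq_square sum_product)
    then show ?thesis by (simp add: sum_distrib_left mult_ac)
  qed
  show "integrable M (\<lambda>\<omega>. R \<omega> * (\<Sum>j<k. v j * f j \<omega>)\<^sup>2)"
    unfolding eq using int by (intro Bochner_Integration.integrable_sum) auto
  show "bilin k (\<lambda>i j. \<integral>\<omega>. R \<omega> * (f i \<omega> * f j \<omega>) \<partial>M) v v = (\<integral>\<omega>. R \<omega> * (\<Sum>j<k. v j * f j \<omega>)\<^sup>2 \<partial>M)"
  proof -
    have "(\<integral>\<omega>. (\<Sum>i<k. \<Sum>j<k. v i * (R \<omega> * (f i \<omega> * f j \<omega>)) * v j) \<partial>M)
      = (\<Sum>i<k. \<integral>\<omega>. (\<Sum>j<k. v i * (R \<omega> * (f i \<omega> * f j \<omega>)) * v j) \<partial>M)"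
      using int by (intro Bochner_Integration.integral_sum Bochner_Integration.integrable_sum) auto
    also have "\<dots> = (\<Sum>i<k. \<Sum>j<k. \<integral>\<omega>. v i * (R \<omega> * (f i \<omega> * f j \<omega>)) * v j \<partial>M)"
      using int by (intro sum.cong refl Bochner_Integration.integral_sum) auto
    finally show ?thesis by (simp add: eq bilin_def)
  qed
qed

text \<open>\<open>H\<close> is the vector of inner products of \<open>g\<close> with the \<open>f j\<close> under the weight \<open>R\<close>. The first bound is Bessel's
inequality. For the second, let \<open>s\<close> be the approximation of \<open>g\<close> with coefficients \<open>p\<close>: then \<open>\<parallel>s\<parallel>\<^sup>2 = \<langle>p, H\<rangle> - \<langle>s, g - s\<rangle>\<close>, and
\<open>|p|\<^sup>2\<close> is at most \<open>\<parallel>s\<parallel>\<^sup>2 / l\<close>, so all terms can be absorbed except \<open>|H|\<^sup>2\<close> and \<open>r\<^sup>2\<close>.\<close>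

lemma projection_coefficients_bounds:
  fixes f :: "nat \<Rightarrow> 's \<Rightarrow> real" and g :: "'s \<Rightarrow> real"
  defines "\<Gamma> \<equiv> \<lambda>i j. \<integral>\<omega>. R \<omega> * (f i \<omega> * f j \<omega>) \<partial>M" and "H \<equiv> \<lambda>j. \<integral>\<omega>. R \<omega> * (f j \<omega> * g \<omega>) \<partial>M"
  assumes f: "\<And>j. j < k \<Longrightarrow> f j \<in> borel_measurable M"
    and f2: "\<And>j. j < k \<Longrightarrow> integrable M (\<lambda>\<omega>. R \<omega> * (f j \<omega>)\<^sup>2)"
    and g: "g \<in> borel_measurable M" and g2: "integrable M (\<lambda>\<omega>. R \<omega> * (g \<omega>)\<^sup>2)"
    and l: "0 < l" and u: "0 < u"
    and lower: "\<And>v. l * (\<Sum>i<k. (v i)\<^sup>2) \<le> bilin k \<Gamma> v v"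
    and upper: "\<And>v. bilin k \<Gamma> v v \<le> u * (\<Sum>i<k. (v i)\<^sup>2)"
  shows "(\<Sum>j<k. (H j)\<^sup>2) \<le> u * (\<integral>\<omega>. R \<omega> * (g \<omega>)\<^sup>2 \<partial>M)"
    and "\<And>p r. AE \<omega> in M. R \<omega> * \<bar>g \<omega> - (\<Sum>j<k. p j * f j \<omega>)\<bar> \<le> r \<Longrightarrow> 0 \<le> r \<Longrightarrow>
      (\<integral>\<omega>. R \<omega> * (g \<omega>)\<^sup>2 \<partial>M) \<le> 4 / l * (\<Sum>j<k. (H j)\<^sup>2) + 6 * r\<^sup>2"
proof -
  note [measurable] = g
  have S_meas[measurable]: "(\<lambda>\<omega>. \<Sum>j<k. v j * f j \<omega>) \<in> borel_measurable M" for v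
    using f by (intro borel_measurable_sum) auto
  have S_int: "integrable M (\<lambda>\<omega>. R \<omega> * (\<Sum>j<k. v j * f j \<omega>)\<^sup>2)" for v
    by (rule form_eq_integral(1)) (use f f2 in auto)
  have S_form: "(\<integral>\<omega>. R \<omega> * (\<Sum>j<k. v j * f j \<omega>)\<^sup>2 \<partial>M) = bilin k \<Gamma> v v" for v
    unfolding \<Gamma>_def by (rule form_eq_integral(2)[symmetric]) (use f f2 in auto)
  have Sg_int: "integrable M (\<lambda>\<omega>. R \<omega> * ((\<Sum>j<k. v j * f j \<omega>) * g \<omega>))" for v
    by (rule integrable_R_times_product[OF S_meas g S_int g2])
  have Sg: "(\<integral>\<omega>. R \<omega> * ((\<Sum>j<k. v j * f j \<omega>) * g \<omega>) \<partial>M) = (\<Sum>j<k. v j * H j)" for v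
  proof -
    have int: "integrable M (\<lambda>\<omega>. R \<omega> * (f j \<omega> * g \<omega>))" if "j < k" for j
      using that f f2 g g2 by (intro integrable_R_times_product) auto
    have "(\<integral>\<omega>. R \<omega> * ((\<Sum>j<k. v j * f j \<omega>) * g \<omega>) \<partial>M) = (\<integral>\<omega>. (\<Sum>j<k. v j * (R \<omega> * (f j \<omega> * g \<omega>))) \<partial>M)"
      by (simp add: sum_distrib_left sum_distrib_right mult_ac)
    then show ?thesis using int by (simp add: H_def Bochner_Integration.integral_sum)
  qed
  let ?w = "\<integral>\<omega>. R \<omega> * (g \<omega>)\<^sup>2 \<partial>M"
  have "2 * (\<Sum>j<k. H j * H j) = (\<integral>\<omega>. 2 * (R \<omega> * ((\<Sum>j<k. H j * f j \<omega>) * g \<omega>)) \<partial>M)"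
    using Sg[of H] by simp
  also have "\<dots> \<le> (\<integral>\<omega>. R \<omega> * (\<Sum>j<k. H j * f j \<omega>)\<^sup>2 / u + u * (R \<omega> * (g \<omega>)\<^sup>2) \<partial>M)"
  proof (rule integral_mono)
    fix \<omega> assume \<omega>: "\<omega> \<in> space M"
    define s where "s = (\<Sum>j<k. H j * f j \<omega>)"
    have "0 \<le> R \<omega> * ((s - u * g \<omega>)\<^sup>2 / u)" using R_nonneg[OF \<omega>] u by simp
    also have "\<dots> = R \<omega> * s\<^sup>2 / u + u * (R \<omega> * (g \<omega>)\<^sup>2) - 2 * (R \<omega> * (s * g \<omega>))"
      using u by (simp add: power2_eq_square field_simps)
    finally show "2 * (R \<omega> * ((\<Sum>j<k. H j * f j \<omega>) * g \<omega>))
      \<le> R \<omega> * (\<Sum>j<k. H j * f j \<omega>)\<^sup>2 / u + u * (R \<omega> * (g \<omega>)\<^sup>2)"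
      by (simp add: s_def)
  qed (use Sg_int S_int g2 in auto)
  also have "\<dots> = bilin k \<Gamma> H H / u + u * ?w"
    using S_int[of H] g2 S_form[of H] by simp
  also have "\<dots> \<le> (\<Sum>j<k. (H j)\<^sup>2) + u * ?w"
    using upper[of H] u by (simp add: divide_le_eq mult.commute)
  finally show "(\<Sum>j<k. (H j)\<^sup>2) \<le> u * ?w" by (simp add: power2_eq_square)
  fix p :: "nat \<Rightarrow> real" and r :: real
  assume ae: "AE \<omega> in M. R \<omega> * \<bar>g \<omega> - (\<Sum>j<k. p j * f j \<omega>)\<bar> \<le> r" and r: "0 \<le> r"
  define s where "s \<omega> = (\<Sum>j<k. p j * f j \<omega>)" for \<omega>
  have s_meas[measurable]: "s \<in> borel_measurable M" unfolding s_def[abs_def] by simp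
  have s_int: "integrable M (\<lambda>\<omega>. R \<omega> * (s \<omega>)\<^sup>2)" using S_int[of p] by (simp add: s_def)
  have sg_int: "integrable M (\<lambda>\<omega>. R \<omega> * (s \<omega> * g \<omega>))" using Sg_int[of p] by (simp add: s_def)
  define A2 where "A2 = (\<integral>\<omega>. R \<omega> * (s \<omega>)\<^sup>2 \<partial>M)"
  have ae2: "AE \<omega> in M. R \<omega> * (g \<omega> - s \<omega>)\<^sup>2 \<le> r\<^sup>2"
    using ae AE_space
  proof eventually_elim
    fix \<omega> assume \<omega>: "\<omega> \<in> space M" and le: "R \<omega> * \<bar>g \<omega> - (\<Sum>j<k. p j * f j \<omega>)\<bar> \<le> r"
    show "R \<omega> * (g \<omega> - s \<omega>)\<^sup>2 \<le> r\<^sup>2"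
    proof (cases "R \<omega> = 0")
      case False
      then have "R \<omega> = 1" using R01[OF \<omega>] by auto
      then have "\<bar>g \<omega> - s \<omega>\<bar> \<le> r" using le by (simp add: s_def)
      then show ?thesis using \<open>R \<omega> = 1\<close> r power_mono[of "\<bar>g \<omega> - s \<omega>\<bar>" r 2] by simp
    qed simp
  qed
  have e_int: "integrable M (\<lambda>\<omega>. R \<omega> * (g \<omega> - s \<omega>)\<^sup>2)"
  proof -
    have "R \<omega> * (g \<omega> - s \<omega>)\<^sup>2 = R \<omega> * (g \<omega>)\<^sup>2 + R \<omega> * (s \<omega>)\<^sup>2 - 2 * (R \<omega> * (s \<omega> * g \<omega>))" for \<omega>
      by (simp add: power2_eq_square algebra_simps)
    then show ?thesis using s_int g2 sg_int by simp
  qed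
  have e_le: "(\<integral>\<omega>. R \<omega> * (g \<omega> - s \<omega>)\<^sup>2 \<partial>M) \<le> r\<^sup>2"
    using integral_mono_AE[OF e_int _ ae2] by (simp add: prob_space)
  have w_le: "?w \<le> 2 * A2 + 2 * r\<^sup>2"
  proof -
    have "?w \<le> (\<integral>\<omega>. 2 * (R \<omega> * (s \<omega>)\<^sup>2) + 2 * (R \<omega> * (g \<omega> - s \<omega>)\<^sup>2) \<partial>M)"
    proof (rule integral_mono)
      fix \<omega> assume \<omega>: "\<omega> \<in> space M"
      have "0 \<le> R \<omega> * (2 * s \<omega> - g \<omega>)\<^sup>2" using R_nonneg[OF \<omega>] by simp
      then show "R \<omega> * (g \<omega>)\<^sup>2 \<le> 2 * (R \<omega> * (s \<omega>)\<^sup>2) + 2 * (R \<omega> * (g \<omega> - s \<omega>)\<^sup>2)"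
        by (simp add: power2_eq_square algebra_simps)
    qed (use s_int g2 e_int in auto)
    also have "\<dots> = 2 * A2 + 2 * (\<integral>\<omega>. R \<omega> * (g \<omega> - s \<omega>)\<^sup>2 \<partial>M)"
      using s_int e_int by (simp add: A2_def)
    finally show ?thesis using e_le by simp
  qed
  have A2_le: "A2 \<le> 2 / l * (\<Sum>j<k. (H j)\<^sup>2) + 2 * r\<^sup>2"
  proof -
    have form: "A2 = bilin k \<Gamma> p p" using S_form[of p] by (simp add: A2_def s_def)
    have "(\<integral>\<omega>. R \<omega> * (s \<omega>)\<^sup>2 \<partial>M) \<le> (\<integral>\<omega>. R \<omega> * (s \<omega> * g \<omega>) + (R \<omega> * (s \<omega>)\<^sup>2 / 4 + R \<omega> * (g \<omega> - s \<omega>)\<^sup>2) \<partial>M)"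
    proof (rule integral_mono)
      fix \<omega> assume \<omega>: "\<omega> \<in> space M"
      have "0 \<le> R \<omega> * (s \<omega> / 2 + (g \<omega> - s \<omega>))\<^sup>2" using R_nonneg[OF \<omega>] by simp
      then show "R \<omega> * (s \<omega>)\<^sup>2 \<le> R \<omega> * (s \<omega> * g \<omega>) + (R \<omega> * (s \<omega>)\<^sup>2 / 4 + R \<omega> * (g \<omega> - s \<omega>)\<^sup>2)"
        by (simp add: power2_eq_square algebra_simps)
    qed (use s_int sg_int e_int in auto)
    also have "\<dots> = (\<Sum>j<k. p j * H j) + (A2 / 4 + (\<integral>\<omega>. R \<omega> * (g \<omega> - s \<omega>)\<^sup>2 \<partial>M))"
      using s_int sg_int e_int Sg[of p] by (simp add: A2_def s_def)
    also have "(\<Sum>j<k. p j * H j) \<le> (\<Sum>j<k. l / 4 * (p j)\<^sup>2 + (H j)\<^sup>2 / l)"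
    proof (rule sum_mono)
      fix j
      have "0 \<le> (l * p j / 2 - H j)\<^sup>2 / l" using l by simp
      also have "\<dots> = l / 4 * (p j)\<^sup>2 + (H j)\<^sup>2 / l - p j * H j"
        using l by (simp add: power2_eq_square field_simps)
      finally show "p j * H j \<le> l / 4 * (p j)\<^sup>2 + (H j)\<^sup>2 / l" by simp
    qed
    also have "\<dots> = (l * (\<Sum>j<k. (p j)\<^sup>2)) / 4 + (\<Sum>j<k. (H j)\<^sup>2) / l"
      by (simp add: sum.distrib sum_distrib_left sum_divide_distrib)
    finally have "A2 \<le> (l * (\<Sum>j<k. (p j)\<^sup>2)) / 4 + (\<Sum>j<k. (H j)\<^sup>2) / l + (A2 / 4 + r\<^sup>2)"
      using e_le unfolding A2_def by simp
    then show ?thesis using lower[of p] form by simp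
  qed
  show "?w \<le> 4 / l * (\<Sum>j<k. (H j)\<^sup>2) + 6 * r\<^sup>2"
    using w_le A2_le by simp
qed

end

section \<open>Second moments of empirical deviations\<close>

definition emp_dev :: "'w measure \<Rightarrow> nat \<Rightarrow> (nat \<Rightarrow> 'w) \<Rightarrow> ('w \<Rightarrow> real) \<Rightarrow> real" where
  "emp_dev \<mu> n w g = (\<Sum>i<n. g (w i)) / real n - (\<integral>x. g x \<partial>\<mu>)"

text \<open>The variance of a mean of independent copies: the cross terms vanish.\<close>

lemma (in prob_space) second_moment_emp_dev:
  fixes W :: "nat \<Rightarrow> 'a \<Rightarrow> 'w" and g :: "'w \<Rightarrow> real"
  assumes indep: "indep_vars (\<lambda>_. N) W UNIV" and ident: "\<And>i. distr M N (W i) = \<mu>"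
    and g[measurable]: "g \<in> borel_measurable N" and g2: "integrable \<mu> (\<lambda>w. (g w)\<^sup>2)" and n: "0 < n"
  shows "(\<integral>\<^sup>+\<omega>. ennreal ((emp_dev \<mu> n (\<lambda>i. W i \<omega>) g)\<^sup>2) \<partial>M) \<le> ennreal ((\<integral>w. (g w)\<^sup>2 \<partial>\<mu>) / real n)"
proof -
  have W[measurable]: "W i \<in> measurable M N" for i
    using indep by (auto simp: indep_vars_def)
  have int2: "integrable M (\<lambda>\<omega>. (g (W i \<omega>))\<^sup>2)" for i
    using g2 unfolding ident[of i, symmetric] by (subst (asm) integrable_distr_eq) auto
  have e2: "(\<integral>\<omega>. (g (W i \<omega>))\<^sup>2 \<partial>M) = (\<integral>w. (g w)\<^sup>2 \<partial>\<mu>)" for i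
    unfolding ident[of i, symmetric] by (subst integral_distr) auto
  have int1: "integrable M (\<lambda>\<omega>. g (W i \<omega>))" for i
    by (rule square_integrable_imp_integrable[OF _ int2]) auto
  define m where "m = (\<integral>w. g w \<partial>\<mu>)"
  have e1: "(\<integral>\<omega>. g (W i \<omega>) \<partial>M) = m" for i
    unfolding m_def ident[of i, symmetric] by (subst integral_distr) auto
  define Y where "Y i \<omega> = g (W i \<omega>) - m" for i \<omega>
  have Y1: "integrable M (Y i)" "(\<integral>\<omega>. Y i \<omega> \<partial>M) = 0" for i
    unfolding Y_def using int1 e1[of i] by (auto simp: prob_space)
  have Y2: "(\<integral>\<omega>. Y i \<omega> * Y i \<omega> \<partial>M) \<le> (\<integral>w. (g w)\<^sup>2 \<partial>\<mu>)" for i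
  proof -
    have "(\<integral>\<omega>. Y i \<omega> * Y i \<omega> \<partial>M) = variance (\<lambda>\<omega>. g (W i \<omega>))"
      by (simp add: Y_def e1 power2_eq_square)
    also have "\<dots> \<le> (\<integral>w. (g w)\<^sup>2 \<partial>\<mu>)"
      by (subst variance_eq[OF int1 int2]) (simp add: e2)
    finally show ?thesis .
  qed
  have Ysq: "integrable M (\<lambda>\<omega>. Y i \<omega> * Y i \<omega>)" for i
  proof -
    have "integrable M (\<lambda>\<omega>. (g (W i \<omega>))\<^sup>2 - 2 * m * g (W i \<omega>) + m\<^sup>2)"
      using int1 int2 by auto
    then show ?thesis by (simp add: Y_def power2_eq_square algebra_simps)
  qed
  have cross: "integrable M (\<lambda>\<omega>. Y i \<omega> * Y j \<omega>) \<and> (\<integral>\<omega>. Y i \<omega> * Y j \<omega> \<partial>M) = 0" if "i \<noteq> j" for i j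
  proof -
    have "indep_vars (\<lambda>_. borel) Y {i, j}"
    proof -
      have "indep_vars (\<lambda>_. borel) (\<lambda>i \<omega>. g (W i \<omega>) - m) {i, j}"
        by (rule indep_vars_compose2[where Y = "\<lambda>_ w. g w - m", OF indep_vars_subset[OF indep]]) auto
      then show ?thesis by (simp add: Y_def[abs_def])
    qed
    then show ?thesis
      using indep_vars_lebesgue_integral[of "{i, j}" Y] indep_vars_integrable[of "{i, j}" Y] that Y1 by simp
  qed
  have int_all: "integrable M (\<lambda>\<omega>. Y i \<omega> * Y j \<omega>)" for i j
    using cross[of i j] Ysq by (cases "i = j") auto
  have dev: "emp_dev \<mu> n (\<lambda>i. W i \<omega>) g = (\<Sum>i<n. Y i \<omega>) / real n" for \<omega>
    using n by (simp add: emp_dev_def Y_def sum_subtractf m_def[symmetric] diff_divide_distrib)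
  have sq: "(emp_dev \<mu> n (\<lambda>i. W i \<omega>) g)\<^sup>2 = (\<Sum>i<n. \<Sum>j<n. Y i \<omega> * Y j \<omega>) / (real n)\<^sup>2" for \<omega>
    by (simp add: dev power_divide sum_product power2_eq_square)
  have "(\<integral>\<^sup>+\<omega>. ennreal ((emp_dev \<mu> n (\<lambda>i. W i \<omega>) g)\<^sup>2) \<partial>M) = ennreal (\<integral>\<omega>. (emp_dev \<mu> n (\<lambda>i. W i \<omega>) g)\<^sup>2 \<partial>M)"
  proof (rule nn_integral_eq_integral)
    show "integrable M (\<lambda>\<omega>. (emp_dev \<mu> n (\<lambda>i. W i \<omega>) g)\<^sup>2)"
      unfolding sq by (intro Bochner_Integration.integrable_divide Bochner_Integration.integrable_sum int_all)
  qed simp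
  also have "(\<integral>\<omega>. (emp_dev \<mu> n (\<lambda>i. W i \<omega>) g)\<^sup>2 \<partial>M) = (\<Sum>i<n. \<Sum>j<n. \<integral>\<omega>. Y i \<omega> * Y j \<omega> \<partial>M) / (real n)\<^sup>2"
    unfolding sq by (simp add: Bochner_Integration.integral_sum int_all Bochner_Integration.integrable_sum)
  also have "\<dots> = (\<Sum>i<n. \<integral>\<omega>. Y i \<omega> * Y i \<omega> \<partial>M) / (real n)\<^sup>2"
  proof -
    have "(\<Sum>j<n. \<integral>\<omega>. Y i \<omega> * Y j \<omega> \<partial>M) = (\<Sum>j<n. if j = i then \<integral>\<omega>. Y i \<omega> * Y i \<omega> \<partial>M else 0)" for i
      using cross by (intro sum.cong) auto
    then show ?thesis by simp
  qed
  also have "\<dots> \<le> (\<Sum>i<n. \<integral>w. (g w)\<^sup>2 \<partial>\<mu>) / (real n)\<^sup>2"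
    by (intro divide_right_mono sum_mono Y2) auto
  also have "\<dots> = (\<integral>w. (g w)\<^sup>2 \<partial>\<mu>) / real n"
    using n by (simp add: power2_eq_square)
  finally show ?thesis by (simp add: ennreal_leI)
qed

text \<open>The deviation of \<open>g u\<close> is the sum of the \<open>c i\<close> times the deviations of \<open>g\<close> restricted to \<open>A i\<close>. Splitting
\<open>B i\<close> as \<open>sqrt (B i / s i) * sqrt (B i * s i)\<close> and applying the Cauchy--Schwarz inequality gives a bound that is free of
the coefficients, hence uniform over all \<open>u\<close> with the same \<open>A\<close> and \<open>B\<close>.\<close>

lemma emp_dev_series_bound:
  fixes B s c :: "nat \<Rightarrow> real" and A :: "nat \<Rightarrow> 'w set" and g u :: "'w \<Rightarrow> real"
  assumes "finite_measure \<mu>" and A: "\<And>i. A i \<in> sets \<mu>" and B: "\<And>i. 0 \<le> B i" and s: "\<And>i. 0 < s i"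
    and Bs: "summable (\<lambda>i. B i / s i)"
    and C: "\<And>w. summable (\<lambda>i. B i * s i * indicator (A i) w)" "\<And>w. (\<Sum>i. B i * s i * indicator (A i) w) \<le> C"
    and g: "integrable \<mu> g" and u: "u \<in> borel_measurable \<mu>"
    and c: "\<And>i. \<bar>c i\<bar> \<le> B i" and exp: "\<And>w. w \<in> G \<Longrightarrow> (\<lambda>i. c i * indicator (A i) w) sums u w"
    and G: "AE w in \<mu>. w \<in> G" and w: "\<And>i. i < n \<Longrightarrow> w i \<in> G"
  shows "ennreal ((emp_dev \<mu> n w (\<lambda>x. g x * u x))\<^sup>2)
    \<le> ennreal (\<Sum>i. B i / s i) * (\<Sum>i. ennreal (B i * s i * (emp_dev \<mu> n w (\<lambda>x. g x * indicator (A i) x))\<^sup>2))"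
proof -
  have g_meas[measurable]: "g \<in> borel_measurable \<mu>" using g by auto
  note [measurable] = A u
  define C' where "C' = (\<Sum>i. B i / s i) + C"
  define \<nu> where "\<nu> i = emp_dev \<mu> n w (\<lambda>x. g x * indicator (A i) x)" for i
  have intA: "integrable \<mu> (\<lambda>x. g x * indicator (A i) x)" for i
    by (rule Bochner_Integration.integrable_bound[OF g]) (auto simp: indicator_def)
  \<comment> \<open>As \<open>1 \<le> 1/s + s\<close>, the two summability assumptions already dominate the partial sums.\<close>
  have le: "B i * indicator (A i) x \<le> B i / s i + B i * s i * indicator (A i) x" for i x
  proof -
    have "2 * 1 \<le> 1 / s i + s i"
    proof -
      have "0 \<le> (s i - 1)\<^sup>2 / s i" using s[of i] by simp
      also have "\<dots> = 1 / s i + s i - 2" using s[of i] by (simp add: power2_eq_square field_simps)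
      finally show ?thesis by simp
    qed
    then have "B i * 1 \<le> B i * (1 / s i + s i)" using B[of i] s[of i] by (intro mult_left_mono) auto
    then show ?thesis using B[of i] s[of i] by (auto simp: indicator_def algebra_simps)
  qed
  have bnd: "\<bar>\<Sum>i<k. c i * indicator (A i) x\<bar> \<le> C'" for k :: nat and x
  proof -
    have "\<bar>\<Sum>i<k. c i * indicator (A i) x\<bar> \<le> (\<Sum>i<k. \<bar>c i\<bar> * indicator (A i) x)"
      by (rule order_trans[OF sum_abs]) (simp add: abs_mult)
    also have "\<dots> \<le> (\<Sum>i<k. B i / s i + B i * s i * indicator (A i) x)"
      using c by (intro sum_mono order_trans[OF mult_right_mono le]) auto
    also have "\<dots> = (\<Sum>i<k. B i / s i) + (\<Sum>i<k. B i * s i * indicator (A i) x)"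
      by (rule sum.distrib)
    also have "\<dots> \<le> (\<Sum>i. B i / s i) + (\<Sum>i. B i * s i * indicator (A i) x)"
      using B s less_imp_le[OF s] by (intro add_mono sum_le_suminf Bs C) auto
    also have "\<dots> \<le> C'" using C unfolding C'_def by (intro add_left_mono)
    finally show ?thesis .
  qed
  have conv_int: "(\<lambda>k. \<integral>x. g x * (\<Sum>i<k. c i * indicator (A i) x) \<partial>\<mu>) \<longlonglongrightarrow> (\<integral>x. g x * u x \<partial>\<mu>)"
  proof (rule integral_dominated_convergence[where w = "\<lambda>x. \<bar>g x\<bar> * C'"])
    show "integrable \<mu> (\<lambda>x. \<bar>g x\<bar> * C')" using g by auto
    show "AE x in \<mu>. (\<lambda>k. g x * (\<Sum>i<k. c i * indicator (A i) x)) \<longlonglongrightarrow> g x * u x"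
      using G by eventually_elim (use exp in \<open>auto intro!: tendsto_mult simp: sums_def\<close>)
    show "AE x in \<mu>. norm (g x * (\<Sum>i<k. c i * indicator (A i) x)) \<le> \<bar>g x\<bar> * C'" for k
      using bnd[where k = k] by (auto simp: abs_mult intro!: mult_left_mono)
    show "(\<lambda>x. g x * (\<Sum>i<k. c i * indicator (A i) x)) \<in> borel_measurable \<mu>" for k
      by measurable
  qed measurable
  have conv_sum: "(\<lambda>k. \<Sum>j<n. g (w j) * (\<Sum>i<k. c i * indicator (A i) (w j))) \<longlonglongrightarrow> (\<Sum>j<n. g (w j) * u (w j))"
    by (intro tendsto_sum tendsto_mult tendsto_const) (use exp w in \<open>auto simp: sums_def\<close>)
  have "(\<lambda>k. emp_dev \<mu> n w (\<lambda>x. g x * (\<Sum>i<k. c i * indicator (A i) x))) \<longlonglongrightarrow> emp_dev \<mu> n w (\<lambda>x. g x * u x)"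
    unfolding emp_dev_def divide_inverse by (intro tendsto_diff conv_int tendsto_mult tendsto_const conv_sum)
  moreover have "emp_dev \<mu> n w (\<lambda>x. g x * (\<Sum>i<k. c i * indicator (A i) x)) = (\<Sum>i<k. c i * \<nu> i)" for k
  proof -
    have 1: "(\<lambda>x. g x * (\<Sum>i<k. c i * indicator (A i) x)) = (\<lambda>x. \<Sum>i<k. c i * (g x * indicator (A i) x))"
      by (simp only: sum_distrib_left mult.left_commute)
    have 2: "(\<integral>x. (\<Sum>i<k. c i * (g x * indicator (A i) x)) \<partial>\<mu>) = (\<Sum>i<k. c i * (\<integral>x. g x * indicator (A i) x \<partial>\<mu>))"
      using intA by (subst Bochner_Integration.integral_sum) auto
    have 3: "(\<Sum>j<n. \<Sum>i<k. c i * (g (w j) * indicator (A i) (w j))) = (\<Sum>i<k. c i * (\<Sum>j<n. g (w j) * indicator (A i) (w j)))"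
      by (subst sum.swap) (simp only: sum_distrib_left)
    have "(\<Sum>i<k. c i * a i) / real n - (\<Sum>i<k. c i * b i) = (\<Sum>i<k. c i * (a i / real n - b i))"
      for a b :: "nat \<Rightarrow> real"
      by (simp add: sum_divide_distrib sum_subtractf right_diff_distrib)
    then show ?thesis unfolding 1 emp_dev_def \<nu>_def 2 3 .
  qed
  ultimately have "(\<lambda>k. (\<Sum>i<k. c i * \<nu> i)\<^sup>2) \<longlonglongrightarrow> (emp_dev \<mu> n w (\<lambda>x. g x * u x))\<^sup>2"
    by (intro tendsto_power) simp
  then have "(\<lambda>k. ennreal ((\<Sum>i<k. c i * \<nu> i)\<^sup>2)) \<longlonglongrightarrow> ennreal ((emp_dev \<mu> n w (\<lambda>x. g x * u x))\<^sup>2)"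
    by (rule tendsto_ennrealI)
  then show ?thesis
  proof (rule LIMSEQ_le_const2, intro exI allI impI)
    fix k :: nat
    have "(\<Sum>i<k. c i * \<nu> i)\<^sup>2 \<le> (\<Sum>i<k. B i * \<bar>\<nu> i\<bar>)\<^sup>2"
    proof (rule power2_le_iff_abs_le[THEN iffD2])
      show "0 \<le> (\<Sum>i<k. B i * \<bar>\<nu> i\<bar>)" using B by (intro sum_nonneg) auto
      show "\<bar>\<Sum>i<k. c i * \<nu> i\<bar> \<le> (\<Sum>i<k. B i * \<bar>\<nu> i\<bar>)"
        by (rule order_trans[OF sum_abs]) (use c in \<open>auto simp: abs_mult intro!: sum_mono mult_right_mono\<close>)
    qed
    also have "(\<Sum>i<k. B i * \<bar>\<nu> i\<bar>) = (\<Sum>i<k. sqrt (B i / s i) * (sqrt (B i * s i) * \<bar>\<nu> i\<bar>))"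
    proof (rule sum.cong[OF refl])
      fix i
      have "sqrt (B i / s i) * sqrt (B i * s i) = sqrt (B i * B i)"
        using s[of i] by (simp add: real_sqrt_mult[symmetric])
      then show "B i * \<bar>\<nu> i\<bar> = sqrt (B i / s i) * (sqrt (B i * s i) * \<bar>\<nu> i\<bar>)"
        using B[of i] by (simp add: mult.assoc[symmetric])
    qed
    also have "\<dots>\<^sup>2 \<le> (\<Sum>i<k. (sqrt (B i / s i))\<^sup>2) * (\<Sum>i<k. (sqrt (B i * s i) * \<bar>\<nu> i\<bar>)\<^sup>2)"
      by (rule Cauchy_Schwarz_ineq_sum)
    also have "\<dots> = (\<Sum>i<k. B i / s i) * (\<Sum>i<k. B i * s i * (\<nu> i)\<^sup>2)"
      using B less_imp_le[OF s] by (simp add: power_mult_distrib)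
    also have "\<dots> \<le> (\<Sum>i. B i / s i) * (\<Sum>i<k. B i * s i * (\<nu> i)\<^sup>2)"
      using B less_imp_le[OF s] by (intro mult_right_mono sum_le_suminf Bs sum_nonneg) auto
    finally have "ennreal ((\<Sum>i<k. c i * \<nu> i)\<^sup>2) \<le> ennreal ((\<Sum>i. B i / s i) * (\<Sum>i<k. B i * s i * (\<nu> i)\<^sup>2))"
      by (rule ennreal_leI)
    also have "\<dots> = ennreal (\<Sum>i. B i / s i) * (\<Sum>i<k. ennreal (B i * s i * (\<nu> i)\<^sup>2))"
      using B less_imp_le[OF s] by (subst ennreal_mult) (auto intro!: suminf_nonneg Bs sum_nonneg)
    also have "\<dots> \<le> ennreal (\<Sum>i. B i / s i) * (\<Sum>i. ennreal (B i * s i * (\<nu> i)\<^sup>2))"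
      by (intro mult_left_mono sum_le_suminf) auto
    finally show "ennreal ((\<Sum>i<k. c i * \<nu> i)\<^sup>2)
      \<le> ennreal (\<Sum>i. B i / s i) * (\<Sum>i. ennreal (B i * s i * (emp_dev \<mu> n w (\<lambda>x. g x * indicator (A i) x))\<^sup>2))"
      by (simp add: \<nu>_def)
  qed
qed

text \<open>Each summand is a variance bounded by the integral of \<open>g\<^sup>2\<close> over \<open>A i\<close>, and the weights \<open>B s\<close> sum to at most \<open>C\<close> at
every point.\<close>

lemma (in prob_space) expected_series_bound:
  fixes W :: "nat \<Rightarrow> 'a \<Rightarrow> 'w" and g :: "'w \<Rightarrow> real" and A :: "nat \<Rightarrow> 'w set"
  assumes indep: "indep_vars (\<lambda>_. N) W UNIV" and ident: "\<And>i. distr M N (W i) = \<mu>"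
    and g[measurable]: "g \<in> borel_measurable N" and g2: "integrable \<mu> (\<lambda>w. (g w)\<^sup>2)" and n: "0 < n"
    and A[measurable]: "\<And>i. A i \<in> sets N" and B: "\<And>i. 0 \<le> B i" and s: "\<And>i. 0 < s i"
    and C: "\<And>w. summable (\<lambda>i. B i * s i * indicator (A i) w)" "\<And>w. (\<Sum>i. B i * s i * indicator (A i) w) \<le> C"
  shows "(\<integral>\<^sup>+\<omega>. (\<Sum>i. ennreal (B i * s i * (emp_dev \<mu> n (\<lambda>j. W j \<omega>) (\<lambda>x. g x * indicator (A i) x))\<^sup>2)) \<partial>M)
    \<le> ennreal (C * (\<integral>w. (g w)\<^sup>2 \<partial>\<mu>) / real n)"
proof -
  have W[measurable]: "W i \<in> measurable M N" for i
    using indep by (auto simp: indep_vars_def)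
  have sets_\<mu>[measurable_cong]: "sets \<mu> = sets N" using ident[of 0] by (metis sets_distr)
  define Bs where "Bs i = B i * s i" for i
  have Bs: "0 \<le> Bs i" for i using B[of i] s[of i] by (simp add: Bs_def)
  have C0: "0 \<le> C"
  proof -
    have "0 \<le> (\<Sum>i. B i * s i * indicator (A i) undefined)"
      by (rule suminf_nonneg[OF C(1)]) (use Bs in \<open>simp add: Bs_def\<close>)
    then show ?thesis using C(2)[of undefined] by linarith
  qed
  have dev_meas[measurable]: "(\<lambda>\<omega>. emp_dev \<mu> n (\<lambda>j. W j \<omega>) f) \<in> borel_measurable M"
    if [measurable]: "f \<in> borel_measurable N" for f
    unfolding emp_dev_def by measurable
  have "(\<integral>\<^sup>+\<omega>. (\<Sum>i. ennreal (Bs i * (emp_dev \<mu> n (\<lambda>j. W j \<omega>) (\<lambda>x. g x * indicator (A i) x))\<^sup>2)) \<partial>M)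
    = (\<Sum>i. \<integral>\<^sup>+\<omega>. ennreal (Bs i * (emp_dev \<mu> n (\<lambda>j. W j \<omega>) (\<lambda>x. g x * indicator (A i) x))\<^sup>2) \<partial>M)"
    by (intro nn_integral_suminf) measurable
  also have "\<dots> = (\<Sum>i. ennreal (Bs i) * \<integral>\<^sup>+\<omega>. ennreal ((emp_dev \<mu> n (\<lambda>j. W j \<omega>) (\<lambda>x. g x * indicator (A i) x))\<^sup>2) \<partial>M)"
    using Bs by (intro suminf_cong) (simp add: ennreal_mult nn_integral_cmult)
  also have "\<dots> \<le> (\<Sum>i. ennreal (Bs i) * (\<integral>\<^sup>+w. ennreal ((g w)\<^sup>2 / real n) * indicator (A i) w \<partial>\<mu>))"
  proof (intro suminf_le mult_left_mono)
    fix i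
    have i: "integrable \<mu> (\<lambda>w. (g w * indicator (A i) w)\<^sup>2)"
      by (rule Bochner_Integration.integrable_bound[OF g2]) (auto simp: indicator_def)
    have "(\<integral>\<^sup>+\<omega>. ennreal ((emp_dev \<mu> n (\<lambda>j. W j \<omega>) (\<lambda>x. g x * indicator (A i) x))\<^sup>2) \<partial>M)
      \<le> ennreal ((\<integral>w. (g w * indicator (A i) w)\<^sup>2 \<partial>\<mu>) / real n)"
      by (rule second_moment_emp_dev[OF indep ident _ i n]) measurable
    also have "\<dots> = ennreal (\<integral>w. (g w * indicator (A i) w)\<^sup>2 / real n \<partial>\<mu>)" by simp
    also have "\<dots> = (\<integral>\<^sup>+w. ennreal ((g w * indicator (A i) w)\<^sup>2 / real n) \<partial>\<mu>)"
      using i by (intro nn_integral_eq_integral[symmetric]) auto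
    also have "\<dots> = (\<integral>\<^sup>+w. ennreal ((g w)\<^sup>2 / real n) * indicator (A i) w \<partial>\<mu>)"
      by (intro nn_integral_cong) (auto simp: indicator_def)
    finally show "(\<integral>\<^sup>+\<omega>. ennreal ((emp_dev \<mu> n (\<lambda>j. W j \<omega>) (\<lambda>x. g x * indicator (A i) x))\<^sup>2) \<partial>M)
      \<le> (\<integral>\<^sup>+w. ennreal ((g w)\<^sup>2 / real n) * indicator (A i) w \<partial>\<mu>)" .
  qed auto
  also have "\<dots> = (\<Sum>i. \<integral>\<^sup>+w. ennreal ((g w)\<^sup>2 / real n) * ennreal (Bs i * indicator (A i) w) \<partial>\<mu>)"
    by (intro suminf_cong, subst nn_integral_cmult[symmetric])
      (use Bs in \<open>auto intro!: nn_integral_cong simp: ennreal_mult indicator_def mult.commute\<close>)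
  also have "\<dots> = (\<integral>\<^sup>+w. (\<Sum>i. ennreal ((g w)\<^sup>2 / real n) * ennreal (Bs i * indicator (A i) w)) \<partial>\<mu>)"
    by (intro nn_integral_suminf[symmetric]) measurable
  also have "\<dots> \<le> (\<integral>\<^sup>+w. ennreal (C * (g w)\<^sup>2 / real n) \<partial>\<mu>)"
  proof (rule nn_integral_mono)
    fix w
    have "(\<Sum>i. ennreal ((g w)\<^sup>2 / real n) * ennreal (Bs i * indicator (A i) w))
      = ennreal ((g w)\<^sup>2 / real n) * ennreal (\<Sum>i. Bs i * indicator (A i) w)"
      using Bs C(1)[of w] by (simp add: ennreal_suminf_cmult suminf_ennreal2 Bs_def)
    also have "\<dots> \<le> ennreal ((g w)\<^sup>2 / real n) * ennreal C"
      using C(2)[of w] by (intro mult_left_mono ennreal_leI) (auto simp: Bs_def)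
    also have "\<dots> = ennreal (C * (g w)\<^sup>2 / real n)"
      using C0 by (simp add: ennreal_mult[symmetric] mult.commute)
    finally show "(\<Sum>i. ennreal ((g w)\<^sup>2 / real n) * ennreal (Bs i * indicator (A i) w)) \<le> ennreal (C * (g w)\<^sup>2 / real n)" .
  qed
  also have "\<dots> = ennreal (\<integral>w. C * (g w)\<^sup>2 / real n \<partial>\<mu>)"
    using g2 C0 by (intro nn_integral_eq_integral) auto
  also have "(\<integral>w. C * (g w)\<^sup>2 / real n \<partial>\<mu>) = C * (\<integral>w. (g w)\<^sup>2 \<partial>\<mu>) / real n"
    by simp
  finally show ?thesis by (simp add: Bs_def)
qed

section \<open>Deviations of the sample moments and the sample Gram matrix\<close>

lemma Markov_ennreal:
  assumes [measurable]: "f \<in> borel_measurable M" and "(\<integral>\<^sup>+\<omega>. f \<omega> \<partial>M) \<le> ennreal e" and "0 < t" "0 \<le> e"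
  shows "emeasure M {\<omega> \<in> space M. ennreal t < f \<omega>} \<le> ennreal (e / t)"
proof -
  have "emeasure M {\<omega> \<in> space M. ennreal t < f \<omega>} \<le> emeasure M {\<omega> \<in> space M. 1 \<le> ennreal (1 / t) * f \<omega>}"
  proof (rule emeasure_mono)
    show "{\<omega> \<in> space M. ennreal t < f \<omega>} \<subseteq> {\<omega> \<in> space M. 1 \<le> ennreal (1 / t) * f \<omega>}"
    proof safe
      fix \<omega> assume "ennreal t < f \<omega>"
      then have "ennreal (1 / t) * ennreal t \<le> ennreal (1 / t) * f \<omega>" by (intro mult_left_mono) auto
      then show "1 \<le> ennreal (1 / t) * f \<omega>" using assms(3) by (simp add: ennreal_mult[symmetric])
    qed
  qed measurable
  also have "\<dots> \<le> ennreal (1 / t) * (\<integral>\<^sup>+\<omega>. f \<omega> * indicator (space M) \<omega> \<partial>M)"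
    by (rule nn_integral_Markov_inequality) measurable
  also have "(\<integral>\<^sup>+\<omega>. f \<omega> * indicator (space M) \<omega> \<partial>M) = (\<integral>\<^sup>+\<omega>. f \<omega> \<partial>M)"
    by (intro nn_integral_cong) auto
  also have "ennreal (1 / t) * \<dots> \<le> ennreal (1 / t) * ennreal e" using assms by (intro mult_left_mono) auto
  also have "\<dots> = ennreal (e / t)" using assms by (simp add: ennreal_mult[symmetric])
  finally show ?thesis .
qed

text \<open>The factor \<open>r\<close> is part of the function because \<open>y\<close> enters the sample moments only where it is observed.\<close>

definition tuple_XY :: "('x \<times> real \<Rightarrow> real) \<Rightarrow> real \<times> 'x \<times> real \<times> real \<Rightarrow> real" where
  "tuple_XY f t = fst t * f (fst (snd t), fst (snd (snd t)))"

definition tuple_XZ :: "real \<times> 'x \<times> real \<times> real \<Rightarrow> 'x \<times> real" where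
  "tuple_XZ t = (fst (snd t), snd (snd (snd t)))"

lemma tuple_XY_simp [simp]: "tuple_XY f (r, x, y, z) = r * f (x, y)"
  by (simp add: tuple_XY_def)

lemma tuple_XZ_simp [simp]: "tuple_XZ (r, x, y, z) = (x, z)"
  by (simp add: tuple_XZ_def)

lemma tuple_XY_measurable:
  fixes f :: "'x::euclidean_space \<times> real \<Rightarrow> real"
  assumes "f \<in> borel_measurable borel"
  shows "tuple_XY f \<in> borel_measurable borel"
  unfolding tuple_XY_def
  by (intro borel_measurable_times measurable_compose[OF _ assms] borel_measurable_continuous_onI continuous_intros)

lemma tuple_XZ_measurable: "(tuple_XZ :: _ \<Rightarrow> 'x::euclidean_space \<times> real) \<in> borel_measurable borel"
  unfolding tuple_XZ_def by (intro borel_measurable_continuous_onI continuous_intros)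

text \<open>The sampling model together with the consequences of the conditions that the probabilistic argument uses: \<open>l\<close> and \<open>u\<close>
bound the quadratic forms of all matrices \<open>E[R \<phi> \<phi>\<^sup>T]\<close>, and \<open>A\<close>, \<open>B\<close>, \<open>s\<close>, \<open>C\<close> come from \<open>smooth_class_expansion\<close>.\<close>

locale sieve_regression = missing_outcome M R Y Z X
  for M :: "'s measure" and R Y Z :: "'s \<Rightarrow> real" and X :: "'s \<Rightarrow> 'x::euclidean_space" +
  fixes Rs Ys Zs :: "nat \<Rightarrow> 's \<Rightarrow> real" and Xs :: "nat \<Rightarrow> 's \<Rightarrow> 'x"
    and \<phi> :: "nat \<Rightarrow> 'x \<times> real \<Rightarrow> real" and k :: "nat \<Rightarrow> nat" and \<tau> :: "'x \<times> real \<Rightarrow> real"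
    and \<Delta> :: "('x \<times> real \<Rightarrow> real) set" and S :: "('x \<times> real) set" and K l u :: real
    and A :: "nat \<Rightarrow> ('x \<times> real) set" and B s :: "nat \<Rightarrow> real" and C :: real
  assumes indep: "indep_vars (\<lambda>_. borel) (\<lambda>i \<omega>. (Rs i \<omega>, Xs i \<omega>, Ys i \<omega>, Zs i \<omega>)) UNIV"
    and ident: "\<And>i. distr M borel (\<lambda>\<omega>. (Rs i \<omega>, Xs i \<omega>, Ys i \<omega>, Zs i \<omega>)) =
      distr M borel (\<lambda>\<omega>. (R \<omega>, X \<omega>, Y \<omega>, Z \<omega>))"
    and phi_meas[measurable]: "\<And>j. \<phi> j \<in> borel_measurable borel"
    and tau_meas[measurable]: "\<tau> \<in> borel_measurable borel"
    and S_borel[measurable]: "S \<in> sets borel" and S_AE: "AE \<omega> in M. (X \<omega>, Z \<omega>) \<in> S"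
    and Delta_meas: "\<And>\<delta>. \<delta> \<in> \<Delta> \<Longrightarrow> \<delta> \<in> borel_measurable borel"
    and Delta_bdd: "\<And>\<delta> w. \<delta> \<in> \<Delta> \<Longrightarrow> w \<in> S \<Longrightarrow> \<bar>\<delta> w\<bar> \<le> K"
    and tau_bdd: "AE \<omega> in M. \<bar>R \<omega> * \<tau> (X \<omega>, Y \<omega>)\<bar> \<le> K"
    and l_pos: "0 < l" and u_pos: "0 < u"
    and form_lower: "\<And>n v. l * (\<Sum>i<k n. (v i)\<^sup>2)
      \<le> bilin (k n) (\<lambda>i j. \<integral>\<omega>. R \<omega> * (\<phi> i (X \<omega>, Y \<omega>) * \<phi> j (X \<omega>, Y \<omega>)) \<partial>M) v v"
    and form_upper: "\<And>n v. bilin (k n) (\<lambda>i j. \<integral>\<omega>. R \<omega> * (\<phi> i (X \<omega>, Y \<omega>) * \<phi> j (X \<omega>, Y \<omega>)) \<partial>M) v v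
      \<le> u * (\<Sum>i<k n. (v i)\<^sup>2)"
    and phi_sq: "\<And>n j. j < k n \<Longrightarrow> integrable M (\<lambda>\<omega>. R \<omega> * (\<phi> j (X \<omega>, Y \<omega>))\<^sup>2)"
    and A_borel[measurable]: "\<And>i. A i \<in> sets borel" and B_nonneg: "\<And>i. 0 \<le> B i" and s_pos: "\<And>i. 0 < s i"
    and Bs_div: "summable (\<lambda>i. B i / s i)"
    and Bs_sum: "\<And>w. summable (\<lambda>i. B i * s i * indicator (A i) w)"
    and Bs_le: "\<And>w. (\<Sum>i. B i * s i * indicator (A i) w) \<le> C"
    and expansion: "\<And>\<delta>. \<delta> \<in> \<Delta> \<Longrightarrow>
      \<exists>c. (\<forall>i. \<bar>c i\<bar> \<le> B i) \<and> (\<forall>w\<in>S. (\<lambda>i. c i * indicator (A i) w) sums \<delta> w)"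
begin

definition obs :: "nat \<Rightarrow> 's \<Rightarrow> real \<times> 'x \<times> real \<times> real" where
  "obs i \<omega> = (Rs i \<omega>, Xs i \<omega>, Ys i \<omega>, Zs i \<omega>)"

definition law :: "(real \<times> 'x \<times> real \<times> real) measure" where
  "law = distr M borel (\<lambda>\<omega>. (R \<omega>, X \<omega>, Y \<omega>, Z \<omega>))"

text \<open>The squared weak distance of \<open>\<delta>\<close> from any solution; it vanishes exactly on \<open>\<Delta>\<^sub>0\<close>.\<close>

definition wsq :: "('x \<times> real \<Rightarrow> real) \<Rightarrow> real" where
  "wsq \<delta> = (\<integral>\<omega>. R \<omega> * (\<tau> (X \<omega>, Y \<omega>) - cond_mean M R X Y (\<lambda>\<omega>. \<delta> (X \<omega>, Z \<omega>)) \<omega>)\<^sup>2 \<partial>M)"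

definition moment :: "('x \<times> real \<Rightarrow> real) \<Rightarrow> nat \<Rightarrow> real" where
  "moment \<delta> j = (\<integral>\<omega>. R \<omega> * (\<phi> j (X \<omega>, Y \<omega>) * (\<tau> (X \<omega>, Y \<omega>) - \<delta> (X \<omega>, Z \<omega>))) \<partial>M)"

definition sample_moment :: "nat \<Rightarrow> 's \<Rightarrow> ('x \<times> real \<Rightarrow> real) \<Rightarrow> nat \<Rightarrow> real" where
  "sample_moment n \<omega> \<delta> j = (\<Sum>a<n. Rs a \<omega> * \<phi> j (Xs a \<omega>, Ys a \<omega>) *
      (\<tau> (Xs a \<omega>, Ys a \<omega>) - \<delta> (Xs a \<omega>, Zs a \<omega>))) / real n"

definition sample_gram :: "nat \<Rightarrow> 's \<Rightarrow> nat \<Rightarrow> nat \<Rightarrow> real" where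
  "sample_gram n \<omega> i j = (\<Sum>a<n. Rs a \<omega> * \<phi> i (Xs a \<omega>, Ys a \<omega>) * \<phi> j (Xs a \<omega>, Ys a \<omega>)) / real n"

definition gram :: "nat \<Rightarrow> nat \<Rightarrow> real" where
  "gram i j = (\<integral>\<omega>. R \<omega> * (\<phi> i (X \<omega>, Y \<omega>) * \<phi> j (X \<omega>, Y \<omega>)) \<partial>M)"

definition dev :: "nat \<Rightarrow> 's \<Rightarrow> (real \<times> 'x \<times> real \<times> real \<Rightarrow> real) \<Rightarrow> real" where
  "dev n \<omega> f = emp_dev law n (\<lambda>i. obs i \<omega>) f"

lemma obs_indep: "indep_vars (\<lambda>_. borel) obs UNIV"
  using indep by (simp add: obs_def[abs_def])

lemma obs_ident: "distr M borel (obs i) = law"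
  using ident[of i] by (simp add: obs_def[abs_def] law_def)

lemma obs_meas[measurable]: "obs i \<in> borel_measurable M"
  using obs_indep by (auto simp: indep_vars_def)

lemma tuple_meas[measurable]: "(\<lambda>\<omega>. (R \<omega>, X \<omega>, Y \<omega>, Z \<omega>)) \<in> borel_measurable M"
  by (intro borel_measurable_Pair) auto

lemma sets_law[simp, measurable_cong]: "sets law = sets borel"
  by (simp add: law_def)

lemma integral_law:
  "f \<in> borel_measurable borel \<Longrightarrow> (\<integral>t. f t \<partial>law) = (\<integral>\<omega>. (f (R \<omega>, X \<omega>, Y \<omega>, Z \<omega>) :: real) \<partial>M)"
  unfolding law_def by (subst integral_distr) auto

lemma integrable_law:
  "f \<in> borel_measurable borel \<Longrightarrow> integrable law f \<longleftrightarrow> integrable M (\<lambda>\<omega>. f (R \<omega>, X \<omega>, Y \<omega>, Z \<omega>) :: real)"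
  unfolding law_def by (subst integrable_distr_eq) auto

lemma dev_measurable[measurable (raw)]:
  assumes [measurable]: "f \<in> borel_measurable borel"
  shows "(\<lambda>\<omega>. dev n \<omega> f) \<in> borel_measurable M"
  unfolding dev_def emp_dev_def by measurable

lemma K_nonneg: "0 \<le> K"
proof -
  have "AE \<omega> in M. 0 \<le> K" using tau_bdd by eventually_elim (rule order_trans[OF abs_ge_zero])
  then show ?thesis by (simp add: prob_space)
qed

lemma C_nonneg: "0 \<le> C"
proof -
  have "0 \<le> (\<Sum>i. B i * s i * indicator (A i) undefined)"
    by (rule suminf_nonneg[OF Bs_sum]) (use B_nonneg less_imp_le[OF s_pos] in auto)
  then show ?thesis using Bs_le[of undefined] by linarith
qed

lemma phi_XY_meas[measurable]: "(\<lambda>\<omega>. \<phi> j (X \<omega>, Y \<omega>)) \<in> borel_measurable M"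
  by (rule measurable_compose[OF _ phi_meas]) (intro borel_measurable_Pair X_meas Y_meas)

lemma tau_XY_meas[measurable]: "(\<lambda>\<omega>. \<tau> (X \<omega>, Y \<omega>)) \<in> borel_measurable M"
  by (rule measurable_compose[OF _ tau_meas]) (intro borel_measurable_Pair X_meas Y_meas)

lemma delta_XZ_meas: "\<delta> \<in> \<Delta> \<Longrightarrow> (\<lambda>\<omega>. \<delta> (X \<omega>, Z \<omega>)) \<in> borel_measurable M"
  by (rule measurable_compose[OF _ Delta_meas]) (intro borel_measurable_Pair X_meas Z_meas)

lemma delta_XZ_bdd: "\<delta> \<in> \<Delta> \<Longrightarrow> AE \<omega> in M. \<bar>\<delta> (X \<omega>, Z \<omega>)\<bar> \<le> K"
  using S_AE by eventually_elim (rule Delta_bdd)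

lemma R_phi_integrable: "j < k n \<Longrightarrow> integrable M (\<lambda>\<omega>. R \<omega> * \<phi> j (X \<omega>, Y \<omega>))"
proof (rule square_integrable_imp_integrable)
  assume "j < k n"
  have "integrable M (\<lambda>\<omega>. (R \<omega> * \<phi> j (X \<omega>, Y \<omega>))\<^sup>2) \<longleftrightarrow> integrable M (\<lambda>\<omega>. R \<omega> * (\<phi> j (X \<omega>, Y \<omega>))\<^sup>2)"
  proof (rule Bochner_Integration.integrable_cong[OF refl])
    fix \<omega> assume "\<omega> \<in> space M"
    then show "(R \<omega> * \<phi> j (X \<omega>, Y \<omega>))\<^sup>2 = R \<omega> * (\<phi> j (X \<omega>, Y \<omega>))\<^sup>2"
      using R01[OF \<open>\<omega> \<in> space M\<close>] by (auto simp: power_mult_distrib)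
  qed
  then show "integrable M (\<lambda>\<omega>. (R \<omega> * \<phi> j (X \<omega>, Y \<omega>))\<^sup>2)" using phi_sq[OF \<open>j < k n\<close>] by simp
qed measurable

lemma R_phi_sq_le: "j < k n \<Longrightarrow> (\<integral>\<omega>. R \<omega> * (\<phi> j (X \<omega>, Y \<omega>))\<^sup>2 \<partial>M) \<le> u"
proof -
  assume j: "j < k n"
  define e where "e i = (if i = j then 1 else 0 :: real)" for i
  have "bilin (k n) gram e e = (\<Sum>i<k n. e i * (\<Sum>j'<k n. gram i j' * e j'))" by (rule bilin_right)
  also have gram_jj: "\<dots> = gram j j" using j by (simp add: e_def if_distrib[of "\<lambda>x. _ * x"] if_distrib[of "\<lambda>x. x * _"] cong: if_cong)
  finally have 1: "bilin (k n) gram e e = gram j j" .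
  have "(\<Sum>i<k n. (e i)\<^sup>2) = (\<Sum>i<k n. if i = j then 1 else 0)" by (intro sum.cong) (auto simp: e_def)
  then have 2: "(\<Sum>i<k n. (e i)\<^sup>2) = 1" using j by simp
  show ?thesis
    using form_upper[where n = n and v = e] unfolding 2 gram_def[abs_def, symmetric] 1 by (simp add: gram_def power2_eq_square)
qed

lemma integrable_R_phi_bounded:
  assumes j: "j < k n" and b[measurable]: "b \<in> borel_measurable M" and bd: "AE \<omega> in M. \<bar>R \<omega> * b \<omega>\<bar> \<le> K"
  shows "integrable M (\<lambda>\<omega>. R \<omega> * (\<phi> j (X \<omega>, Y \<omega>) * b \<omega>))"
proof (rule Bochner_Integration.integrable_bound)
  show "integrable M (\<lambda>\<omega>. K * (R \<omega> * \<phi> j (X \<omega>, Y \<omega>)))" using R_phi_integrable[OF j] by auto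
  show "AE \<omega> in M. norm (R \<omega> * (\<phi> j (X \<omega>, Y \<omega>) * b \<omega>)) \<le> norm (K * (R \<omega> * \<phi> j (X \<omega>, Y \<omega>)))"
    using bd AE_space
  proof eventually_elim
    fix \<omega> assume le: "\<bar>R \<omega> * b \<omega>\<bar> \<le> K" and \<omega>: "\<omega> \<in> space M"
    have "R \<omega> * (\<phi> j (X \<omega>, Y \<omega>) * b \<omega>) = (R \<omega> * b \<omega>) * (R \<omega> * \<phi> j (X \<omega>, Y \<omega>))"
      using R01[OF \<omega>] by auto
    then show "norm (R \<omega> * (\<phi> j (X \<omega>, Y \<omega>) * b \<omega>)) \<le> norm (K * (R \<omega> * \<phi> j (X \<omega>, Y \<omega>)))"
      using mult_right_mono[OF le abs_ge_zero[of "R \<omega> * \<phi> j (X \<omega>, Y \<omega>)"]] K_nonneg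
      by (simp only: real_norm_def abs_mult[of K] abs_mult[of "R \<omega> * b \<omega>"] abs_of_nonneg)
  qed
qed measurable

lemma R_delta_bdd: "\<delta> \<in> \<Delta> \<Longrightarrow> AE \<omega> in M. \<bar>R \<omega> * \<delta> (X \<omega>, Z \<omega>)\<bar> \<le> K"
proof -
  assume "\<delta> \<in> \<Delta>"
  from delta_XZ_bdd[OF this] AE_space show ?thesis
  proof eventually_elim
    fix \<omega> assume "\<bar>\<delta> (X \<omega>, Z \<omega>)\<bar> \<le> K" "\<omega> \<in> space M"
    then show "\<bar>R \<omega> * \<delta> (X \<omega>, Z \<omega>)\<bar> \<le> K" using R01[of \<omega>] K_nonneg by auto
  qed
qed

text \<open>The part with \<open>\<tau>\<close> is a single function for each \<open>j\<close>; only the part with \<open>\<delta>\<close> needs control uniformly over \<open>\<Delta>\<close>.\<close>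

lemma sample_moment_deviation:
  assumes j: "j < k n" and \<delta>: "\<delta> \<in> \<Delta>"
  shows "sample_moment n \<omega> \<delta> j - moment \<delta> j =
    dev n \<omega> (\<lambda>t. tuple_XY (\<lambda>v. \<phi> j v * \<tau> v) t) - dev n \<omega> (\<lambda>t. tuple_XY (\<phi> j) t * \<delta> (tuple_XZ t))"
proof -
  note [measurable] = delta_XZ_meas[OF \<delta>]
  have m1: "(\<lambda>t. tuple_XY (\<lambda>v. \<phi> j v * \<tau> v) t) \<in> borel_measurable borel"
    by (intro tuple_XY_measurable borel_measurable_times phi_meas tau_meas)
  have m2: "(\<lambda>t. tuple_XY (\<phi> j) t * \<delta> (tuple_XZ t)) \<in> borel_measurable borel"
    by (intro borel_measurable_times tuple_XY_measurable phi_meas measurable_compose[OF tuple_XZ_measurable Delta_meas[OF \<delta>]])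
  have "moment \<delta> j = (\<integral>\<omega>. R \<omega> * (\<phi> j (X \<omega>, Y \<omega>) * \<tau> (X \<omega>, Y \<omega>)) - R \<omega> * (\<phi> j (X \<omega>, Y \<omega>) * \<delta> (X \<omega>, Z \<omega>)) \<partial>M)"
    by (simp add: moment_def right_diff_distrib)
  also have "\<dots> = (\<integral>\<omega>. R \<omega> * (\<phi> j (X \<omega>, Y \<omega>) * \<tau> (X \<omega>, Y \<omega>)) \<partial>M) - (\<integral>\<omega>. R \<omega> * (\<phi> j (X \<omega>, Y \<omega>) * \<delta> (X \<omega>, Z \<omega>)) \<partial>M)"
    using integrable_R_phi_bounded[OF j tau_XY_meas tau_bdd] integrable_R_phi_bounded[OF j delta_XZ_meas[OF \<delta>] R_delta_bdd[OF \<delta>]]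
    by (rule Bochner_Integration.integral_diff)
  finally show ?thesis
    by (simp add: dev_def emp_dev_def integral_law[OF m1] integral_law[OF m2] obs_def sample_moment_def
        right_diff_distrib sum_subtractf diff_divide_distrib mult.assoc)
qed

lemma sample_gram_deviation:
  "sample_gram n \<omega> i j - gram i j = dev n \<omega> (tuple_XY (\<lambda>v. \<phi> i v * \<phi> j v))"
proof -
  have m1: "tuple_XY (\<lambda>v. \<phi> i v * \<phi> j v) \<in> borel_measurable borel"
    by (intro tuple_XY_measurable borel_measurable_times phi_meas)
  show ?thesis
    by (simp add: dev_def emp_dev_def integral_law[OF m1] obs_def sample_gram_def gram_def mult.assoc)
qed

definition series_const :: real where "series_const = (\<Sum>i. B i / s i)"

text \<open>A measurable random variable that dominates the squared deviation of the moment vector for all \<open>\<delta>\<close> at once; the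
supremum over \<open>\<Delta>\<close> itself need not be measurable.\<close>

definition moment_dev_bound :: "nat \<Rightarrow> 's \<Rightarrow> ennreal" where
  "moment_dev_bound n \<omega> = (\<Sum>j<k n. 2 * ennreal ((dev n \<omega> (tuple_XY (\<lambda>v. \<phi> j v * \<tau> v)))\<^sup>2) +
     2 * (ennreal series_const * (\<Sum>i. ennreal (B i * s i *
       (dev n \<omega> (\<lambda>t. tuple_XY (\<phi> j) t * indicator (tuple_XZ -` A i) t))\<^sup>2))))"

definition moment_const :: real where
  "moment_const = 2 * K\<^sup>2 * u + 2 * series_const * C * u"

lemma series_const_nonneg: "0 \<le> series_const"
  unfolding series_const_def using B_nonneg less_imp_le[OF s_pos] by (intro suminf_nonneg Bs_div) auto

lemma moment_const_nonneg: "0 \<le> moment_const"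
  unfolding moment_const_def using series_const_nonneg C_nonneg u_pos by simp

lemma tuple_XZ_vimage[measurable]: "tuple_XZ -` A i \<in> sets borel" "tuple_XZ -` S \<in> sets borel"
  using measurable_sets[OF tuple_XZ_measurable A_borel, of i] measurable_sets[OF tuple_XZ_measurable S_borel] by simp_all

lemma moment_dev_bound_measurable[measurable]: "moment_dev_bound n \<in> borel_measurable M"
proof -
  note [measurable] = phi_meas tau_meas
  have [measurable]: "tuple_XY (\<lambda>v. \<phi> j v * \<tau> v) \<in> borel_measurable borel" "tuple_XY (\<phi> j) \<in> borel_measurable borel" for j
    by (auto intro!: tuple_XY_measurable)
  show ?thesis unfolding moment_dev_bound_def[abs_def] by measurable
qed

text \<open>Each \<open>j\<close> contributes at most a constant multiple of \<open>E[R \<phi>\<^sub>j\<^sup>2] / n\<close>, and these expectations are diagonal entries of a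
matrix with quadratic form bounded by \<open>u\<close>.\<close>

lemma expected_moment_dev_bound:
  assumes n: "0 < n"
  shows "(\<integral>\<^sup>+\<omega>. moment_dev_bound n \<omega> \<partial>M) \<le> ennreal (moment_const * real (k n) / real n)"
proof -
  have [measurable]: "tuple_XY (\<lambda>v. \<phi> j v * \<tau> v) \<in> borel_measurable borel" "tuple_XY (\<phi> j) \<in> borel_measurable borel" for j
    by (auto intro!: tuple_XY_measurable)
  define c where "c = moment_const / real n"
  have each: "(\<integral>\<^sup>+\<omega>. 2 * ennreal ((dev n \<omega> (tuple_XY (\<lambda>v. \<phi> j v * \<tau> v)))\<^sup>2) +
     2 * (ennreal series_const * (\<Sum>i. ennreal (B i * s i *
       (dev n \<omega> (\<lambda>t. tuple_XY (\<phi> j) t * indicator (tuple_XZ -` A i) t))\<^sup>2))) \<partial>M) \<le> ennreal c" if j: "j < k n" for j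
  proof -
    let ?G = "\<integral>\<omega>. R \<omega> * (\<phi> j (X \<omega>, Y \<omega>))\<^sup>2 \<partial>M"
    have G: "?G \<le> u" by (rule R_phi_sq_le[OF j])
    have sq: "(R \<omega> * a)\<^sup>2 = R \<omega> * a\<^sup>2" if "\<omega> \<in> space M" for \<omega> a
      using R01[OF that] by (auto simp: power_mult_distrib)
    have m\<phi>: "(\<lambda>t. (tuple_XY (\<phi> j) t)\<^sup>2) \<in> borel_measurable borel" by measurable
    have int\<phi>: "integrable law (\<lambda>t. (tuple_XY (\<phi> j) t)\<^sup>2)"
      unfolding integrable_law[OF m\<phi>] using phi_sq[OF j]
      by (subst Bochner_Integration.integrable_cong[OF refl]) (auto simp: sq)
    have eq\<phi>: "(\<integral>t. (tuple_XY (\<phi> j) t)\<^sup>2 \<partial>law) = ?G"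
      unfolding integral_law[OF m\<phi>] by (intro Bochner_Integration.integral_cong) (auto simp: sq)
    have m\<tau>: "(\<lambda>t. (tuple_XY (\<lambda>v. \<phi> j v * \<tau> v) t)\<^sup>2) \<in> borel_measurable borel" by measurable
    have le\<tau>: "AE \<omega> in M. (R \<omega> * (\<phi> j (X \<omega>, Y \<omega>) * \<tau> (X \<omega>, Y \<omega>)))\<^sup>2 \<le> K\<^sup>2 * (R \<omega> * (\<phi> j (X \<omega>, Y \<omega>))\<^sup>2)"
      using tau_bdd AE_space
    proof eventually_elim
      fix \<omega> assume le: "\<bar>R \<omega> * \<tau> (X \<omega>, Y \<omega>)\<bar> \<le> K" and \<omega>: "\<omega> \<in> space M"
      have "(R \<omega> * (\<phi> j (X \<omega>, Y \<omega>) * \<tau> (X \<omega>, Y \<omega>)))\<^sup>2 = (R \<omega> * \<tau> (X \<omega>, Y \<omega>))\<^sup>2 * (R \<omega> * (\<phi> j (X \<omega>, Y \<omega>))\<^sup>2)"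
        using R01[OF \<omega>] by (auto simp: power_mult_distrib)
      also have "\<dots> \<le> K\<^sup>2 * (R \<omega> * (\<phi> j (X \<omega>, Y \<omega>))\<^sup>2)"
        using le power_mono[OF le abs_ge_zero, of 2] R_nonneg[OF \<omega>] by (intro mult_right_mono) auto
      finally show "(R \<omega> * (\<phi> j (X \<omega>, Y \<omega>) * \<tau> (X \<omega>, Y \<omega>)))\<^sup>2 \<le> K\<^sup>2 * (R \<omega> * (\<phi> j (X \<omega>, Y \<omega>))\<^sup>2)" .
    qed
    have int\<tau>M: "integrable M (\<lambda>\<omega>. (R \<omega> * (\<phi> j (X \<omega>, Y \<omega>) * \<tau> (X \<omega>, Y \<omega>)))\<^sup>2)"
      by (rule Bochner_Integration.integrable_bound[where f = "\<lambda>\<omega>. K\<^sup>2 * (R \<omega> * (\<phi> j (X \<omega>, Y \<omega>))\<^sup>2)"])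
        (use phi_sq[OF j] le\<tau> in \<open>auto elim!: eventually_mono\<close>)
    have int\<tau>: "integrable law (\<lambda>t. (tuple_XY (\<lambda>v. \<phi> j v * \<tau> v) t)\<^sup>2)"
      unfolding integrable_law[OF m\<tau>] using int\<tau>M by simp
    have eq\<tau>: "(\<integral>t. (tuple_XY (\<lambda>v. \<phi> j v * \<tau> v) t)\<^sup>2 \<partial>law) \<le> K\<^sup>2 * ?G"
    proof -
      have "(\<integral>t. (tuple_XY (\<lambda>v. \<phi> j v * \<tau> v) t)\<^sup>2 \<partial>law) \<le> (\<integral>\<omega>. K\<^sup>2 * (R \<omega> * (\<phi> j (X \<omega>, Y \<omega>))\<^sup>2) \<partial>M)"
        unfolding integral_law[OF m\<tau>] using int\<tau>M phi_sq[OF j] le\<tau> by (intro integral_mono_AE) auto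
      then show ?thesis by simp
    qed
    have 1: "(\<integral>\<^sup>+\<omega>. ennreal ((dev n \<omega> (tuple_XY (\<lambda>v. \<phi> j v * \<tau> v)))\<^sup>2) \<partial>M) \<le> ennreal (K\<^sup>2 * u / real n)"
    proof -
      have "(\<integral>\<^sup>+\<omega>. ennreal ((dev n \<omega> (tuple_XY (\<lambda>v. \<phi> j v * \<tau> v)))\<^sup>2) \<partial>M)
        \<le> ennreal ((\<integral>t. (tuple_XY (\<lambda>v. \<phi> j v * \<tau> v) t)\<^sup>2 \<partial>law) / real n)"
        unfolding dev_def by (rule second_moment_emp_dev[OF obs_indep obs_ident _ int\<tau> n]) measurable
      also have "\<dots> \<le> ennreal (K\<^sup>2 * u / real n)"
        using eq\<tau> mult_left_mono[OF G, of "K\<^sup>2"] by (intro ennreal_leI divide_right_mono) auto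
      finally show ?thesis .
    qed
    have 2: "(\<integral>\<^sup>+\<omega>. (\<Sum>i. ennreal (B i * s i *
       (dev n \<omega> (\<lambda>t. tuple_XY (\<phi> j) t * indicator (tuple_XZ -` A i) t))\<^sup>2)) \<partial>M) \<le> ennreal (C * u / real n)"
    proof -
      have ind: "indicator (tuple_XZ -` A i) t = (indicator (A i) (tuple_XZ t) :: real)" for i t
        by (simp add: indicator_def)
      have "(\<integral>\<^sup>+\<omega>. (\<Sum>i. ennreal (B i * s i *
         (dev n \<omega> (\<lambda>t. tuple_XY (\<phi> j) t * indicator (tuple_XZ -` A i) t))\<^sup>2)) \<partial>M)
        \<le> ennreal (C * (\<integral>t. (tuple_XY (\<phi> j) t)\<^sup>2 \<partial>law) / real n)"
        unfolding dev_def
        by (rule expected_series_bound[OF obs_indep obs_ident _ int\<phi> n _ B_nonneg s_pos])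
          (measurable, simp_all only: ind Bs_sum Bs_le)
      also have "\<dots> \<le> ennreal (C * u / real n)"
        unfolding eq\<phi> using G C_nonneg by (intro ennreal_leI divide_right_mono mult_left_mono) auto
      finally show ?thesis .
    qed
    have "(\<integral>\<^sup>+\<omega>. 2 * ennreal ((dev n \<omega> (tuple_XY (\<lambda>v. \<phi> j v * \<tau> v)))\<^sup>2) +
       2 * (ennreal series_const * (\<Sum>i. ennreal (B i * s i *
         (dev n \<omega> (\<lambda>t. tuple_XY (\<phi> j) t * indicator (tuple_XZ -` A i) t))\<^sup>2))) \<partial>M)
      = 2 * (\<integral>\<^sup>+\<omega>. ennreal ((dev n \<omega> (tuple_XY (\<lambda>v. \<phi> j v * \<tau> v)))\<^sup>2) \<partial>M) +
        2 * (ennreal series_const * (\<integral>\<^sup>+\<omega>. (\<Sum>i. ennreal (B i * s i *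
         (dev n \<omega> (\<lambda>t. tuple_XY (\<phi> j) t * indicator (tuple_XZ -` A i) t))\<^sup>2)) \<partial>M))"
      by (simp add: nn_integral_add nn_integral_cmult)
    also have "\<dots> \<le> 2 * ennreal (K\<^sup>2 * u / real n) + 2 * (ennreal series_const * ennreal (C * u / real n))"
      by (intro add_mono mult_left_mono 1 2) auto
    also have "\<dots> = ennreal c"
    proof -
      have "2 * ennreal (K\<^sup>2 * u / real n) = ennreal (2 * (K\<^sup>2 * u / real n))"
        using u_pos by (subst ennreal_mult) auto
      moreover have "2 * (ennreal series_const * ennreal (C * u / real n)) = ennreal (2 * (series_const * (C * u / real n)))"
        using u_pos C_nonneg series_const_nonneg by (subst ennreal_mult, simp, simp, subst ennreal_mult) auto
      ultimately show ?thesis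
        using u_pos C_nonneg series_const_nonneg
        by (simp add: ennreal_plus[symmetric] c_def moment_const_def add_divide_distrib mult.assoc del: ennreal_plus)
    qed
    finally show ?thesis .
  qed
  have "(\<integral>\<^sup>+\<omega>. moment_dev_bound n \<omega> \<partial>M) = (\<Sum>j<k n. \<integral>\<^sup>+\<omega>. 2 * ennreal ((dev n \<omega> (tuple_XY (\<lambda>v. \<phi> j v * \<tau> v)))\<^sup>2) +
     2 * (ennreal series_const * (\<Sum>i. ennreal (B i * s i *
       (dev n \<omega> (\<lambda>t. tuple_XY (\<phi> j) t * indicator (tuple_XZ -` A i) t))\<^sup>2))) \<partial>M)"
    unfolding moment_dev_bound_def by (rule nn_integral_sum) measurable
  also have "\<dots> \<le> (\<Sum>j<k n. ennreal c)" by (intro sum_mono each) auto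
  also have "\<dots> = ennreal (real (k n) * c)"
    using moment_const_nonneg by (simp add: c_def ennreal_of_nat_eq_real_of_nat ennreal_mult[symmetric])
  finally show ?thesis by (simp add: c_def mult.commute)
qed


definition gram_dev :: "nat \<Rightarrow> 's \<Rightarrow> real" where
  "gram_dev n \<omega> = (\<Sum>i<k n. \<Sum>j<k n. (sample_gram n \<omega> i j - gram i j)\<^sup>2)"

lemma gram_dev_measurable[measurable]: "gram_dev n \<in> borel_measurable M"
proof -
  have [measurable]: "tuple_XY (\<lambda>v. \<phi> i v * \<phi> j v) \<in> borel_measurable borel" for i j
    by (auto intro!: tuple_XY_measurable)
  show ?thesis unfolding gram_dev_def[abs_def] sample_gram_deviation by measurable
qed

text \<open>Summing the variances of all entries gives \<open>E[R |\<phi>|\<^sup>4] / n\<close>. One factor \<open>|\<phi>|\<^sup>2\<close> is at most \<open>x\<close>, and the expectation of the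
other is the trace of the matrix, at most \<open>u k\<^sub>n\<close>.\<close>

lemma expected_gram_dev:
  assumes n: "0 < n" and x: "AE \<omega> in M. (\<Sum>j<k n. (\<phi> j (X \<omega>, Y \<omega>))\<^sup>2) \<le> x"
  shows "(\<integral>\<^sup>+\<omega>. ennreal (gram_dev n \<omega>) \<partial>M) \<le> ennreal (u * (x * real (k n) / real n))"
proof -
  have [measurable]: "tuple_XY (\<lambda>v. \<phi> i v * \<phi> j v) \<in> borel_measurable borel" for i j
    by (auto intro!: tuple_XY_measurable)
  have "AE \<omega> in M. 0 \<le> x" using x by eventually_elim (meson order_trans sum_nonneg zero_le_power2)
  then have x0: "0 \<le> x" by (simp add: prob_space)
  define F where "F i j \<omega> = R \<omega> * (\<phi> i (X \<omega>, Y \<omega>) * \<phi> j (X \<omega>, Y \<omega>))" for i j \<omega>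
  have F_le: "AE \<omega> in M. (\<Sum>i<k n. (F i j \<omega>)\<^sup>2) \<le> x * (R \<omega> * (\<phi> j (X \<omega>, Y \<omega>))\<^sup>2)" for j
    using x AE_space
  proof eventually_elim
    fix \<omega> assume le: "(\<Sum>j<k n. (\<phi> j (X \<omega>, Y \<omega>))\<^sup>2) \<le> x" and \<omega>: "\<omega> \<in> space M"
    have "(\<Sum>i<k n. (F i j \<omega>)\<^sup>2) = (\<Sum>i<k n. (\<phi> i (X \<omega>, Y \<omega>))\<^sup>2) * (R \<omega> * (\<phi> j (X \<omega>, Y \<omega>))\<^sup>2)"
      using R01[OF \<omega>] by (auto simp: F_def power_mult_distrib sum_distrib_right)
    also have "\<dots> \<le> x * (R \<omega> * (\<phi> j (X \<omega>, Y \<omega>))\<^sup>2)"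
      using le R_nonneg[OF \<omega>] by (intro mult_right_mono) auto
    finally show "(\<Sum>i<k n. (F i j \<omega>)\<^sup>2) \<le> x * (R \<omega> * (\<phi> j (X \<omega>, Y \<omega>))\<^sup>2)" .
  qed
  have F_meas[measurable]: "F i j \<in> borel_measurable M" for i j unfolding F_def[abs_def] by measurable
  have F_int: "integrable M (\<lambda>\<omega>. (F i j \<omega>)\<^sup>2)" if "i < k n" "j < k n" for i j
  proof (rule Bochner_Integration.integrable_bound)
    show "integrable M (\<lambda>\<omega>. x * (R \<omega> * (\<phi> j (X \<omega>, Y \<omega>))\<^sup>2))" using phi_sq[OF that(2)] by simp
    show "AE \<omega> in M. norm ((F i j \<omega>)\<^sup>2) \<le> norm (x * (R \<omega> * (\<phi> j (X \<omega>, Y \<omega>))\<^sup>2))"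
      using F_le[of j]
    proof eventually_elim
      fix \<omega> assume "(\<Sum>i<k n. (F i j \<omega>)\<^sup>2) \<le> x * (R \<omega> * (\<phi> j (X \<omega>, Y \<omega>))\<^sup>2)"
      moreover have "(F i j \<omega>)\<^sup>2 \<le> (\<Sum>i<k n. (F i j \<omega>)\<^sup>2)" using that by (intro member_le_sum) auto
      ultimately show "norm ((F i j \<omega>)\<^sup>2) \<le> norm (x * (R \<omega> * (\<phi> j (X \<omega>, Y \<omega>))\<^sup>2))" by simp
    qed
  qed measurable
  have m: "(\<lambda>t. (tuple_XY (\<lambda>v. \<phi> i v * \<phi> j v) t)\<^sup>2) \<in> borel_measurable borel" for i j by measurable
  have each: "(\<integral>\<^sup>+\<omega>. ennreal ((sample_gram n \<omega> i j - gram i j)\<^sup>2) \<partial>M) \<le> ennreal ((\<integral>\<omega>. (F i j \<omega>)\<^sup>2 \<partial>M) / real n)"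
    if "i < k n" "j < k n" for i j
  proof -
    have int: "integrable law (\<lambda>t. (tuple_XY (\<lambda>v. \<phi> i v * \<phi> j v) t)\<^sup>2)"
      unfolding integrable_law[OF m] using F_int[OF that] by (simp add: F_def)
    have "(\<integral>\<^sup>+\<omega>. ennreal ((sample_gram n \<omega> i j - gram i j)\<^sup>2) \<partial>M)
      \<le> ennreal ((\<integral>t. (tuple_XY (\<lambda>v. \<phi> i v * \<phi> j v) t)\<^sup>2 \<partial>law) / real n)"
      unfolding sample_gram_deviation dev_def
      by (rule second_moment_emp_dev[OF obs_indep obs_ident _ int n]) measurable
    also have "(\<integral>t. (tuple_XY (\<lambda>v. \<phi> i v * \<phi> j v) t)\<^sup>2 \<partial>law) = (\<integral>\<omega>. (F i j \<omega>)\<^sup>2 \<partial>M)"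
      unfolding integral_law[OF m] by (simp add: F_def)
    finally show ?thesis .
  qed
  have [measurable]: "(\<lambda>\<omega>. ennreal ((sample_gram n \<omega> i j - gram i j)\<^sup>2)) \<in> borel_measurable M" for i j
    unfolding sample_gram_deviation by measurable
  have "(\<integral>\<^sup>+\<omega>. ennreal (gram_dev n \<omega>) \<partial>M) = (\<integral>\<^sup>+\<omega>. (\<Sum>i<k n. \<Sum>j<k n. ennreal ((sample_gram n \<omega> i j - gram i j)\<^sup>2)) \<partial>M)"
    by (simp add: gram_dev_def sum_nonneg flip: sum_ennreal)
  also have "\<dots> = (\<Sum>i<k n. \<Sum>j<k n. \<integral>\<^sup>+\<omega>. ennreal ((sample_gram n \<omega> i j - gram i j)\<^sup>2) \<partial>M)"
    by (subst nn_integral_sum, measurable, intro sum.cong refl nn_integral_sum) measurable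
  also have "\<dots> \<le> (\<Sum>i<k n. \<Sum>j<k n. ennreal ((\<integral>\<omega>. (F i j \<omega>)\<^sup>2 \<partial>M) / real n))"
    by (intro sum_mono each) auto
  also have "\<dots> = ennreal (\<Sum>i<k n. \<Sum>j<k n. (\<integral>\<omega>. (F i j \<omega>)\<^sup>2 \<partial>M) / real n)"
    by (simp add: sum_nonneg)
  also have "(\<Sum>i<k n. \<Sum>j<k n. (\<integral>\<omega>. (F i j \<omega>)\<^sup>2 \<partial>M) / real n) = (\<Sum>j<k n. (\<Sum>i<k n. \<integral>\<omega>. (F i j \<omega>)\<^sup>2 \<partial>M)) / real n"
    by (subst sum.swap) (simp add: sum_divide_distrib)
  also have "\<dots> \<le> (\<Sum>j<k n. x * u) / real n"
  proof (intro divide_right_mono sum_mono)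
    fix j assume "j \<in> {..<k n}"
    then have j: "j < k n" by simp
    have "(\<Sum>i<k n. \<integral>\<omega>. (F i j \<omega>)\<^sup>2 \<partial>M) = (\<integral>\<omega>. (\<Sum>i<k n. (F i j \<omega>)\<^sup>2) \<partial>M)"
      using F_int j by (intro Bochner_Integration.integral_sum[symmetric]) auto
    also have "\<dots> \<le> (\<integral>\<omega>. x * (R \<omega> * (\<phi> j (X \<omega>, Y \<omega>))\<^sup>2) \<partial>M)"
      using F_int j phi_sq[OF j] F_le by (intro integral_mono_AE Bochner_Integration.integrable_sum) auto
    also have "\<dots> \<le> x * u" using R_phi_sq_le[OF j] x0 by (simp add: mult_left_mono)
    finally show "(\<Sum>i<k n. \<integral>\<omega>. (F i j \<omega>)\<^sup>2 \<partial>M) \<le> x * u" .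
  qed auto
  finally show ?thesis by (simp add: ennreal_leI mult_ac)
qed

text \<open>The Frobenius norm of the difference of two matrices bounds the difference of their quadratic forms.\<close>

lemma form_deviation:
  assumes "gram_dev n \<omega> \<le> d\<^sup>2" "0 \<le> d"
  shows "\<bar>bilin (k n) (sample_gram n \<omega>) v v - bilin (k n) gram v v\<bar> \<le> d * (\<Sum>i<k n. (v i)\<^sup>2)"
proof -
  let ?D = "\<lambda>i j. sample_gram n \<omega> i j - gram i j" and ?P = "{..<k n} \<times> {..<k n}"
  have "(bilin (k n) (sample_gram n \<omega>) v v - bilin (k n) gram v v)\<^sup>2 = (\<Sum>(i, j)\<in>?P. ?D i j * (v i * v j))\<^sup>2"
    by (simp add: bilin_def sum_subtractf[symmetric] sum.cartesian_product[symmetric] algebra_simps)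
  also have "\<dots> \<le> (\<Sum>(i, j)\<in>?P. (?D i j)\<^sup>2) * (\<Sum>(i, j)\<in>?P. (v i * v j)\<^sup>2)"
    using Cauchy_Schwarz_ineq_sum[of "\<lambda>(i, j). ?D i j" "\<lambda>(i, j). v i * v j" ?P] by (simp add: case_prod_unfold)
  also have "(\<Sum>(i, j)\<in>?P. (?D i j)\<^sup>2) = gram_dev n \<omega>"
    by (simp add: gram_dev_def sum.cartesian_product)
  also have "(\<Sum>(i, j)\<in>?P. (v i * v j)\<^sup>2) = (\<Sum>i<k n. (v i)\<^sup>2)\<^sup>2"
    by (simp add: sum.cartesian_product[symmetric] power2_eq_square[of "sum _ _"] sum_product power_mult_distrib)
  also have "gram_dev n \<omega> * (\<Sum>i<k n. (v i)\<^sup>2)\<^sup>2 \<le> d\<^sup>2 * (\<Sum>i<k n. (v i)\<^sup>2)\<^sup>2"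
    using assms by (intro mult_right_mono) auto
  finally have "(bilin (k n) (sample_gram n \<omega>) v v - bilin (k n) gram v v)\<^sup>2 \<le> (d * (\<Sum>i<k n. (v i)\<^sup>2))\<^sup>2"
    by (simp add: power_mult_distrib)
  then show ?thesis
    using assms(2) by (subst power2_le_iff_abs_le[symmetric]) (auto intro!: mult_nonneg_nonneg sum_nonneg)
qed

lemma moment_deviation_uniform:
  assumes \<delta>: "\<delta> \<in> \<Delta>" and good: "\<And>i. i < n \<Longrightarrow> tuple_XZ (obs i \<omega>) \<in> S"
    and le: "moment_dev_bound n \<omega> \<le> ennreal e" "0 \<le> e"
  shows "(\<Sum>j<k n. (sample_moment n \<omega> \<delta> j - moment \<delta> j)\<^sup>2) \<le> e"
proof -
  have [measurable]: "tuple_XY (\<phi> j) \<in> borel_measurable borel" for j by (auto intro!: tuple_XY_measurable)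
  obtain c where c: "\<And>i. \<bar>c i\<bar> \<le> B i" "\<And>w. w \<in> S \<Longrightarrow> (\<lambda>i. c i * indicator (A i) w) sums \<delta> w"
    using expansion[OF \<delta>] by blast
  have ind: "indicator (tuple_XZ -` A i) t = (indicator (A i) (tuple_XZ t) :: real)" for i t
    by (simp add: indicator_def)
  have prob_law: "prob_space law" unfolding law_def by (rule prob_space_distr) auto
  have each: "ennreal ((sample_moment n \<omega> \<delta> j - moment \<delta> j)\<^sup>2) \<le>
      2 * ennreal ((dev n \<omega> (tuple_XY (\<lambda>v. \<phi> j v * \<tau> v)))\<^sup>2) +
      2 * (ennreal series_const * (\<Sum>i. ennreal (B i * s i *
       (dev n \<omega> (\<lambda>t. tuple_XY (\<phi> j) t * indicator (tuple_XZ -` A i) t))\<^sup>2)))" if j: "j < k n" for j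
  proof -
    define p q where "p = dev n \<omega> (tuple_XY (\<lambda>v. \<phi> j v * \<tau> v))"
      and "q = dev n \<omega> (\<lambda>t. tuple_XY (\<phi> j) t * \<delta> (tuple_XZ t))"
    have "(sample_moment n \<omega> \<delta> j - moment \<delta> j)\<^sup>2 = (p - q)\<^sup>2"
      by (simp add: sample_moment_deviation[OF j \<delta>] p_def q_def)
    also have "\<dots> \<le> 2 * p\<^sup>2 + 2 * q\<^sup>2"
      using zero_le_power2[of "p + q"] by (simp add: power2_eq_square algebra_simps)
    finally have "ennreal ((sample_moment n \<omega> \<delta> j - moment \<delta> j)\<^sup>2) \<le> ennreal (2 * p\<^sup>2 + 2 * q\<^sup>2)"
      by (rule ennreal_leI)
    also have "\<dots> = 2 * ennreal (p\<^sup>2) + 2 * ennreal (q\<^sup>2)"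
      by (simp add: ennreal_mult)
    also have "ennreal (q\<^sup>2) \<le> ennreal series_const * (\<Sum>i. ennreal (B i * s i *
       (dev n \<omega> (\<lambda>t. tuple_XY (\<phi> j) t * indicator (tuple_XZ -` A i) t))\<^sup>2))"
      unfolding q_def dev_def series_const_def
    proof (rule emp_dev_series_bound[where c = c and G = "{t. tuple_XZ t \<in> S}" and C = C])
      show "finite_measure law" using prob_law by (simp add: prob_space_def)
      show "integrable law (tuple_XY (\<phi> j))"
        by (subst integrable_law) (use R_phi_integrable[OF j] in auto)
      show "(\<lambda>t. \<delta> (tuple_XZ t)) \<in> borel_measurable law"
        using measurable_compose[OF tuple_XZ_measurable Delta_meas[OF \<delta>]] by (simp cong: measurable_cong_sets)
      show "AE t in law. t \<in> {t. tuple_XZ t \<in> S}"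
        unfolding law_def using S_AE tuple_XZ_vimage(2) by (subst AE_distr_iff) (auto simp: vimage_def)
    qed (use B_nonneg s_pos Bs_div Bs_sum Bs_le c good in \<open>auto simp: ind\<close>)
    finally show ?thesis by (simp add: p_def mult_left_mono add_left_mono)
  qed
  have "ennreal (\<Sum>j<k n. (sample_moment n \<omega> \<delta> j - moment \<delta> j)\<^sup>2) = (\<Sum>j<k n. ennreal ((sample_moment n \<omega> \<delta> j - moment \<delta> j)\<^sup>2))"
    by simp
  also have "\<dots> \<le> moment_dev_bound n \<omega>"
    unfolding moment_dev_bound_def by (rule sum_mono) (rule each, simp)
  also note le(1)
  finally show ?thesis by (simp only: ennreal_le_iff[OF le(2)])
qed

lemma samples_in_support: "AE \<omega> in M. \<forall>i. tuple_XZ (obs i \<omega>) \<in> S"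
proof -
  have "AE \<omega> in M. tuple_XZ (obs i \<omega>) \<in> S" for i
  proof -
    have "AE t in law. tuple_XZ t \<in> S"
      unfolding law_def using S_AE tuple_XZ_vimage(2) by (subst AE_distr_iff) (auto simp: vimage_def)
    then show ?thesis
      unfolding obs_ident[of i, symmetric] using tuple_XZ_vimage(2) by (subst (asm) AE_distr_iff) (auto simp: vimage_def)
  qed
  then show ?thesis by (simp add: AE_all_countable)
qed

text \<open>Markov's inequality for \<open>moment_dev_bound\<close> and \<open>gram_dev\<close>, together with the null event that some observation lies
outside \<open>S\<close>, where the expansion of \<open>\<delta>\<close> says nothing.\<close>

lemma good_event:
  assumes n: "0 < n" and x: "AE \<omega> in M. (\<Sum>j<k n. (\<phi> j (X \<omega>, Y \<omega>))\<^sup>2) \<le> x"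
    and \<epsilon>: "0 < \<epsilon>" and small: "4 * u / l\<^sup>2 * (x * real (k n) / real n) \<le> \<epsilon>"
  obtains Bad where "Bad \<in> sets M" "emeasure M Bad \<le> ennreal (2 * \<epsilon>)"
    "\<And>\<omega> \<delta>. \<omega> \<in> space M - Bad \<Longrightarrow> \<delta> \<in> \<Delta> \<Longrightarrow>
      (\<Sum>j<k n. (sample_moment n \<omega> \<delta> j - moment \<delta> j)\<^sup>2) \<le> (moment_const + 1) / \<epsilon> * (real (k n) / real n)"
    "\<And>\<omega> v. \<omega> \<in> space M - Bad \<Longrightarrow> l / 2 * (\<Sum>i<k n. (v i)\<^sup>2) \<le> bilin (k n) (sample_gram n \<omega>) v v"
    "\<And>\<omega> v. \<omega> \<in> space M - Bad \<Longrightarrow> bilin (k n) (sample_gram n \<omega>) v v \<le> (u + l / 2) * (\<Sum>i<k n. (v i)\<^sup>2)"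
proof -
  define t where "t = (moment_const + 1) / \<epsilon> * (real (k n) / real n)"
  have t0: "0 \<le> t" using moment_const_nonneg \<epsilon> by (simp add: t_def)
  define B1 where "B1 = {\<omega> \<in> space M. ennreal t < moment_dev_bound n \<omega>}"
  define B2 where "B2 = {\<omega> \<in> space M. ennreal ((l / 2)\<^sup>2) < ennreal (gram_dev n \<omega>)}"
  obtain B3 where B3: "{\<omega> \<in> space M. \<not> (\<forall>i. tuple_XZ (obs i \<omega>) \<in> S)} \<subseteq> B3" "B3 \<in> sets M" "emeasure M B3 = 0"
    using samples_in_support by (auto elim: AE_E)
  have B12[measurable]: "B1 \<in> sets M" "B2 \<in> sets M" unfolding B1_def B2_def by measurable
  have e1: "emeasure M B1 \<le> ennreal \<epsilon>"
  proof (cases "k n = 0")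
    case True
    then have "B1 = {}" by (auto simp: B1_def moment_dev_bound_def)
    then show ?thesis by simp
  next
    case False
    define r where "r = real (k n) / real n"
    have r: "0 < r" using False n by (simp add: r_def)
    have t: "t = (moment_const + 1) / \<epsilon> * r" by (simp add: t_def r_def)
    have "0 < t" unfolding t using r \<epsilon> moment_const_nonneg by (intro mult_pos_pos divide_pos_pos) auto
    have "(\<integral>\<^sup>+\<omega>. moment_dev_bound n \<omega> \<partial>M) \<le> ennreal (moment_const * r)"
      using expected_moment_dev_bound[OF n] by (simp add: r_def)
    then have "emeasure M B1 \<le> ennreal (moment_const * r / t)"
      unfolding B1_def using \<open>0 < t\<close> moment_const_nonneg r by (intro Markov_ennreal) auto
    also have "moment_const * r / t = \<epsilon> * (moment_const / (moment_const + 1))"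
      using r \<epsilon> moment_const_nonneg by (simp add: t divide_simps)
    also have "\<dots> \<le> \<epsilon> * 1" using \<epsilon> moment_const_nonneg by (intro mult_left_mono) (auto simp: divide_le_eq)
    finally show ?thesis by (simp add: ennreal_leI)
  qed
  have "AE \<omega> in M. 0 \<le> x" using x by eventually_elim (meson order_trans sum_nonneg zero_le_power2)
  then have x0: "0 \<le> x" by (simp add: prob_space)
  have e2: "emeasure M B2 \<le> ennreal \<epsilon>"
  proof -
    have "emeasure M B2 \<le> ennreal ((u * (x * real (k n) / real n)) / (l / 2)\<^sup>2)"
      unfolding B2_def
      by (rule Markov_ennreal) (use expected_gram_dev[OF n x] x0 u_pos l_pos in auto)
    also have "(u * (x * real (k n) / real n)) / (l / 2)\<^sup>2 = 4 * u / l\<^sup>2 * (x * real (k n) / real n)"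
      by (simp add: power_divide mult_ac)
    finally show ?thesis using small by (meson ennreal_leI order_trans)
  qed
  define Bad where "Bad = B1 \<union> B2 \<union> B3"
  show ?thesis
  proof (rule that[of Bad])
    show "Bad \<in> sets M" using B12 B3 by (auto simp: Bad_def)
    have "emeasure M Bad \<le> emeasure M B1 + emeasure M B2 + emeasure M B3"
      unfolding Bad_def using B12 B3 by (intro order_trans[OF emeasure_subadditive] add_mono emeasure_subadditive) auto
    also have "\<dots> \<le> ennreal \<epsilon> + ennreal \<epsilon> + 0" using e1 e2 B3 by (intro add_mono) auto
    also have "\<dots> = ennreal (2 * \<epsilon>)" using \<epsilon> by (simp add: ennreal_plus[symmetric] del: ennreal_plus)
    finally show "emeasure M Bad \<le> ennreal (2 * \<epsilon>)" .
    fix \<omega> assume \<omega>: "\<omega> \<in> space M - Bad"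
    have good: "tuple_XZ (obs i \<omega>) \<in> S" for i using \<omega> B3 by (auto simp: Bad_def)
    have "moment_dev_bound n \<omega> \<le> ennreal t" using \<omega> by (auto simp: Bad_def B1_def)
    then show "(\<Sum>j<k n. (sample_moment n \<omega> \<delta> j - moment \<delta> j)\<^sup>2) \<le> (moment_const + 1) / \<epsilon> * (real (k n) / real n)"
      if "\<delta> \<in> \<Delta>" for \<delta>
      unfolding t_def[symmetric] using that good t0 by (intro moment_deviation_uniform) auto
    have "ennreal (gram_dev n \<omega>) \<le> ennreal ((l / 2)\<^sup>2)" using \<omega> by (auto simp: Bad_def B2_def not_less)
    then have "gram_dev n \<omega> \<le> (l / 2)\<^sup>2" by (simp add: ennreal_le_iff)
    then have d: "\<bar>bilin (k n) (sample_gram n \<omega>) v v - bilin (k n) gram v v\<bar> \<le> l / 2 * (\<Sum>i<k n. (v i)\<^sup>2)" for v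
      using l_pos by (intro form_deviation) auto
    have lo: "l * (\<Sum>i<k n. (v i)\<^sup>2) \<le> bilin (k n) gram v v" and up: "bilin (k n) gram v v \<le> u * (\<Sum>i<k n. (v i)\<^sup>2)" for v
      using form_lower[where n = n and v = v] form_upper[where n = n and v = v] by (simp_all add: gram_def[abs_def])
    show "l / 2 * (\<Sum>i<k n. (v i)\<^sup>2) \<le> bilin (k n) (sample_gram n \<omega>) v v" for v
      using d[of v] lo[of v] unfolding abs_le_iff by linarith
    show "bilin (k n) (sample_gram n \<omega>) v v \<le> (u + l / 2) * (\<Sum>i<k n. (v i)\<^sup>2)" for v
      using d[of v] up[of v] unfolding abs_le_iff distrib_right by linarith
  qed
qed

end

section \<open>Comparison of the criterion with the weak distance\<close>

context sieve_regression
begin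

lemma cond_mean_delta_bdd:
  assumes "\<delta> \<in> \<Delta>"
  shows "AE \<omega> in M. \<bar>cond_mean M R X Y (\<lambda>\<omega>. \<delta> (X \<omega>, Z \<omega>)) \<omega>\<bar> \<le> K"
  by (rule cond_mean_bounded[OF delta_XZ_meas[OF assms] delta_XZ_bdd[OF assms]])

lemma residual_bdd:
  assumes "\<delta> \<in> \<Delta>"
  shows "AE \<omega> in M. \<bar>R \<omega> * (\<tau> (X \<omega>, Y \<omega>) - cond_mean M R X Y (\<lambda>\<omega>. \<delta> (X \<omega>, Z \<omega>)) \<omega>)\<bar> \<le> 2 * K"
  using tau_bdd cond_mean_delta_bdd[OF assms] AE_space
proof eventually_elim
  fix \<omega> assume 1: "\<bar>R \<omega> * \<tau> (X \<omega>, Y \<omega>)\<bar> \<le> K" and 2: "\<bar>cond_mean M R X Y (\<lambda>\<omega>. \<delta> (X \<omega>, Z \<omega>)) \<omega>\<bar> \<le> K"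
    and \<omega>: "\<omega> \<in> space M"
  show "\<bar>R \<omega> * (\<tau> (X \<omega>, Y \<omega>) - cond_mean M R X Y (\<lambda>\<omega>. \<delta> (X \<omega>, Z \<omega>)) \<omega>)\<bar> \<le> 2 * K"
  proof (cases "R \<omega> = 0")
    case False
    then have "R \<omega> = 1" using R01[OF \<omega>] by auto
    then show ?thesis using 1 2 by (simp add: abs_le_iff)
  qed (use K_nonneg in simp)
qed

lemma wsq_integrable:
  assumes "\<delta> \<in> \<Delta>"
  shows "integrable M (\<lambda>\<omega>. R \<omega> * (\<tau> (X \<omega>, Y \<omega>) - cond_mean M R X Y (\<lambda>\<omega>. \<delta> (X \<omega>, Z \<omega>)) \<omega>)\<^sup>2)"
proof (rule integrable_const_bound[where B = "(2 * K)\<^sup>2"])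
  show "AE \<omega> in M. norm (R \<omega> * (\<tau> (X \<omega>, Y \<omega>) - cond_mean M R X Y (\<lambda>\<omega>. \<delta> (X \<omega>, Z \<omega>)) \<omega>)\<^sup>2) \<le> (2 * K)\<^sup>2"
    using residual_bdd[OF assms] AE_space
  proof eventually_elim
    fix \<omega> define g where "g = \<tau> (X \<omega>, Y \<omega>) - cond_mean M R X Y (\<lambda>\<omega>. \<delta> (X \<omega>, Z \<omega>)) \<omega>"
    assume le: "\<bar>R \<omega> * (\<tau> (X \<omega>, Y \<omega>) - cond_mean M R X Y (\<lambda>\<omega>. \<delta> (X \<omega>, Z \<omega>)) \<omega>)\<bar> \<le> 2 * K" and \<omega>: "\<omega> \<in> space M"
    have "R \<omega> * g\<^sup>2 = \<bar>R \<omega> * g\<bar>\<^sup>2" using R01[OF \<omega>] by (auto simp: power_mult_distrib)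
    also have "\<dots> \<le> (2 * K)\<^sup>2" using le by (intro power_mono) (auto simp: g_def)
    finally show "norm (R \<omega> * (\<tau> (X \<omega>, Y \<omega>) - cond_mean M R X Y (\<lambda>\<omega>. \<delta> (X \<omega>, Z \<omega>)) \<omega>)\<^sup>2) \<le> (2 * K)\<^sup>2"
      using R_nonneg[OF \<omega>] by (simp add: g_def[symmetric])
  qed
qed measurable

text \<open>The factor \<open>R \<phi>\<^sub>j\<close> is measurable for the conditioning information, so \<open>\<delta>\<close> may be replaced by its conditional mean.\<close>

lemma moment_eq:
  assumes j: "j < k n" and \<delta>: "\<delta> \<in> \<Delta>"
  shows "moment \<delta> j = (\<integral>\<omega>. R \<omega> * (\<phi> j (X \<omega>, Y \<omega>) * (\<tau> (X \<omega>, Y \<omega>) - cond_mean M R X Y (\<lambda>\<omega>. \<delta> (X \<omega>, Z \<omega>)) \<omega>)) \<partial>M)"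
proof -
  let ?m = "cond_mean M R X Y (\<lambda>\<omega>. \<delta> (X \<omega>, Z \<omega>))"
  note i\<tau> = integrable_R_phi_bounded[OF j tau_XY_meas tau_bdd]
  have R_m: "AE \<omega> in M. \<bar>R \<omega> * ?m \<omega>\<bar> \<le> K"
    using cond_mean_delta_bdd[OF \<delta>] AE_space
  proof eventually_elim
    fix \<omega> assume "\<bar>?m \<omega>\<bar> \<le> K" "\<omega> \<in> space M"
    then show "\<bar>R \<omega> * ?m \<omega>\<bar> \<le> K" using R01[of \<omega>] K_nonneg by auto
  qed
  have "(\<integral>\<omega>. R \<omega> * \<phi> j (X \<omega>, Y \<omega>) * ?m \<omega> \<partial>M) = (\<integral>\<omega>. R \<omega> * \<phi> j (X \<omega>, Y \<omega>) * \<delta> (X \<omega>, Z \<omega>) \<partial>M)"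
    by (rule integral_cond_mean[OF phi_meas R_phi_integrable[OF j] delta_XZ_meas[OF \<delta>] delta_XZ_bdd[OF \<delta>]])
  then show ?thesis
    using i\<tau> integrable_R_phi_bounded[OF j delta_XZ_meas[OF \<delta>] R_delta_bdd[OF \<delta>]]
      integrable_R_phi_bounded[OF j cond_mean_measurable R_m]
    by (simp add: moment_def right_diff_distrib mult.assoc)
qed

lemma criterion_eq_sample:
  assumes n: "0 < n" and c: "0 < c" and lower: "\<And>v. c * (\<Sum>i<k n. (v i)\<^sup>2) \<le> bilin (k n) (sample_gram n \<omega>) v v"
    and C': "0 < C'" and upper: "\<And>v. bilin (k n) (sample_gram n \<omega>) v v \<le> C' * (\<Sum>i<k n. (v i)\<^sup>2)"
  defines "Q \<equiv> \<lambda>\<delta>. criterion \<phi> (k n) \<tau> n (\<lambda>i. Rs i \<omega>) (\<lambda>i. Xs i \<omega>) (\<lambda>i. Ys i \<omega>) (\<lambda>i. Zs i \<omega>) \<delta>"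
  shows "Q \<delta> \<le> (\<Sum>j<k n. (sample_moment n \<omega> \<delta> j)\<^sup>2) / c" "(\<Sum>j<k n. (sample_moment n \<omega> \<delta> j)\<^sup>2) \<le> C' * Q \<delta>"
proof -
  obtain \<beta> where \<beta>: "\<And>i. i < k n \<Longrightarrow> (\<Sum>j<k n. sample_gram n \<omega> i j * \<beta> j) = sample_moment n \<omega> \<delta> i"
    "Q \<delta> = bilin (k n) (sample_gram n \<omega>) \<beta> \<beta>"
    using criterion_solves_normal_equations[where n = n and c = c and k = "k n" and \<phi> = \<phi> and \<tau> = \<tau> and \<delta> = \<delta>
        and r = "\<lambda>i. Rs i \<omega>" and x = "\<lambda>i. Xs i \<omega>" and y = "\<lambda>i. Ys i \<omega>" and z = "\<lambda>i. Zs i \<omega>",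
        folded sample_gram_def sample_moment_def, OF n c lower] unfolding Q_def by blast
  have sym: "sample_gram n \<omega> i j = sample_gram n \<omega> j i" for i j
    by (simp add: sample_gram_def mult_ac)
  show "Q \<delta> \<le> (\<Sum>j<k n. (sample_moment n \<omega> \<delta> j)\<^sup>2) / c" "(\<Sum>j<k n. (sample_moment n \<omega> \<delta> j)\<^sup>2) \<le> C' * Q \<delta>"
    unfolding \<beta>(2) by (rule normal_equations_bounds[OF sym c C' lower upper \<beta>(1)]; assumption)+
qed

definition crit :: "nat \<Rightarrow> 's \<Rightarrow> ('x \<times> real \<Rightarrow> real) \<Rightarrow> real" where
  "crit n \<omega> \<delta> = criterion \<phi> (k n) \<tau> n (\<lambda>i. Rs i \<omega>) (\<lambda>i. Xs i \<omega>) (\<lambda>i. Ys i \<omega>) (\<lambda>i. Zs i \<omega>) \<delta>"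

text \<open>The residual lies within \<open>r\<close> of the span of the basis functions, almost surely on the event \<open>R = 1\<close>.\<close>

definition near_span :: "nat \<Rightarrow> ('x \<times> real \<Rightarrow> real) \<Rightarrow> real \<Rightarrow> bool" where
  "near_span n \<delta> r \<longleftrightarrow> (\<exists>p. AE \<omega> in M.
     R \<omega> * \<bar>\<tau> (X \<omega>, Y \<omega>) - cond_mean M R X Y (\<lambda>\<omega>. \<delta> (X \<omega>, Z \<omega>)) \<omega> - (\<Sum>j<k n. p j * \<phi> j (X \<omega>, Y \<omega>))\<bar> \<le> r)"

definition comparable :: "real \<Rightarrow> nat \<Rightarrow> 's \<Rightarrow> bool" where
  "comparable D n \<omega> \<longleftrightarrow> (\<forall>\<delta>\<in>\<Delta>.
     crit n \<omega> \<delta> \<le> D * (wsq \<delta> + real (k n) / real n) \<and>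
     (\<forall>r\<ge>0. near_span n \<delta> r \<longrightarrow> wsq \<delta> \<le> D * (crit n \<omega> \<delta> + real (k n) / real n + r\<^sup>2)))"

text \<open>The constant \<open>D\<close> depends on \<open>\<epsilon>\<close> but not on \<open>n\<close>: the chain is criterion, sample moments, population moments, weak
distance, with the deviation of the moments entering as a multiple of \<open>k\<^sub>n / n\<close>.\<close>

lemma criterion_comparable:
  assumes \<epsilon>: "0 < \<epsilon>"
  shows "\<exists>D>0. \<forall>n x. 0 < n \<longrightarrow> (AE \<omega> in M. (\<Sum>j<k n. (\<phi> j (X \<omega>, Y \<omega>))\<^sup>2) \<le> x) \<longrightarrow>
      4 * u / l\<^sup>2 * (x * real (k n) / real n) \<le> \<epsilon> \<longrightarrow>
      (\<exists>Bad\<in>sets M. emeasure M Bad \<le> ennreal (2 * \<epsilon>) \<and> (\<forall>\<omega>\<in>space M - Bad. comparable D n \<omega>))"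
proof -
  \<comment> \<open>\<open>e\<close> is the factor in \<open>good_event\<close>; the \<open>+ 1\<close> keeps it positive.\<close>
  define e where "e = (moment_const + 1) / \<epsilon>"
  have e: "0 < e" using moment_const_nonneg \<epsilon> by (simp add: e_def)
  define D where "D = 4 * u / l + 4 * e / l + 8 * (u + l / 2) / l + 8 * e / l + 6"
  have ulp: "0 < 4 * u / l" "0 < 4 * e / l" "0 < 8 * (u + l / 2) / l" "0 < 8 * e / l"
    using u_pos l_pos e by auto
  have D: "0 < D" "4 * u / l \<le> D" "4 * e / l \<le> D" "8 * (u + l / 2) / l \<le> D" "8 * e / l \<le> D" "6 \<le> D"
    using ulp unfolding D_def by linarith+
  show ?thesis
  proof (intro exI[of _ D] conjI D(1) allI impI)
    fix n x assume n: "0 < n" and x: "AE \<omega> in M. (\<Sum>j<k n. (\<phi> j (X \<omega>, Y \<omega>))\<^sup>2) \<le> x"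
      and small: "4 * u / l\<^sup>2 * (x * real (k n) / real n) \<le> \<epsilon>"
    define kn where "kn = real (k n) / real n"
    have kn: "0 \<le> kn" by (simp add: kn_def)
    obtain Bad where Bad: "Bad \<in> sets M" "emeasure M Bad \<le> ennreal (2 * \<epsilon>)"
      and dv: "\<And>\<omega> \<delta>. \<omega> \<in> space M - Bad \<Longrightarrow> \<delta> \<in> \<Delta> \<Longrightarrow> (\<Sum>j<k n. (sample_moment n \<omega> \<delta> j - moment \<delta> j)\<^sup>2) \<le> e * kn"
      and lower: "\<And>\<omega> v. \<omega> \<in> space M - Bad \<Longrightarrow> l / 2 * (\<Sum>i<k n. (v i)\<^sup>2) \<le> bilin (k n) (sample_gram n \<omega>) v v"
      and upper: "\<And>\<omega> v. \<omega> \<in> space M - Bad \<Longrightarrow> bilin (k n) (sample_gram n \<omega>) v v \<le> (u + l / 2) * (\<Sum>i<k n. (v i)\<^sup>2)"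
      by (rule good_event[OF n x \<epsilon> small, folded e_def kn_def]) blast
    show "\<exists>Bad\<in>sets M. emeasure M Bad \<le> ennreal (2 * \<epsilon>) \<and> (\<forall>\<omega>\<in>space M - Bad. comparable D n \<omega>)"
    proof (intro bexI[OF _ Bad(1)] conjI Bad(2) ballI, unfold comparable_def, intro ballI conjI allI impI)
      fix \<omega> \<delta> assume \<omega>: "\<omega> \<in> space M - Bad" and \<delta>: "\<delta> \<in> \<Delta>"
      define Q where "Q = crit n \<omega> \<delta>"
      define g where "g \<omega> = \<tau> (X \<omega>, Y \<omega>) - cond_mean M R X Y (\<lambda>\<omega>. \<delta> (X \<omega>, Z \<omega>)) \<omega>" for \<omega>
      define H h where "H = (\<Sum>j<k n. (moment \<delta> j)\<^sup>2)" and "h = (\<Sum>j<k n. (sample_moment n \<omega> \<delta> j)\<^sup>2)"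
      have l2: "0 < l / 2" "0 < u + l / 2" using l_pos u_pos by auto
      have Qh: "Q \<le> h / (l / 2)" "h \<le> (u + l / 2) * Q"
        unfolding Q_def crit_def h_def
        by (rule criterion_eq_sample[OF n l2(1) lower[OF \<omega>] l2(2) upper[OF \<omega>]])+
      have g_meas: "g \<in> borel_measurable M" unfolding g_def[abs_def] by measurable
      have w: "wsq \<delta> = (\<integral>\<omega>. R \<omega> * (g \<omega>)\<^sup>2 \<partial>M)" by (simp add: wsq_def g_def)
      have g2: "integrable M (\<lambda>\<omega>. R \<omega> * (g \<omega>)\<^sup>2)" using wsq_integrable[OF \<delta>] by (simp add: g_def)
      have w0: "0 \<le> wsq \<delta>" unfolding w using R_nonneg by (intro integral_nonneg_AE AE_I2) auto
      have H_eq: "H = (\<Sum>j<k n. (\<integral>\<omega>. R \<omega> * (\<phi> j (X \<omega>, Y \<omega>) * g \<omega>) \<partial>M)\<^sup>2)"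
        unfolding H_def g_def by (intro sum.cong refl) (simp add: moment_eq[OF _ \<delta>])
      note proj = projection_coefficients_bounds[where f = "\<lambda>j \<omega>. \<phi> j (X \<omega>, Y \<omega>)" and g = g and k = "k n",
          OF phi_XY_meas phi_sq g_meas g2 l_pos u_pos form_lower form_upper, folded H_eq w]
      have Hw: "H \<le> u * wsq \<delta>" by (rule proj(1))
      have hH: "h \<le> 2 * H + 2 * (e * kn)" "H \<le> 2 * h + 2 * (e * kn)"
      proof -
        have *: "(\<Sum>j<k n. (a j)\<^sup>2) \<le> 2 * (\<Sum>j<k n. (b j)\<^sup>2) + 2 * (\<Sum>j<k n. (a j - b j)\<^sup>2)" for a b :: "nat \<Rightarrow> real"
        proof -
          have "(a j)\<^sup>2 \<le> 2 * (b j)\<^sup>2 + 2 * (a j - b j)\<^sup>2" for j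
            using zero_le_power2[of "a j - 2 * b j"] by (simp add: power2_eq_square algebra_simps)
          then show ?thesis by (simp add: sum_distrib_left sum.distrib[symmetric] sum_mono)
        qed
        show "h \<le> 2 * H + 2 * (e * kn)"
          using *[of "sample_moment n \<omega> \<delta>" "moment \<delta>"] dv[OF \<omega> \<delta>] by (simp add: h_def H_def)
        show "H \<le> 2 * h + 2 * (e * kn)"
          using *[of "moment \<delta>" "sample_moment n \<omega> \<delta>"] dv[OF \<omega> \<delta>]
          by (simp add: h_def H_def power2_commute[of "moment \<delta> _"])
      qed
      have Q0: "0 \<le> Q"
      proof -
        have "0 \<le> h" by (simp add: h_def sum_nonneg)
        then have "0 \<le> (u + l / 2) * Q" using Qh(2) by linarith
        then show ?thesis using l2(2) by (simp add: zero_le_mult_iff)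
      qed
      show "crit n \<omega> \<delta> \<le> D * (wsq \<delta> + real (k n) / real n)"
      proof -
        have "Q \<le> 2 / l * h" using Qh(1) by (simp add: mult.commute)
        also have "\<dots> \<le> 2 / l * (2 * (u * wsq \<delta>) + 2 * (e * kn))"
          using hH(1) Hw l_pos by (intro mult_left_mono) auto
        also have "\<dots> = 4 * u / l * wsq \<delta> + 4 * e / l * kn" using l_pos by (simp add: field_simps)
        also have "\<dots> \<le> D * wsq \<delta> + D * kn" using D w0 kn by (intro add_mono mult_right_mono)
        finally show ?thesis by (simp add: kn_def Q_def distrib_left)
      qed
      fix r :: real assume r: "0 \<le> r" and "near_span n \<delta> r"
      then obtain p where p: "AE \<omega> in M. R \<omega> * \<bar>g \<omega> - (\<Sum>j<k n. p j * \<phi> j (X \<omega>, Y \<omega>))\<bar> \<le> r"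
        unfolding near_span_def g_def by blast
      have "wsq \<delta> \<le> 4 / l * H + 6 * r\<^sup>2"
        using proj(2)[where p = p and r = r] p r by simp
      also have "\<dots> \<le> 4 / l * (2 * ((u + l / 2) * Q) + 2 * (e * kn)) + 6 * r\<^sup>2"
        using hH(2) Qh(2) l_pos by (intro add_right_mono mult_left_mono) auto
      also have "\<dots> = 8 * (u + l / 2) / l * Q + 8 * e / l * kn + 6 * r\<^sup>2"
        using l_pos by (simp add: field_simps)
      also have "\<dots> \<le> D * Q + D * kn + D * r\<^sup>2"
        using D Q0 kn by (intro add_mono mult_right_mono) auto
      finally show "wsq \<delta> \<le> D * (crit n \<omega> \<delta> + real (k n) / real n + r\<^sup>2)"
        by (simp add: kn_def Q_def distrib_left)
    qed
  qed
qed

end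

section \<open>Supports, compactness and the zeros of the weak distance\<close>

text \<open>The complement of the support is a countable union of null sets from a basis of the topology.\<close>

lemma msupport_complement_null:
  fixes \<mu> :: "'b::second_countable_topology measure"
  assumes sets: "sets \<mu> = sets borel"
  shows "closed (msupport \<mu>)" "AE x in \<mu>. x \<in> msupport \<mu>"
proof -
  obtain \<B> :: "'b set set" where \<B>: "countable \<B>" "topological_basis \<B>"
    using ex_countable_basis by blast
  define \<N> where "\<N> = {U \<in> \<B>. emeasure \<mu> U = 0}"
  have openB: "open U" if "U \<in> \<B>" for U using topological_basis_open[OF \<B>(2) that] .
  have eq: "- msupport \<mu> = \<Union>\<N>"
  proof (intro equalityI subsetI)
    fix x assume "x \<in> - msupport \<mu>"
    then obtain U where U: "open U" "x \<in> U" "emeasure \<mu> U = 0" by (auto simp: msupport_def)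
    obtain V where V: "V \<in> \<B>" "x \<in> V" "V \<subseteq> U" using topological_basisE[OF \<B>(2) U(1,2)] by blast
    have "emeasure \<mu> V \<le> emeasure \<mu> U" using V U sets by (intro emeasure_mono) auto
    then show "x \<in> \<Union>\<N>" using V U by (auto simp: \<N>_def)
  qed (auto simp: \<N>_def msupport_def dest: openB)
  show "closed (msupport \<mu>)"
    unfolding closed_def eq by (auto simp: \<N>_def intro: openB)
  have "(\<Union>U\<in>\<N>. U) \<in> null_sets \<mu>"
  proof (rule null_sets_UN')
    show "countable \<N>" using \<B>(1) by (simp add: \<N>_def countable_subset)
    show "U \<in> null_sets \<mu>" if "U \<in> \<N>" for U
      using that openB sets by (auto simp: \<N>_def null_sets_def)
  qed
  then have "- msupport \<mu> \<in> null_sets \<mu>" using eq by simp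
  then show "AE x in \<mu>. x \<in> msupport \<mu>"
    using AE_not_in[of "- msupport \<mu>" \<mu>] by simp
qed

lemma AE_in_msupport:
  fixes V :: "'s \<Rightarrow> 'b::second_countable_topology"
  assumes [measurable]: "V \<in> borel_measurable M"
  shows "AE \<omega> in M. V \<omega> \<in> msupport (distr M borel V)"
proof -
  have "closed (msupport (distr M borel V))" by (rule msupport_complement_null) simp
  then have [measurable]: "msupport (distr M borel V) \<in> sets borel" by (rule borel_closed)
  have "AE x in distr M borel V. x \<in> msupport (distr M borel V)" by (rule msupport_complement_null) simp
  then show ?thesis by (subst (asm) AE_distr_iff) (auto simp: Collect_mem_eq)
qed

text \<open>Otherwise there is a sequence in \<open>\<Delta>\<close> with \<open>W \<rightarrow> 0\<close> that stays away from the zeros of \<open>W\<close>. By Arzela--Ascoli a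
subsequence converges uniformly; the limit is in \<open>\<Delta>\<close> because \<open>\<Delta>\<close> is closed, and \<open>W\<close> vanishes there by continuity.\<close>

lemma well_separated_zeros:
  fixes S :: "'a::euclidean_space set" and \<Delta> :: "('a \<Rightarrow> real) set" and W :: "('a \<Rightarrow> real) \<Rightarrow> real"
  assumes S: "compact S" and ext: "\<Delta> \<subseteq> extensional S" and cl: "sup_closed S \<Delta>"
    and bdd: "\<And>\<delta> x. \<delta> \<in> \<Delta> \<Longrightarrow> x \<in> S \<Longrightarrow> \<bar>\<delta> x\<bar> \<le> K"
    and lip: "\<And>\<delta> x y. \<delta> \<in> \<Delta> \<Longrightarrow> x \<in> S \<Longrightarrow> y \<in> S \<Longrightarrow> \<bar>\<delta> x - \<delta> y\<bar> \<le> L * norm (x - y)"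
    and W: "\<And>\<delta>. \<delta> \<in> \<Delta> \<Longrightarrow> 0 \<le> W \<delta>"
      "\<And>\<delta> \<delta>' e. \<delta> \<in> \<Delta> \<Longrightarrow> \<delta>' \<in> \<Delta> \<Longrightarrow> 0 \<le> e \<Longrightarrow> (\<And>x. x \<in> S \<Longrightarrow> \<bar>\<delta> x - \<delta>' x\<bar> \<le> e) \<Longrightarrow> W \<delta>' \<le> 2 * W \<delta> + 2 * e\<^sup>2"
    and \<epsilon>: "0 < \<epsilon>"
  shows "\<exists>\<kappa>>0. \<forall>\<delta>\<in>\<Delta>. W \<delta> < \<kappa> \<longrightarrow> (\<exists>\<delta>'\<in>\<Delta>. W \<delta>' = 0 \<and> (\<forall>x\<in>S. \<bar>\<delta> x - \<delta>' x\<bar> \<le> \<epsilon>))"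
proof (rule ccontr)
  assume neg: "\<not> ?thesis"
  have "\<forall>j. \<exists>\<delta>\<in>\<Delta>. W \<delta> < 1 / real (Suc j) \<and> \<not> (\<exists>\<delta>'\<in>\<Delta>. W \<delta>' = 0 \<and> (\<forall>x\<in>S. \<bar>\<delta> x - \<delta>' x\<bar> \<le> \<epsilon>))"
  proof
    fix j
    have "0 < 1 / real (Suc j)" by simp
    then show "\<exists>\<delta>\<in>\<Delta>. W \<delta> < 1 / real (Suc j) \<and> \<not> (\<exists>\<delta>'\<in>\<Delta>. W \<delta>' = 0 \<and> (\<forall>x\<in>S. \<bar>\<delta> x - \<delta>' x\<bar> \<le> \<epsilon>))"
      using neg by blast
  qed
  then obtain f where f: "\<And>j. f j \<in> \<Delta>" "\<And>j. W (f j) < 1 / real (Suc j)"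
    "\<And>j. \<not> (\<exists>\<delta>'\<in>\<Delta>. W \<delta>' = 0 \<and> (\<forall>x\<in>S. \<bar>f j x - \<delta>' x\<bar> \<le> \<epsilon>))" by metis
  have equi: "\<exists>d>0. \<forall>n y. y \<in> S \<and> norm (x - y) < d \<longrightarrow> norm (f n x - f n y) < e" if x: "x \<in> S" and e: "0 < e" for x e
  proof (intro exI conjI allI impI)
    show "0 < e / (\<bar>L\<bar> + 1)" using e by simp
    fix n y assume y: "y \<in> S \<and> norm (x - y) < e / (\<bar>L\<bar> + 1)"
    have "\<bar>f n x - f n y\<bar> \<le> L * norm (x - y)" using y x f by (intro lip) auto
    also have "\<dots> \<le> (\<bar>L\<bar> + 1) * norm (x - y)" by (intro mult_right_mono) auto
    also have "\<dots> < e"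
    proof -
      have "0 < \<bar>L\<bar> + 1" by simp
      with y show ?thesis by (simp only: pos_less_divide_eq mult.commute)
    qed
    finally show "norm (f n x - f n y) < e" by simp
  qed
  obtain g r where r: "strict_mono (r :: nat \<Rightarrow> nat)"
    and conv: "\<And>e. 0 < e \<Longrightarrow> \<exists>N. \<forall>n x. n \<ge> N \<and> x \<in> S \<longrightarrow> norm (f (r n) x - g x) < e"
  proof (rule Arzela_Ascoli[of S f K])
    show "norm (f n x) \<le> K" if "x \<in> S" for n x using bdd[OF f(1) that] by simp
  qed (use S equi in auto)
  define g' where "g' = restrict g S"
  have close: "\<exists>N. \<forall>n\<ge>N. \<forall>x\<in>S. \<bar>f (r n) x - g' x\<bar> < e" if "0 < e" for e
    using conv[OF that] by (auto simp: g'_def)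
  have "uniform_limit S (\<lambda>n. f (r n)) g' sequentially"
    unfolding uniform_limit_sequentially_iff dist_real_def using close by simp
  then have g'\<Delta>: "g' \<in> \<Delta>"
    using cl f(1) unfolding sup_closed_def by (metis g'_def restrict_extensional)
  have "W g' = 0"
  proof (rule ccontr)
    assume "W g' \<noteq> 0"
    then have pos: "0 < W g'" using W(1)[OF g'\<Delta>] by simp
    define e where "e = sqrt (W g' / 8)"
    have e: "0 < e" "e\<^sup>2 = W g' / 8" using pos by (auto simp: e_def)
    obtain N where N: "\<And>n x. n \<ge> N \<Longrightarrow> x \<in> S \<Longrightarrow> \<bar>f (r n) x - g' x\<bar> < e" using close[OF e(1)] by blast
    obtain M where M: "1 / real (Suc M) < W g' / 8" using nat_approx_posE[of "W g' / 8"] pos by auto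
    define n where "n = max N M"
    have "M \<le> r n" using seq_suble[OF r, of n] by (simp add: n_def)
    then have "1 / real (Suc (r n)) \<le> 1 / real (Suc M)" by (intro divide_left_mono) auto
    then have "W (f (r n)) < W g' / 8" using f(2)[of "r n"] M by linarith
    moreover have "W g' \<le> 2 * W (f (r n)) + 2 * e\<^sup>2"
      using N[of n] e f by (intro W(2)[OF f(1) g'\<Delta>]) (auto simp: n_def less_imp_le)
    ultimately show False using e pos by simp
  qed
  moreover obtain N where "\<And>n x. n \<ge> N \<Longrightarrow> x \<in> S \<Longrightarrow> \<bar>f (r n) x - g' x\<bar> < \<epsilon>" using close[OF \<epsilon>] by blast
  ultimately show False using f(3)[of "r N"] g'\<Delta> by (meson less_imp_le order_refl)
qed

context sieve_regression
begin

lemma wsq_nonneg: "0 \<le> wsq \<delta>"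
  unfolding wsq_def using R_nonneg by (intro integral_nonneg_AE AE_I2) auto

lemma cond_mean_close:
  assumes \<delta>: "\<delta> \<in> \<Delta>" "\<delta>' \<in> \<Delta>" and close: "\<And>w. w \<in> S \<Longrightarrow> \<bar>\<delta> w - \<delta>' w\<bar> \<le> e"
  shows "AE \<omega> in M. \<bar>cond_mean M R X Y (\<lambda>\<omega>. \<delta> (X \<omega>, Z \<omega>)) \<omega> - cond_mean M R X Y (\<lambda>\<omega>. \<delta>' (X \<omega>, Z \<omega>)) \<omega>\<bar> \<le> e"
proof -
  have "AE \<omega> in M. \<bar>\<delta> (X \<omega>, Z \<omega>) - \<delta>' (X \<omega>, Z \<omega>)\<bar> \<le> e"
    using S_AE by eventually_elim (rule close)
  then have "AE \<omega> in M. \<bar>cond_mean M R X Y (\<lambda>\<omega>. \<delta> (X \<omega>, Z \<omega>) - \<delta>' (X \<omega>, Z \<omega>)) \<omega>\<bar> \<le> e"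
    by (intro cond_mean_bounded borel_measurable_diff delta_XZ_meas \<delta>)
  then show ?thesis
    using cond_mean_diff[OF delta_XZ_meas[OF \<delta>(1)] delta_XZ_bdd[OF \<delta>(1)] delta_XZ_meas[OF \<delta>(2)] delta_XZ_bdd[OF \<delta>(2)]]
    by eventually_elim simp
qed

lemma wsq_close:
  assumes \<delta>: "\<delta> \<in> \<Delta>" "\<delta>' \<in> \<Delta>" and e: "0 \<le> e" and close: "\<And>w. w \<in> S \<Longrightarrow> \<bar>\<delta> w - \<delta>' w\<bar> \<le> e"
  shows "wsq \<delta>' \<le> 2 * wsq \<delta> + 2 * e\<^sup>2"
proof -
  define g where "g \<delta> \<omega> = \<tau> (X \<omega>, Y \<omega>) - cond_mean M R X Y (\<lambda>\<omega>. \<delta> (X \<omega>, Z \<omega>)) \<omega>" for \<delta> \<omega>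
  have int: "integrable M (\<lambda>\<omega>. R \<omega> * (g \<delta> \<omega>)\<^sup>2)" "integrable M (\<lambda>\<omega>. R \<omega> * (g \<delta>' \<omega>)\<^sup>2)"
    using wsq_integrable \<delta> by (auto simp: g_def)
  have cc: "AE \<omega> in M. \<bar>cond_mean M R X Y (\<lambda>\<omega>. \<delta> (X \<omega>, Z \<omega>)) \<omega> - cond_mean M R X Y (\<lambda>\<omega>. \<delta>' (X \<omega>, Z \<omega>)) \<omega>\<bar> \<le> e"
    by (rule cond_mean_close[OF \<delta>]) (rule close)
  have "(\<integral>\<omega>. R \<omega> * (g \<delta>' \<omega>)\<^sup>2 \<partial>M) \<le> (\<integral>\<omega>. 2 * (R \<omega> * (g \<delta> \<omega>)\<^sup>2) + 2 * e\<^sup>2 \<partial>M)"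
  proof (rule integral_mono_AE)
    show "AE \<omega> in M. R \<omega> * (g \<delta>' \<omega>)\<^sup>2 \<le> 2 * (R \<omega> * (g \<delta> \<omega>)\<^sup>2) + 2 * e\<^sup>2"
      using cc AE_space
    proof eventually_elim
      fix \<omega> assume "\<bar>cond_mean M R X Y (\<lambda>\<omega>. \<delta> (X \<omega>, Z \<omega>)) \<omega> - cond_mean M R X Y (\<lambda>\<omega>. \<delta>' (X \<omega>, Z \<omega>)) \<omega>\<bar> \<le> e"
        and \<omega>: "\<omega> \<in> space M"
      then have "\<bar>g \<delta>' \<omega> - g \<delta> \<omega>\<bar> \<le> e" by (simp add: g_def abs_minus_commute)
      then have sq: "(g \<delta>' \<omega> - g \<delta> \<omega>)\<^sup>2 \<le> e\<^sup>2" using power_mono[of "\<bar>g \<delta>' \<omega> - g \<delta> \<omega>\<bar>" e 2] by simp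
      have "(g \<delta>' \<omega>)\<^sup>2 \<le> 2 * (g \<delta> \<omega>)\<^sup>2 + 2 * (g \<delta>' \<omega> - g \<delta> \<omega>)\<^sup>2"
        using zero_le_power2[of "g \<delta>' \<omega> - 2 * g \<delta> \<omega>"] by (simp add: power2_eq_square algebra_simps)
      then have "(g \<delta>' \<omega>)\<^sup>2 \<le> 2 * (g \<delta> \<omega>)\<^sup>2 + 2 * e\<^sup>2" using sq by linarith
      then show "R \<omega> * (g \<delta>' \<omega>)\<^sup>2 \<le> 2 * (R \<omega> * (g \<delta> \<omega>)\<^sup>2) + 2 * e\<^sup>2" using R01[OF \<omega>] by auto
    qed
  qed (use int in auto)
  then show ?thesis using int by (simp add: wsq_def g_def[symmetric] prob_space)
qed

lemma wsq_zero_iff: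
  assumes \<delta>: "\<delta> \<in> \<Delta>"
  shows "wsq \<delta> = 0 \<longleftrightarrow> is_regression M R X Y (\<lambda>\<omega>. \<delta> (X \<omega>, Z \<omega>)) \<tau>"
proof -
  have "wsq \<delta> = 0 \<longleftrightarrow> (AE \<omega> in M. R \<omega> * (\<tau> (X \<omega>, Y \<omega>) - cond_mean M R X Y (\<lambda>\<omega>. \<delta> (X \<omega>, Z \<omega>)) \<omega>)\<^sup>2 = 0)"
    unfolding wsq_def using wsq_integrable[OF \<delta>] R_nonneg by (intro integral_nonneg_eq_0_iff_AE AE_I2) auto
  also have "\<dots> \<longleftrightarrow> (AE \<omega> in M. R \<omega> = 1 \<longrightarrow> cond_mean M R X Y (\<lambda>\<omega>. \<delta> (X \<omega>, Z \<omega>)) \<omega> = \<tau> (X \<omega>, Y \<omega>))"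
    by (intro AE_cong) (use R01 in auto)
  finally show ?thesis by (simp add: is_regression_def tau_meas)
qed

text \<open>All solutions have the conditional mean \<open>\<tau>\<close> on \<open>R = 1\<close>, so the weak norm does not distinguish between them.\<close>

lemma weak_norm_from_zero:
  assumes \<delta>: "\<delta> \<in> \<Delta>" and \<delta>0: "\<delta>\<^sub>0 \<in> \<Delta>" "is_regression M R X Y (\<lambda>\<omega>. \<delta>\<^sub>0 (X \<omega>, Z \<omega>)) \<tau>"
  shows "weak_norm M R X Y Z (\<lambda>w. \<delta> w - \<delta>\<^sub>0 w) = ennreal (sqrt (wsq \<delta>))"
    "weak_norm M R X Y Z (\<lambda>w. \<delta>\<^sub>0 w - \<delta> w) = ennreal (sqrt (wsq \<delta>))"
proof -
  have reg: "AE \<omega> in M. R \<omega> = 1 \<longrightarrow> cond_mean M R X Y (\<lambda>\<omega>. \<delta>\<^sub>0 (X \<omega>, Z \<omega>)) \<omega> = \<tau> (X \<omega>, Y \<omega>)"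
    using \<delta>0(2) by (simp add: is_regression_def)
  note diff = cond_mean_diff[OF delta_XZ_meas delta_XZ_bdd delta_XZ_meas delta_XZ_bdd]
  have alg: "r * c\<^sup>2 = r * (t - a)\<^sup>2" if "r \<in> {0, 1}" "r = 1 \<longrightarrow> b = t" "c = a - b \<or> c = b - a"
    for r a b c t :: real
    using that by (auto simp: power2_commute)
  let ?m = "\<lambda>\<delta>. cond_mean M R X Y (\<lambda>\<omega>. \<delta> (X \<omega>, Z \<omega>))"
  have "AE \<omega> in M. R \<omega> * (?m (\<lambda>w. \<delta> w - \<delta>\<^sub>0 w) \<omega>)\<^sup>2 = R \<omega> * (\<tau> (X \<omega>, Y \<omega>) - ?m \<delta> \<omega>)\<^sup>2"
    using diff[OF \<delta> \<delta> \<delta>0(1) \<delta>0(1)] reg AE_space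
    by eventually_elim (rule alg[OF R01], assumption+, simp)
  then have "(\<integral>\<omega>. R \<omega> * (?m (\<lambda>w. \<delta> w - \<delta>\<^sub>0 w) \<omega>)\<^sup>2 \<partial>M) = wsq \<delta>"
    unfolding wsq_def by (intro integral_cong_AE) measurable
  then show "weak_norm M R X Y Z (\<lambda>w. \<delta> w - \<delta>\<^sub>0 w) = ennreal (sqrt (wsq \<delta>))"
    by (simp add: weak_norm_def)
  have "AE \<omega> in M. R \<omega> * (?m (\<lambda>w. \<delta>\<^sub>0 w - \<delta> w) \<omega>)\<^sup>2 = R \<omega> * (\<tau> (X \<omega>, Y \<omega>) - ?m \<delta> \<omega>)\<^sup>2"
    using diff[OF \<delta>0(1) \<delta>0(1) \<delta> \<delta>] reg AE_space
    by eventually_elim (rule alg[OF R01], assumption+, simp)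
  then have "(\<integral>\<omega>. R \<omega> * (?m (\<lambda>w. \<delta>\<^sub>0 w - \<delta> w) \<omega>)\<^sup>2 \<partial>M) = wsq \<delta>"
    unfolding wsq_def by (intro integral_cong_AE) measurable
  then show "weak_norm M R X Y Z (\<lambda>w. \<delta>\<^sub>0 w - \<delta> w) = ennreal (sqrt (wsq \<delta>))"
    by (simp add: weak_norm_def)
qed

end

section \<open>Hausdorff distances\<close>

lemma hausdorff_semidist_le:
  assumes "\<And>f. f \<in> F \<Longrightarrow> \<exists>g\<in>G. N (\<lambda>w. f w - g w) \<le> b"
  shows "hausdorff_semidist N F G \<le> b"
  unfolding hausdorff_semidist_def
proof (rule SUP_least)
  fix f assume "f \<in> F"
  then obtain g where "g \<in> G" "N (\<lambda>w. f w - g w) \<le> b" using assms by blast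
  then show "(INF g\<in>G. N (\<lambda>w. f w - g w)) \<le> b" by (intro INF_lower2[of g])
qed

lemma sup_norm_le: "(\<And>w. w \<in> S \<Longrightarrow> \<bar>f w\<bar> \<le> e) \<Longrightarrow> sup_norm S f \<le> ennreal e"
  unfolding sup_norm_def by (intro SUP_least ennreal_leI)

text \<open>Only the exceptional event has to be measurable.\<close>

lemma outer_measure_exceeds_le:
  fixes T :: "'s \<Rightarrow> ennreal"
  assumes "Bad \<in> sets M" "emeasure M Bad \<le> e" "\<And>\<omega>. \<omega> \<in> space M - Bad \<Longrightarrow> T \<omega> \<le> b"
  shows "outer_measure_of M {\<omega> \<in> space M. b < T \<omega>} \<le> e"
proof -
  have "{\<omega> \<in> space M. b < T \<omega>} \<subseteq> Bad"
  proof
    fix \<omega> assume "\<omega> \<in> {\<omega> \<in> space M. b < T \<omega>}"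
    then show "\<omega> \<in> Bad" using assms(3)[of \<omega>] by (cases "\<omega> \<in> Bad") auto
  qed
  then have "outer_measure_of M {\<omega> \<in> space M. b < T \<omega>} \<le> outer_measure_of M Bad" by (rule outer_measure_of_mono)
  also have "\<dots> = emeasure M Bad" using assms(1) by (rule outer_measure_of_eq)
  finally show ?thesis using assms(2) by (rule order_trans)
qed

lemma tendsto_0_ennrealI:
  fixes f :: "nat \<Rightarrow> ennreal"
  assumes "\<And>e. 0 < e \<Longrightarrow> \<forall>\<^sub>F n in sequentially. f n \<le> ennreal e"
  shows "f \<longlonglongrightarrow> 0"
proof (rule order_tendstoI)
  fix a :: ennreal assume "0 < a"
  then obtain e where e: "0 < e" "ennreal e < a"
  proof (cases a)
    case (real r)
    with \<open>0 < a\<close> have "0 < r" by simp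
    then show ?thesis using that[of "r / 2"] real by (simp add: ennreal_less_iff)
  next
    case top
    then show ?thesis using that[of 1] by simp
  qed
  from assms[OF e(1)] show "\<forall>\<^sub>F n in sequentially. f n < a"
    by eventually_elim (rule le_less_trans[OF _ e(2)])
qed simp

context sieve_regression
begin

text \<open>Outside the exceptional event of \<open>criterion_comparable\<close> two things hold for large \<open>n\<close>: the sieve approximation of every
solution passes the threshold \<open>c n\<close>, and every member of the estimated set has weak distance of order \<open>c n\<close>. Each
Hausdorff semidistance is controlled by one of them.\<close>

lemma consistency_and_rate:
  fixes \<Delta>\<^sub>0 :: "('x \<times> real \<Rightarrow> real) set" and \<Delta>s :: "nat \<Rightarrow> ('x \<times> real \<Rightarrow> real) set"
    and \<Delta>hat :: "nat \<Rightarrow> 's \<Rightarrow> ('x \<times> real \<Rightarrow> real) set" and P :: "nat \<Rightarrow> ('x \<times> real \<Rightarrow> real) \<Rightarrow> 'x \<times> real \<Rightarrow> real"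
    and \<eta> \<rho> c x :: "nat \<Rightarrow> real"
  assumes Delta0: "\<Delta>\<^sub>0 = {\<delta>\<in>\<Delta>. is_regression M R X Y (\<lambda>\<omega>. \<delta> (X \<omega>, Z \<omega>)) \<tau>}" "\<Delta>\<^sub>0 \<noteq> {}"
    and Deltas: "\<And>n. \<Delta>s n \<subseteq> \<Delta>" and P: "\<And>n \<delta>. \<delta> \<in> \<Delta> \<Longrightarrow> P n \<delta> \<in> \<Delta>s n"
    and Deltahat: "\<And>n \<omega>. \<Delta>hat n \<omega> = {\<delta>\<in>\<Delta>s n. crit n \<omega> \<delta> \<le> c n}"
    and S: "compact S" "\<Delta> \<subseteq> extensional S" "sup_closed S \<Delta>"
    and lip: "\<And>\<delta> w w'. \<delta> \<in> \<Delta> \<Longrightarrow> w \<in> S \<Longrightarrow> w' \<in> S \<Longrightarrow> \<bar>\<delta> w - \<delta> w'\<bar> \<le> L * norm (w - w')"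
    and sieve: "0 \<le> C1" "\<forall>\<^sub>F n in sequentially. \<forall>\<delta>\<in>\<Delta>. \<forall>w\<in>S. \<bar>\<delta> w - P n \<delta> w\<bar> \<le> C1 * \<bar>\<eta> n\<bar>"
    and approx: "0 \<le> C2" "\<And>n. 0 \<le> \<rho> n" "\<forall>\<^sub>F n in sequentially. \<forall>\<delta>\<in>\<Delta>. near_span n \<delta> (C2 * \<rho> n)"
    and x: "\<forall>\<^sub>F n in sequentially. AE \<omega> in M. (\<Sum>j<k n. (\<phi> j (X \<omega>, Y \<omega>))\<^sup>2) \<le> x n"
      "(\<lambda>n. x n * real (k n) / real n) \<longlonglongrightarrow> 0"
    and rate: "\<And>C'. \<forall>\<^sub>F n in sequentially. C' * (real (k n) / real n + (\<rho> n)\<^sup>2 + (\<eta> n)\<^sup>2) \<le> c n"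
      "c \<longlonglongrightarrow> 0" "\<eta> \<longlonglongrightarrow> 0"
  shows "oP_one M (\<lambda>n \<omega>. hausdorff_dist (sup_norm S) (\<Delta>hat n \<omega>) \<Delta>\<^sub>0) \<and>
    OP M (\<lambda>n \<omega>. hausdorff_dist (weak_norm M R X Y Z) (\<Delta>hat n \<omega>) \<Delta>\<^sub>0) (\<lambda>n. sqrt (c n))"
proof -
  have zero: "\<delta> \<in> \<Delta>\<^sub>0 \<longleftrightarrow> \<delta> \<in> \<Delta> \<and> wsq \<delta> = 0" for \<delta>
    using wsq_zero_iff[of \<delta>] by (auto simp: Delta0)
  have key: "\<exists>D>0. \<forall>\<^sub>F n in sequentially. \<exists>Bad\<in>sets M. emeasure M Bad \<le> ennreal \<epsilon> \<and>
      (\<forall>\<omega>\<in>space M - Bad. (\<forall>\<delta>\<in>\<Delta>\<^sub>0. P n \<delta> \<in> \<Delta>hat n \<omega>) \<and> (\<forall>\<delta>\<in>\<Delta>hat n \<omega>. wsq \<delta> \<le> D * c n))"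
    if \<epsilon>: "0 < \<epsilon>" for \<epsilon>
  proof -
    have e2: "0 < \<epsilon> / 2" using \<epsilon> by simp
    obtain D where D: "0 < D" and cmp: "\<forall>n x. 0 < n \<longrightarrow> (AE \<omega> in M. (\<Sum>j<k n. (\<phi> j (X \<omega>, Y \<omega>))\<^sup>2) \<le> x) \<longrightarrow>
      4 * u / l\<^sup>2 * (x * real (k n) / real n) \<le> \<epsilon> / 2 \<longrightarrow>
      (\<exists>Bad\<in>sets M. emeasure M Bad \<le> ennreal (2 * (\<epsilon> / 2)) \<and> (\<forall>\<omega>\<in>space M - Bad. comparable D n \<omega>))"
      using criterion_comparable[OF e2] by (elim exE conjE) (rule that)
    have "(\<lambda>n. 4 * u / l\<^sup>2 * (x n * real (k n) / real n)) \<longlonglongrightarrow> 4 * u / l\<^sup>2 * 0"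
      by (intro tendsto_mult tendsto_const x(2))
    then have "\<forall>\<^sub>F n in sequentially. 4 * u / l\<^sup>2 * (x n * real (k n) / real n) < \<epsilon> / 2"
      using e2 by (intro order_tendstoD(2)) auto
    moreover have "\<forall>\<^sub>F n in sequentially. 0 < n" by (rule eventually_gt_at_top)
    ultimately have "\<forall>\<^sub>F n in sequentially. \<exists>Bad\<in>sets M. emeasure M Bad \<le> ennreal \<epsilon> \<and>
      (\<forall>\<omega>\<in>space M - Bad. (\<forall>\<delta>\<in>\<Delta>\<^sub>0. P n \<delta> \<in> \<Delta>hat n \<omega>) \<and> (\<forall>\<delta>\<in>\<Delta>hat n \<omega>. wsq \<delta> \<le> D * (2 + C2\<^sup>2) * c n))"
      using x(1) sieve(2) approx(3) rate(1)[of "D * (1 + 2 * C1\<^sup>2)"] rate(1)[of 1]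
    proof eventually_elim
      fix n
      assume small: "4 * u / l\<^sup>2 * (x n * real (k n) / real n) < \<epsilon> / 2" and n: "0 < n"
        and xn: "AE \<omega> in M. (\<Sum>j<k n. (\<phi> j (X \<omega>, Y \<omega>))\<^sup>2) \<le> x n"
        and sv: "\<forall>\<delta>\<in>\<Delta>. \<forall>w\<in>S. \<bar>\<delta> w - P n \<delta> w\<bar> \<le> C1 * \<bar>\<eta> n\<bar>"
        and ap: "\<forall>\<delta>\<in>\<Delta>. near_span n \<delta> (C2 * \<rho> n)"
        and c1: "D * (1 + 2 * C1\<^sup>2) * (real (k n) / real n + (\<rho> n)\<^sup>2 + (\<eta> n)\<^sup>2) \<le> c n"
        and c2: "1 * (real (k n) / real n + (\<rho> n)\<^sup>2 + (\<eta> n)\<^sup>2) \<le> c n"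
      define kn where "kn = real (k n) / real n"
      have kn: "0 \<le> kn" by (simp add: kn_def)
      obtain Bad where Bad: "Bad \<in> sets M" "emeasure M Bad \<le> ennreal (2 * (\<epsilon> / 2))"
        and cmp': "\<forall>\<omega>\<in>space M - Bad. comparable D n \<omega>"
        using cmp[rule_format, OF n xn less_imp_le[OF small]] by (elim bexE conjE) (rule that)
      have good: "crit n \<omega> \<delta> \<le> D * (wsq \<delta> + kn)"
          "\<And>r. 0 \<le> r \<Longrightarrow> near_span n \<delta> r \<Longrightarrow> wsq \<delta> \<le> D * (crit n \<omega> \<delta> + kn + r\<^sup>2)"
        if "\<omega> \<in> space M - Bad" "\<delta> \<in> \<Delta>" for \<omega> \<delta>
        using bspec[OF cmp' that(1)] that(2) by (auto simp: comparable_def kn_def)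
      show "\<exists>Bad\<in>sets M. emeasure M Bad \<le> ennreal \<epsilon> \<and>
        (\<forall>\<omega>\<in>space M - Bad. (\<forall>\<delta>\<in>\<Delta>\<^sub>0. P n \<delta> \<in> \<Delta>hat n \<omega>) \<and> (\<forall>\<delta>\<in>\<Delta>hat n \<omega>. wsq \<delta> \<le> D * (2 + C2\<^sup>2) * c n))"
      proof (intro bexI[OF _ Bad(1)] conjI ballI)
        show "emeasure M Bad \<le> ennreal \<epsilon>" using Bad(2) by simp
        fix \<omega> assume \<omega>: "\<omega> \<in> space M - Bad"
        show "P n \<delta> \<in> \<Delta>hat n \<omega>" if \<delta>: "\<delta> \<in> \<Delta>\<^sub>0" for \<delta>
        proof -
          have \<delta>': "\<delta> \<in> \<Delta>" "wsq \<delta> = 0" using \<delta> zero by auto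
          have P\<Delta>: "P n \<delta> \<in> \<Delta>" using P[OF \<delta>'(1)] Deltas by blast
          define Q where "Q = crit n \<omega> (P n \<delta>)"
          have "wsq (P n \<delta>) \<le> 2 * wsq \<delta> + 2 * (C1 * \<bar>\<eta> n\<bar>)\<^sup>2"
            using sv \<delta>' sieve(1) by (intro wsq_close P\<Delta>) auto
          then have w: "wsq (P n \<delta>) \<le> 2 * C1\<^sup>2 * (\<eta> n)\<^sup>2" using \<delta>' by (simp add: power_mult_distrib)
          have "Q \<le> D * (wsq (P n \<delta>) + kn)" using good(1)[OF \<omega> P\<Delta>] by (simp add: Q_def)
          also have "\<dots> \<le> D * ((1 + 2 * C1\<^sup>2) * (kn + (\<rho> n)\<^sup>2 + (\<eta> n)\<^sup>2))"
          proof (rule mult_left_mono)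
            have "0 \<le> 2 * C1\<^sup>2 * kn + (1 + 2 * C1\<^sup>2) * (\<rho> n)\<^sup>2 + (\<eta> n)\<^sup>2"
              using kn by (intro add_nonneg_nonneg mult_nonneg_nonneg) auto
            then show "wsq (P n \<delta>) + kn \<le> (1 + 2 * C1\<^sup>2) * (kn + (\<rho> n)\<^sup>2 + (\<eta> n)\<^sup>2)"
              using w by (simp add: algebra_simps)
          qed (use D in simp)
          also have "\<dots> \<le> c n" using c1 by (simp add: kn_def mult.assoc)
          finally show ?thesis using P[OF \<delta>'(1), of n] by (simp add: Deltahat Q_def)
        qed
        show "wsq \<delta> \<le> D * (2 + C2\<^sup>2) * c n" if \<delta>: "\<delta> \<in> \<Delta>hat n \<omega>" for \<delta>
        proof -
          have \<delta>': "\<delta> \<in> \<Delta>" using \<delta> Deltas by (auto simp: Deltahat)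
          define Q where "Q = crit n \<omega> \<delta>"
          have Qc: "Q \<le> c n" using \<delta> by (simp add: Deltahat Q_def)
          have "wsq \<delta> \<le> D * (Q + kn + (C2 * \<rho> n)\<^sup>2)"
            unfolding Q_def using approx ap \<delta>' by (intro good(2)[OF \<omega> \<delta>']) auto
          also have "\<dots> \<le> D * ((2 + C2\<^sup>2) * c n)"
          proof (rule mult_left_mono)
            have cn: "kn \<le> c n \<and> (\<rho> n)\<^sup>2 \<le> c n"
              using c2[unfolded mult_1] kn zero_le_power2[of "\<rho> n"] zero_le_power2[of "\<eta> n"] unfolding kn_def[symmetric] by (intro conjI) linarith+
            have "C2\<^sup>2 * (\<rho> n)\<^sup>2 \<le> C2\<^sup>2 * c n" using cn by (intro mult_left_mono) auto
            then show "Q + kn + (C2 * \<rho> n)\<^sup>2 \<le> (2 + C2\<^sup>2) * c n"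
              using Qc cn by (simp add: power_mult_distrib distrib_right)
          qed (use D in simp)
          finally show ?thesis by (simp add: mult.assoc)
        qed
      qed
    qed
    moreover have "0 < D * (2 + C2\<^sup>2)" using D by (intro mult_pos_pos add_pos_nonneg) auto
    ultimately show ?thesis by blast
  qed
  have "oP_one M (\<lambda>n \<omega>. hausdorff_dist (sup_norm S) (\<Delta>hat n \<omega>) \<Delta>\<^sub>0)"
    unfolding oP_one_def
  proof (intro allI impI tendsto_0_ennrealI)
    fix \<epsilon> e :: real assume \<epsilon>: "0 < \<epsilon>" and e: "0 < e"
    obtain D where D: "0 < D" and ev: "\<forall>\<^sub>F n in sequentially. \<exists>Bad\<in>sets M. emeasure M Bad \<le> ennreal e \<and>
      (\<forall>\<omega>\<in>space M - Bad. (\<forall>\<delta>\<in>\<Delta>\<^sub>0. P n \<delta> \<in> \<Delta>hat n \<omega>) \<and> (\<forall>\<delta>\<in>\<Delta>hat n \<omega>. wsq \<delta> \<le> D * c n))"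
      using key[OF e] by blast
    have "\<exists>\<kappa>>0. \<forall>\<delta>\<in>\<Delta>. wsq \<delta> < \<kappa> \<longrightarrow> (\<exists>\<delta>'\<in>\<Delta>. wsq \<delta>' = 0 \<and> (\<forall>x\<in>S. \<bar>\<delta> x - \<delta>' x\<bar> \<le> \<epsilon>))"
    proof (rule well_separated_zeros[where K = K and L = L, OF S _ _ _ _ \<epsilon>])
      show "\<bar>\<delta> w\<bar> \<le> K" if "\<delta> \<in> \<Delta>" "w \<in> S" for \<delta> w using that by (rule Delta_bdd)
      show "\<bar>\<delta> w - \<delta> w'\<bar> \<le> L * norm (w - w')" if "\<delta> \<in> \<Delta>" "w \<in> S" "w' \<in> S" for \<delta> w w'
        using that by (rule lip)
      show "0 \<le> wsq \<delta>" for \<delta> by (rule wsq_nonneg)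
      show "wsq \<delta>' \<le> 2 * wsq \<delta> + 2 * e\<^sup>2"
        if "\<delta> \<in> \<Delta>" "\<delta>' \<in> \<Delta>" "0 \<le> e" "\<And>w. w \<in> S \<Longrightarrow> \<bar>\<delta> w - \<delta>' w\<bar> \<le> e" for \<delta> \<delta>' e
        using that by (rule wsq_close)
    qed
    then obtain \<kappa> where \<kappa>: "0 < \<kappa>" "\<And>\<delta>. \<delta> \<in> \<Delta> \<Longrightarrow> wsq \<delta> < \<kappa> \<Longrightarrow> \<exists>\<delta>'\<in>\<Delta>. wsq \<delta>' = 0 \<and> (\<forall>x\<in>S. \<bar>\<delta> x - \<delta>' x\<bar> \<le> \<epsilon>)"
      by blast
    have "(\<lambda>n. D * c n) \<longlonglongrightarrow> D * 0" by (intro tendsto_mult tendsto_const rate(2))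
    then have "\<forall>\<^sub>F n in sequentially. D * c n < \<kappa>" using \<kappa>(1) by (intro order_tendstoD(2)) auto
    moreover have "(\<lambda>n. C1 * \<bar>\<eta> n\<bar>) \<longlonglongrightarrow> C1 * \<bar>0\<bar>" by (intro tendsto_mult tendsto_const tendsto_rabs rate(3))
    then have "\<forall>\<^sub>F n in sequentially. C1 * \<bar>\<eta> n\<bar> < \<epsilon>" using \<epsilon> by (intro order_tendstoD(2)) auto
    ultimately show "\<forall>\<^sub>F n in sequentially. outer_measure_of M
      {\<omega> \<in> space M. ennreal \<epsilon> < hausdorff_dist (sup_norm S) (\<Delta>hat n \<omega>) \<Delta>\<^sub>0} \<le> ennreal e"
      using ev sieve(2)
    proof eventually_elim
      fix n assume dc: "D * c n < \<kappa>" and ce: "C1 * \<bar>\<eta> n\<bar> < \<epsilon>"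
        and "\<exists>Bad\<in>sets M. emeasure M Bad \<le> ennreal e \<and>
          (\<forall>\<omega>\<in>space M - Bad. (\<forall>\<delta>\<in>\<Delta>\<^sub>0. P n \<delta> \<in> \<Delta>hat n \<omega>) \<and> (\<forall>\<delta>\<in>\<Delta>hat n \<omega>. wsq \<delta> \<le> D * c n))"
        and sv: "\<forall>\<delta>\<in>\<Delta>. \<forall>w\<in>S. \<bar>\<delta> w - P n \<delta> w\<bar> \<le> C1 * \<bar>\<eta> n\<bar>"
      then obtain Bad where Bad: "Bad \<in> sets M" "emeasure M Bad \<le> ennreal e"
        and good: "\<And>\<omega> \<delta>. \<omega> \<in> space M - Bad \<Longrightarrow> \<delta> \<in> \<Delta>\<^sub>0 \<Longrightarrow> P n \<delta> \<in> \<Delta>hat n \<omega>"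
          "\<And>\<omega> \<delta>. \<omega> \<in> space M - Bad \<Longrightarrow> \<delta> \<in> \<Delta>hat n \<omega> \<Longrightarrow> wsq \<delta> \<le> D * c n" by blast
      show "outer_measure_of M {\<omega> \<in> space M. ennreal \<epsilon> < hausdorff_dist (sup_norm S) (\<Delta>hat n \<omega>) \<Delta>\<^sub>0} \<le> ennreal e"
      proof (rule outer_measure_exceeds_le[OF Bad])
        fix \<omega> assume \<omega>: "\<omega> \<in> space M - Bad"
        have "hausdorff_semidist (sup_norm S) (\<Delta>hat n \<omega>) \<Delta>\<^sub>0 \<le> ennreal \<epsilon>"
        proof (rule hausdorff_semidist_le)
          fix \<delta> assume \<delta>: "\<delta> \<in> \<Delta>hat n \<omega>"
          then have "\<delta> \<in> \<Delta>" "wsq \<delta> < \<kappa>" using Deltas good(2)[OF \<omega> \<delta>] dc by (auto simp: Deltahat)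
          then obtain \<delta>' where "\<delta>' \<in> \<Delta>\<^sub>0" "\<forall>x\<in>S. \<bar>\<delta> x - \<delta>' x\<bar> \<le> \<epsilon>" using \<kappa>(2) zero by blast
          then show "\<exists>g\<in>\<Delta>\<^sub>0. sup_norm S (\<lambda>w. \<delta> w - g w) \<le> ennreal \<epsilon>" by (intro bexI[of _ \<delta>'] sup_norm_le) auto
        qed
        moreover have "hausdorff_semidist (sup_norm S) \<Delta>\<^sub>0 (\<Delta>hat n \<omega>) \<le> ennreal \<epsilon>"
        proof (rule hausdorff_semidist_le)
          fix \<delta> assume \<delta>: "\<delta> \<in> \<Delta>\<^sub>0"
          then have "\<delta> \<in> \<Delta>" using zero by blast
          then have "\<bar>\<delta> w - P n \<delta> w\<bar> \<le> \<epsilon>" if "w \<in> S" for w using sv ce that by force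
          then show "\<exists>g\<in>\<Delta>hat n \<omega>. sup_norm S (\<lambda>w. \<delta> w - g w) \<le> ennreal \<epsilon>"
            using good(1)[OF \<omega> \<delta>] by (intro bexI[of _ "P n \<delta>"] sup_norm_le) auto
        qed
        ultimately show "hausdorff_dist (sup_norm S) (\<Delta>hat n \<omega>) \<Delta>\<^sub>0 \<le> ennreal \<epsilon>"
          by (simp add: hausdorff_dist_def)
      qed
    qed
  qed
  moreover have "OP M (\<lambda>n \<omega>. hausdorff_dist (weak_norm M R X Y Z) (\<Delta>hat n \<omega>) \<Delta>\<^sub>0) (\<lambda>n. sqrt (c n))"
    unfolding OP_def
  proof (intro allI impI)
    fix e :: real assume e: "0 < e"
    obtain D where D: "0 < D" and ev: "\<forall>\<^sub>F n in sequentially. \<exists>Bad\<in>sets M. emeasure M Bad \<le> ennreal e \<and>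
      (\<forall>\<omega>\<in>space M - Bad. (\<forall>\<delta>\<in>\<Delta>\<^sub>0. P n \<delta> \<in> \<Delta>hat n \<omega>) \<and> (\<forall>\<delta>\<in>\<Delta>hat n \<omega>. wsq \<delta> \<le> D * c n))"
      using key[OF e] by blast
    define D' where "D' = D + 2 * C1\<^sup>2"
    have D': "0 < sqrt D'" "D \<le> D'" "2 * C1\<^sup>2 \<le> D'" using D by (auto simp: D'_def add_pos_nonneg)
    obtain \<delta>\<^sub>0 where \<delta>\<^sub>0: "\<delta>\<^sub>0 \<in> \<Delta>\<^sub>0" using Delta0(2) by blast
    have "\<forall>\<^sub>F n in sequentially. outer_measure_of M
        {\<omega> \<in> space M. ennreal (sqrt D' * \<bar>sqrt (c n)\<bar>) < hausdorff_dist (weak_norm M R X Y Z) (\<Delta>hat n \<omega>) \<Delta>\<^sub>0} \<le> ennreal e"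
      using ev sieve(2) rate(1)[of 1]
    proof eventually_elim
      fix n assume "\<exists>Bad\<in>sets M. emeasure M Bad \<le> ennreal e \<and>
          (\<forall>\<omega>\<in>space M - Bad. (\<forall>\<delta>\<in>\<Delta>\<^sub>0. P n \<delta> \<in> \<Delta>hat n \<omega>) \<and> (\<forall>\<delta>\<in>\<Delta>hat n \<omega>. wsq \<delta> \<le> D * c n))"
        and sv: "\<forall>\<delta>\<in>\<Delta>. \<forall>w\<in>S. \<bar>\<delta> w - P n \<delta> w\<bar> \<le> C1 * \<bar>\<eta> n\<bar>"
        and c2: "1 * (real (k n) / real n + (\<rho> n)\<^sup>2 + (\<eta> n)\<^sup>2) \<le> c n"
      then obtain Bad where Bad: "Bad \<in> sets M" "emeasure M Bad \<le> ennreal e"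
        and good: "\<And>\<omega> \<delta>. \<omega> \<in> space M - Bad \<Longrightarrow> \<delta> \<in> \<Delta>\<^sub>0 \<Longrightarrow> P n \<delta> \<in> \<Delta>hat n \<omega>"
          "\<And>\<omega> \<delta>. \<omega> \<in> space M - Bad \<Longrightarrow> \<delta> \<in> \<Delta>hat n \<omega> \<Longrightarrow> wsq \<delta> \<le> D * c n" by blast
      have "0 \<le> real (k n) / real n" by simp
      then have "0 \<le> c n \<and> (\<eta> n)\<^sup>2 \<le> c n"
        using c2[unfolded mult_1] zero_le_power2[of "\<rho> n"] zero_le_power2[of "\<eta> n"] by (intro conjI) linarith+
      then have c0: "0 \<le> c n" "(\<eta> n)\<^sup>2 \<le> c n" by auto
      have bound: "ennreal (sqrt w) \<le> ennreal (sqrt D' * \<bar>sqrt (c n)\<bar>)" if "w \<le> D' * c n" for w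
        using that c0 by (intro ennreal_leI) (simp add: real_sqrt_mult[symmetric])
      show "outer_measure_of M {\<omega> \<in> space M. ennreal (sqrt D' * \<bar>sqrt (c n)\<bar>)
          < hausdorff_dist (weak_norm M R X Y Z) (\<Delta>hat n \<omega>) \<Delta>\<^sub>0} \<le> ennreal e"
      proof (rule outer_measure_exceeds_le[OF Bad])
        fix \<omega> assume \<omega>: "\<omega> \<in> space M - Bad"
        have "hausdorff_semidist (weak_norm M R X Y Z) (\<Delta>hat n \<omega>) \<Delta>\<^sub>0 \<le> ennreal (sqrt D' * \<bar>sqrt (c n)\<bar>)"
        proof (rule hausdorff_semidist_le, rule bexI[OF _ \<delta>\<^sub>0])
          fix \<delta> assume \<delta>: "\<delta> \<in> \<Delta>hat n \<omega>"
          then have "\<delta> \<in> \<Delta>" using Deltas by (auto simp: Deltahat)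
          have "wsq \<delta> \<le> D' * c n"
            using good(2)[OF \<omega> \<delta>] mult_right_mono[OF D'(2) c0(1)] by linarith
          then show "weak_norm M R X Y Z (\<lambda>w. \<delta> w - \<delta>\<^sub>0 w) \<le> ennreal (sqrt D' * \<bar>sqrt (c n)\<bar>)"
            using \<delta>\<^sub>0 \<open>\<delta> \<in> \<Delta>\<close> by (subst weak_norm_from_zero(1)) (auto simp: Delta0 intro: bound)
        qed
        moreover have "hausdorff_semidist (weak_norm M R X Y Z) \<Delta>\<^sub>0 (\<Delta>hat n \<omega>) \<le> ennreal (sqrt D' * \<bar>sqrt (c n)\<bar>)"
        proof (rule hausdorff_semidist_le)
          fix \<delta> assume \<delta>: "\<delta> \<in> \<Delta>\<^sub>0"
          then have \<delta>': "\<delta> \<in> \<Delta>" "wsq \<delta> = 0" using zero by auto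
          have P\<Delta>: "P n \<delta> \<in> \<Delta>" using P[OF \<delta>'(1)] Deltas by blast
          have "wsq (P n \<delta>) \<le> 2 * wsq \<delta> + 2 * (C1 * \<bar>\<eta> n\<bar>)\<^sup>2"
            using sv \<delta>' sieve(1) by (intro wsq_close P\<Delta>) auto
          also have "\<dots> = 2 * C1\<^sup>2 * (\<eta> n)\<^sup>2" using \<delta>' by (simp add: power_mult_distrib)
          also have "\<dots> \<le> D' * c n" using D' c0 by (intro mult_mono) auto
          finally have "weak_norm M R X Y Z (\<lambda>w. \<delta> w - P n \<delta> w) \<le> ennreal (sqrt D' * \<bar>sqrt (c n)\<bar>)"
            using \<delta> by (subst weak_norm_from_zero(2)[OF P\<Delta>]) (auto simp: Delta0 intro: bound)
          then show "\<exists>g\<in>\<Delta>hat n \<omega>. weak_norm M R X Y Z (\<lambda>w. \<delta> w - g w) \<le> ennreal (sqrt D' * \<bar>sqrt (c n)\<bar>)"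
            using good(1)[OF \<omega> \<delta>] by blast
        qed
        ultimately show "hausdorff_dist (weak_norm M R X Y Z) (\<Delta>hat n \<omega>) \<Delta>\<^sub>0 \<le> ennreal (sqrt D' * \<bar>sqrt (c n)\<bar>)"
          by (simp add: hausdorff_dist_def)
      qed
    qed
    then show "\<exists>C>0. \<forall>\<^sub>F n in sequentially. outer_measure_of M
        {\<omega> \<in> space M. ennreal (C * \<bar>sqrt (c n)\<bar>) < hausdorff_dist (weak_norm M R X Y Z) (\<Delta>hat n \<omega>) \<Delta>\<^sub>0} \<le> ennreal e"
      using D'(1) by blast
  qed
  ultimately show ?thesis by blast
qed

end

section \<open>Smoothness classes and rates under the stated conditions\<close>

text \<open>The norm is an infimum over extensions to the convex hull, so for a constant above the supremum every \<open>\<delta>\<close> has an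
extension that satisfies the bound.\<close>

lemma sup_smooth_norm_finite:
  assumes "(SUP \<delta>\<in>\<Delta>. smooth_norm S \<alpha> \<delta>) < \<infinity>"
  shows "\<exists>K\<ge>0. \<forall>\<delta>\<in>\<Delta>.
    \<exists>D. partial_derivs_on (convex hull S) (lower_int \<alpha>) D \<and> (\<forall>w\<in>S. D (\<lambda>_. 0) w = \<delta> w) \<and>
      derivs_norm (convex hull S) \<alpha> D \<le> ennreal K"
proof -
  obtain r where r: "0 \<le> r" "(SUP \<delta>\<in>\<Delta>. smooth_norm S \<alpha> \<delta>) = ennreal r"
    using assms by (cases "SUP \<delta>\<in>\<Delta>. smooth_norm S \<alpha> \<delta>") auto
  show ?thesis
  proof (intro exI[of _ "r + 1"] conjI ballI)
    fix \<delta> assume "\<delta> \<in> \<Delta>"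
    then have "smooth_norm S \<alpha> \<delta> \<le> ennreal r" unfolding r(2)[symmetric] by (rule SUP_upper)
    also have "\<dots> < ennreal (r + 1)" using r(1) by (simp add: ennreal_less_iff)
    finally show "\<exists>D. partial_derivs_on (convex hull S) (lower_int \<alpha>) D \<and> (\<forall>w\<in>S. D (\<lambda>_. 0) w = \<delta> w) \<and>
      derivs_norm (convex hull S) \<alpha> D \<le> ennreal (r + 1)"
      unfolding smooth_norm_def INF_less_iff by (auto intro: less_imp_le)
  qed (use r in simp)
qed

lemma convex_hull_box_times_compact:
  fixes A :: "real set" and a b :: "'a::euclidean_space"
  assumes "compact A" "A \<noteq> {}" "cbox a b \<noteq> {}"
  obtains c d where "convex hull (cbox a b \<times> A) = cbox (a, c) (b, d)" "cbox (a, c) (b, d) \<noteq> {}"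
proof -
  have "compact (convex hull A)" "is_interval (convex hull A)"
    using assms by (auto simp: compact_convex_hull is_interval_convex_1)
  then obtain c d where cd: "convex hull A = cbox c d" using is_interval_compact by metis
  have "convex hull (cbox a b \<times> A) = cbox (a, c) (b, d)"
    by (simp add: convex_hull_Times cd cbox_Pair_eq convex_hull_eq[THEN iffD2])
  moreover have "cbox (a, c) (b, d) \<noteq> {}"
  proof -
    have "cbox c d \<noteq> {}" using assms(2) unfolding cd[symmetric] by simp
    then show ?thesis using assms(3) by (simp add: cbox_Pair_eq del: cbox_interval)
  qed
  ultimately show ?thesis by (rule that)
qed

lemma ennreal_bigo_sup_norm:
  assumes "ennreal_bigo (\<lambda>n. SUP \<delta>\<in>\<Delta>. sup_norm S (f n \<delta>)) r"
  obtains C where "0 < C" "\<forall>\<^sub>F n in sequentially. \<forall>\<delta>\<in>\<Delta>. \<forall>w\<in>S. \<bar>f n \<delta> w\<bar> \<le> C * \<bar>r n\<bar>"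
proof -
  obtain C where C: "0 < C" "\<forall>\<^sub>F n in sequentially. (SUP \<delta>\<in>\<Delta>. sup_norm S (f n \<delta>)) \<le> ennreal (C * \<bar>r n\<bar>)"
    using assms by (auto simp: ennreal_bigo_def)
  from C(2) have "\<forall>\<^sub>F n in sequentially. \<forall>\<delta>\<in>\<Delta>. \<forall>w\<in>S. \<bar>f n \<delta> w\<bar> \<le> C * \<bar>r n\<bar>"
  proof eventually_elim
    fix n assume le: "(SUP \<delta>\<in>\<Delta>. sup_norm S (f n \<delta>)) \<le> ennreal (C * \<bar>r n\<bar>)"
    show "\<forall>\<delta>\<in>\<Delta>. \<forall>w\<in>S. \<bar>f n \<delta> w\<bar> \<le> C * \<bar>r n\<bar>"
    proof (intro ballI)
      fix \<delta> w assume "\<delta> \<in> \<Delta>" "w \<in> S"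
      then have "ennreal \<bar>f n \<delta> w\<bar> \<le> (SUP \<delta>\<in>\<Delta>. sup_norm S (f n \<delta>))"
        unfolding sup_norm_def by (intro SUP_upper2[of \<delta>] SUP_upper2[of w]) auto
      then have "ennreal \<bar>f n \<delta> w\<bar> \<le> ennreal (C * \<bar>r n\<bar>)" using le by (rule order_trans)
      then show "\<bar>f n \<delta> w\<bar> \<le> C * \<bar>r n\<bar>" using C(1) by (subst (asm) ennreal_le_iff) auto
    qed
  qed
  with C(1) show ?thesis by (rule that)
qed

lemma borel_measurable_of_lipschitz_extensional:
  fixes f :: "'a::euclidean_space \<Rightarrow> real"
  assumes "closed S" "f \<in> extensional S" "\<And>w w'. w \<in> S \<Longrightarrow> w' \<in> S \<Longrightarrow> \<bar>f w - f w'\<bar> \<le> L * norm (w - w')"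
  shows "f \<in> borel_measurable borel"
proof -
  have "continuous_on S f"
    unfolding continuous_on_iff dist_real_def dist_norm
  proof (intro ballI allI impI)
    fix x e assume x: "x \<in> S" and e: "(0::real) < e"
    show "\<exists>d>0. \<forall>x'\<in>S. norm (x' - x) < d \<longrightarrow> \<bar>f x' - f x\<bar> < e"
    proof (intro exI conjI ballI impI)
      show "0 < e / (\<bar>L\<bar> + 1)" using e by simp
      fix x' assume x': "x' \<in> S" and lt: "norm (x' - x) < e / (\<bar>L\<bar> + 1)"
      have "\<bar>f x' - f x\<bar> \<le> L * norm (x' - x)" using x x' assms(3) by blast
      also have "\<dots> \<le> (\<bar>L\<bar> + 1) * norm (x' - x)" by (intro mult_right_mono) auto
      also have "\<dots> < e"
      proof -
        have "0 < \<bar>L\<bar> + 1" by simp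
        with lt show ?thesis by (simp only: pos_less_divide_eq mult.commute)
      qed
      finally show "\<bar>f x' - f x\<bar> < e" .
    qed
  qed
  then have "(\<lambda>x. if x \<in> S then f x else undefined) \<in> borel_measurable borel"
    using assms(1) by (intro borel_measurable_continuous_on_if borel_closed) auto
  moreover have "(\<lambda>x. if x \<in> S then f x else undefined) = f"
    using assms(2) by (auto simp: extensional_def)
  ultimately show ?thesis by simp
qed

text \<open>\<open>c n / lam n = b n / (a n * lam n)\<close>, where the denominator is bounded and \<open>b\<close> diverges.\<close>

lemma rate_dominates:
  fixes a b c lam :: "nat \<Rightarrow> real"
  assumes pos: "\<And>n. 0 < a n" "\<And>n. 0 < b n" and lam: "\<And>n. 0 < lam n" and a: "a \<in> O(\<lambda>n. inverse (lam n))"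
    and b: "filterlim b at_top sequentially" "b \<in> o(a)" and c: "\<And>n. c n = b n / a n"
  shows "\<forall>\<^sub>F n in sequentially. C * lam n \<le> c n" and "c \<longlonglongrightarrow> 0"
proof -
  obtain C' where C': "0 < C'" "\<forall>\<^sub>F n in sequentially. norm (a n) \<le> C' * norm (inverse (lam n))"
    using a by (auto elim: landau_o.bigE)
  have "\<forall>\<^sub>F n in sequentially. C' * \<bar>C\<bar> \<le> b n" using b(1) by (simp add: filterlim_at_top)
  with C'(2) show "\<forall>\<^sub>F n in sequentially. C * lam n \<le> c n"
  proof eventually_elim
    fix n assume 1: "norm (a n) \<le> C' * norm (inverse (lam n))" and 2: "C' * \<bar>C\<bar> \<le> b n"
    have "a n \<le> C' / lam n" using 1 pos(1)[of n] lam[of n] by (simp add: divide_inverse)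
    then have "a n * lam n \<le> C'" using lam[of n] by (simp add: pos_le_divide_eq)
    then have "\<bar>C\<bar> * (a n * lam n) \<le> \<bar>C\<bar> * C'" by (intro mult_left_mono) auto
    moreover have "C * (a n * lam n) \<le> \<bar>C\<bar> * (a n * lam n)"
      using pos(1)[of n] lam[of n] by (intro mult_right_mono) auto
    ultimately have "C * lam n * a n \<le> b n" using 2 by (simp add: mult_ac)
    then show "C * lam n \<le> c n" using pos(1)[of n] by (simp add: c pos_le_divide_eq)
  qed
  have "c = (\<lambda>n. b n / a n)" using c by auto
  then show "c \<longlonglongrightarrow> 0" using smalloD_tendsto[OF b(2)] by simp
qed

text \<open>Since \<open>k n\<close> is positive, an infinite \<open>\<xi> n\<close> would make the ratio infinite.\<close>

lemma squared_ratio_eventually_finite: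
  fixes \<xi> :: "nat \<Rightarrow> ennreal" and k :: "nat \<Rightarrow> nat"
  assumes lim: "(\<lambda>n. (\<xi> n)\<^sup>2 * of_nat (k n) / of_nat n) \<longlonglongrightarrow> 0" and k: "\<And>n. 1 \<le> k n"
  shows "\<forall>\<^sub>F n in sequentially. \<xi> n < \<infinity>" and "(\<lambda>n. (enn2real (\<xi> n))\<^sup>2 * real (k n) / real n) \<longlonglongrightarrow> 0"
proof -
  have "\<forall>\<^sub>F n in sequentially. (\<xi> n)\<^sup>2 * of_nat (k n) / of_nat n < 1"
    using lim by (rule order_tendstoD) simp
  then show fin: "\<forall>\<^sub>F n in sequentially. \<xi> n < \<infinity>"
  proof eventually_elim
    fix n assume lt: "(\<xi> n)\<^sup>2 * of_nat (k n) / of_nat n < 1"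
    show "\<xi> n < \<infinity>"
    proof (rule ccontr)
      assume "\<not> \<xi> n < \<infinity>"
      then have "\<xi> n = \<infinity>" by (simp add: less_top[symmetric])
      moreover have "k n \<noteq> 0" using k[of n] by simp
      ultimately have "(\<xi> n)\<^sup>2 * of_nat (k n) = \<infinity>" by (simp add: power2_eq_square ennreal_top_mult ennreal_mult_top)
      then show False using lt by (simp add: ennreal_top_divide)
    qed
  qed
  define f where "f n = (enn2real (\<xi> n))\<^sup>2 * real (k n) / real n" for n
  have "\<forall>\<^sub>F n in sequentially. (\<xi> n)\<^sup>2 * of_nat (k n) / of_nat n = ennreal (f n)"
    using fin eventually_gt_at_top[of 0]
  proof eventually_elim
    fix n :: nat assume "\<xi> n < \<infinity>" "0 < n"
    then obtain r where "0 \<le> r" "\<xi> n = ennreal r" by (cases "\<xi> n") auto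
    then show "(\<xi> n)\<^sup>2 * of_nat (k n) / of_nat n = ennreal (f n)"
      using \<open>0 < n\<close>
      by (simp add: f_def ennreal_power ennreal_of_nat_eq_real_of_nat ennreal_mult[symmetric] divide_ennreal)
  qed
  then have "(\<lambda>n. ennreal (f n)) \<longlonglongrightarrow> 0" using lim by (rule Lim_transform_eventually[rotated])
  then have "f \<longlonglongrightarrow> 0" by (subst (asm) ennreal_tendsto_0_iff) (simp_all add: f_def)
  then show "(\<lambda>n. (enn2real (\<xi> n))\<^sup>2 * real (k n) / real n) \<longlonglongrightarrow> 0" by (simp add: f_def[abs_def])
qed

theorem theorem2:
  fixes M :: "'s measure"
    and R Y Z :: "'s \<Rightarrow> real" and X :: "'s \<Rightarrow> real ^ 'd"
    and Rs Ys Zs :: "nat \<Rightarrow> 's \<Rightarrow> real" and Xs :: "nat \<Rightarrow> 's \<Rightarrow> real ^ 'd"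
    and S :: "((real ^ 'd) \<times> real) set" and T :: "((real ^ 'd) \<times> real) set"
    and \<tau> :: "(real ^ 'd) \<times> real \<Rightarrow> real"
    and \<Delta> \<Delta>\<^sub>0 :: "((real ^ 'd) \<times> real \<Rightarrow> real) set"
    and \<Delta>s :: "nat \<Rightarrow> ((real ^ 'd) \<times> real \<Rightarrow> real) set"
    and \<Delta>hat :: "nat \<Rightarrow> 's \<Rightarrow> ((real ^ 'd) \<times> real \<Rightarrow> real) set"
    and \<psi> \<phi> :: "nat \<Rightarrow> (real ^ 'd) \<times> real \<Rightarrow> real"
    and q k :: "nat \<Rightarrow> nat"
    and P :: "nat \<Rightarrow> ((real ^ 'd) \<times> real \<Rightarrow> real) \<Rightarrow> (real ^ 'd) \<times> real \<Rightarrow> real"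
    and m :: "((real ^ 'd) \<times> real \<Rightarrow> real) \<Rightarrow> (real ^ 'd) \<times> real \<Rightarrow> real"
    and \<pi> :: "nat \<Rightarrow> ((real ^ 'd) \<times> real \<Rightarrow> real) \<Rightarrow> real Matrix.vec"
    and \<alpha> :: real and \<eta> a b c lam :: "nat \<Rightarrow> real" and \<xi> :: "nat \<Rightarrow> ennreal"
  assumes prob: "prob_space M"
    and meas: "R \<in> borel_measurable M" "X \<in> borel_measurable M"
      "Y \<in> borel_measurable M" "Z \<in> borel_measurable M"
    and R01: "\<And>\<omega>. \<omega> \<in> space M \<Longrightarrow> R \<omega> \<in> {0, 1}"
    and indep: "prob_space.indep_vars M (\<lambda>_. borel)
      (\<lambda>i \<omega>. (Rs i \<omega>, Xs i \<omega>, Ys i \<omega>, Zs i \<omega>)) UNIV"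
    and ident: "\<And>i. distr M borel (\<lambda>\<omega>. (Rs i \<omega>, Xs i \<omega>, Ys i \<omega>, Zs i \<omega>)) =
      distr M borel (\<lambda>\<omega>. (R \<omega>, X \<omega>, Y \<omega>, Z \<omega>))"
    and tau_meas: "\<tau> \<in> borel_measurable borel"
    and phi_meas: "\<And>j. \<phi> j \<in> borel_measurable borel"
    and k_pos: "\<And>n. 1 \<le> k n"
    and S_eq: "S = cbox 0 1 \<times> msupport (distr M borel Z)"
    and T_eq: "T = msupport (distr M borel (\<lambda>\<omega>. (X \<omega>, Y \<omega>)))"
    and Delta_dom: "\<Delta> \<subseteq> extensional S"
    and Delta0_eq: "\<Delta>\<^sub>0 = {\<delta>\<in>\<Delta>. is_regression M R X Y (\<lambda>\<omega>. \<delta> (X \<omega>, Z \<omega>)) \<tau>}"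
    and Deltan_eq: "\<And>n. \<Delta>s n = sieve S \<Delta> \<psi> (q n)"
    and A3: "msupport (distr M borel X) = cbox 0 1"
      "compact (msupport (distr M borel Y))" "compact (msupport (distr M borel Z))"
    and A4_i: "\<alpha> > (real CARD('d) + 1) / 2" "(SUP \<delta>\<in>\<Delta>. smooth_norm S \<alpha> \<delta>) < \<infinity>"
      "\<Delta>\<^sub>0 \<noteq> {}" "sup_closed S \<Delta>" "\<And>n. sup_closed S (\<Delta>s n)"
    and A4_ii: "\<And>n \<delta>. \<delta> \<in> \<Delta> \<Longrightarrow> P n \<delta> \<in> \<Delta>s n"
      "ennreal_bigo (\<lambda>n. SUP \<delta>\<in>\<Delta>. sup_norm S (\<lambda>w. \<delta> w - P n \<delta> w)) \<eta>"
      "\<eta> \<longlonglongrightarrow> 0"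
    and A5_i: "\<exists>l>0. \<exists>u. \<forall>n v. eigenvalue (gram_mat M R X Y \<phi> (k n)) v \<longrightarrow> l \<le> v \<and> v \<le> u"
    \<comment> \<open>\<open>m \<delta>\<close> is \<open>E(\<delta>(X,Z) | R = 1, X = x, Y = y)\<close> as a function of \<open>(x, y)\<close>\<close>
    and A5_ii: "\<And>\<delta>. \<delta> \<in> \<Delta> \<Longrightarrow> is_regression M R X Y (\<lambda>\<omega>. \<delta> (X \<omega>, Z \<omega>)) (m \<delta>)"
      "\<And>n \<delta>. \<delta> \<in> \<Delta> \<Longrightarrow> \<pi> n \<delta> \<in> carrier_vec (k n)"
      "ennreal_bigo
         (\<lambda>n. SUP \<delta>\<in>\<Delta>. sup_norm T (\<lambda>v. m \<delta> v - scalar_prod (basis_vec \<phi> (k n) v) (\<pi> n \<delta>)))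
         (\<lambda>n. real (k n) powr (- \<alpha> / (real CARD('d) + 1)))"
    and xi_eq: "\<And>n. \<xi> n = (SUP v\<in>T. ennreal (sqrt (\<Sum>j<k n. (\<phi> j v)\<^sup>2)))"
    and A5_iii: "(\<lambda>n. (\<xi> n)\<^sup>2 * of_nat (k n) / of_nat n) \<longlonglongrightarrow> 0"
    and lam_eq: "\<And>n. lam n = real (k n) / real n
      + real (k n) powr (- 2 * \<alpha> / (real CARD('d) + 1)) + (\<eta> n)\<^sup>2"
    and ab_pos: "\<And>n. 0 < a n" "\<And>n. 0 < b n"
    and a_rate: "a \<in> O(\<lambda>n. inverse (lam n))"
    and b_rate: "filterlim b at_top sequentially" "b \<in> o(a)"
    and c_eq: "\<And>n. c n = b n / a n"
    and Deltahat_eq: "\<And>n \<omega>. \<Delta>hat n \<omega> = {\<delta>\<in>\<Delta>s n.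
      criterion \<phi> (k n) \<tau> n (\<lambda>i. Rs i \<omega>) (\<lambda>i. Xs i \<omega>) (\<lambda>i. Ys i \<omega>) (\<lambda>i. Zs i \<omega>) \<delta> \<le> c n}"
  shows "oP_one M (\<lambda>n \<omega>. hausdorff_dist (sup_norm S) (\<Delta>hat n \<omega>) \<Delta>\<^sub>0) \<and>
    OP M (\<lambda>n \<omega>. hausdorff_dist (weak_norm M R X Y Z) (\<Delta>hat n \<omega>) \<Delta>\<^sub>0) (\<lambda>n. sqrt (c n))"
proof -
  interpret prob_space M by (rule prob)
  interpret mo: missing_outcome M R Y Z X
    by unfold_locales (use meas R01 in auto)
  let ?D = "real CARD('d) + 1"
  have dim: "real DIM((real ^ 'd) \<times> real) = ?D" by simp
  have \<alpha>1: "1 < \<alpha>"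
  proof -
    have "1 \<le> real CARD('d)" by (simp add: Suc_leI)
    moreover have "1 < \<alpha>" if "1 \<le> x" "\<alpha> > (x + 1) / 2" for x :: real using that by simp
    ultimately show ?thesis using A4_i(1) by blast
  qed
  then have "2 \<le> \<lceil>\<alpha>\<rceil>" by linarith
  then have p1: "1 \<le> lower_int \<alpha>" unfolding lower_int_def by (simp add: nat_le_eq_zle le_nat_iff)
  have XZ_meas: "(\<lambda>\<omega>. (X \<omega>, Z \<omega>)) \<in> borel_measurable M" "(\<lambda>\<omega>. (X \<omega>, Y \<omega>)) \<in> borel_measurable M"
    using meas by (auto intro!: borel_measurable_Pair)
  have aeX: "AE \<omega> in M. X \<omega> \<in> cbox 0 1" using AE_in_msupport[OF meas(2)] A3(1) by simp
  have aeZ: "AE \<omega> in M. Z \<omega> \<in> msupport (distr M borel Z)" by (rule AE_in_msupport[OF meas(4)])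
  have aeT: "AE \<omega> in M. (X \<omega>, Y \<omega>) \<in> T" unfolding T_eq by (rule AE_in_msupport[OF XZ_meas(2)])
  have S_AE: "AE \<omega> in M. (X \<omega>, Z \<omega>) \<in> S"
    using aeX aeZ by eventually_elim (simp add: S_eq)
  have S_compact: "compact S" unfolding S_eq using A3(3) by (intro compact_Times compact_cbox)
  then have S_closed: "closed S" by (rule compact_imp_closed)
  have Z_ne: "msupport (distr M borel Z) \<noteq> {}"
    using aeZ by (auto simp: prob_space)
  have box_ne: "cbox (0 :: real ^ 'd) 1 \<noteq> {}"
    using aeX by (auto simp: prob_space)
  obtain z1 z2 where hull: "convex hull S = cbox (0, z1) (1, z2)" and hull_ne: "cbox (0 :: real ^ 'd, z1) (1, z2) \<noteq> {}"
    unfolding S_eq by (rule convex_hull_box_times_compact[OF A3(3) Z_ne box_ne])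
  have S_hull: "S \<subseteq> cbox (0, z1) (1, z2)" unfolding hull[symmetric] by (rule hull_subset)
  obtain K where K: "0 \<le> K" and ext_all: "\<forall>\<delta>\<in>\<Delta>.
    \<exists>D. partial_derivs_on (cbox (0, z1) (1, z2)) (lower_int \<alpha>) D \<and> (\<forall>w\<in>S. D (\<lambda>_. 0) w = \<delta> w) \<and>
      derivs_norm (cbox (0, z1) (1, z2)) \<alpha> D \<le> ennreal K"
    using sup_smooth_norm_finite[OF A4_i(2), unfolded hull] by (elim exE conjE) (rule that)
  note ext = bspec[OF ext_all]
  have bdd: "\<bar>\<delta> w\<bar> \<le> K" if "\<delta> \<in> \<Delta>" "w \<in> S" for \<delta> w
  proof -
    obtain D where D: "\<forall>w\<in>S. D (\<lambda>_. 0) w = \<delta> w" "derivs_norm (cbox (0, z1) (1, z2)) \<alpha> D \<le> ennreal K"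
      using ext[OF \<open>\<delta> \<in> \<Delta>\<close>] by blast
    have "\<bar>D (\<lambda>_. 0) w\<bar> \<le> K"
      by (rule derivs_norm_bounds(1)[OF D(2) K]) (use that S_hull in \<open>auto simp: multi_indices_def mi_size_def\<close>)
    then show ?thesis using D(1) that by simp
  qed
  have lip: "\<bar>\<delta> w - \<delta> w'\<bar> \<le> K * ?D * norm (w - w')" if "\<delta> \<in> \<Delta>" "w \<in> S" "w' \<in> S" for \<delta> w w'
  proof -
    obtain D where D: "partial_derivs_on (cbox (0, z1) (1, z2)) (lower_int \<alpha>) D" "\<forall>w\<in>S. D (\<lambda>_. 0) w = \<delta> w"
      "derivs_norm (cbox (0, z1) (1, z2)) \<alpha> D \<le> ennreal K"
      using ext[OF \<open>\<delta> \<in> \<Delta>\<close>] by blast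
    have "\<bar>D (\<lambda>_. 0) w - D (\<lambda>_. 0) w'\<bar> \<le> K * real DIM((real ^ 'd) \<times> real) * norm (w - w')"
      by (rule smooth_function_lipschitz[OF D(1,3) K p1]) (use that S_hull in auto)
    then show ?thesis unfolding dim using D(2) that by simp
  qed
  have D_meas: "\<delta> \<in> borel_measurable borel" if "\<delta> \<in> \<Delta>" for \<delta>
    using Delta_dom that by (intro borel_measurable_of_lipschitz_extensional[OF S_closed _ lip]) auto
  have \<alpha>D: "\<alpha> > real DIM((real ^ 'd) \<times> real) / 2" unfolding dim by (rule A4_i(1))
  obtain A :: "nat \<Rightarrow> ((real ^ 'd) \<times> real) set" and B s :: "nat \<Rightarrow> real" and C :: real
    where A: "\<And>i. A i \<in> sets borel" and B: "\<And>i. 0 \<le> B i" and s: "\<And>i. 0 < s i" and Bs: "summable (\<lambda>i. B i / s i)"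
    and sums: "\<And>w. (\<lambda>i. B i * s i * indicator (A i) w) sums (if w \<in> cbox (0, z1) (1, z2) then C else 0)"
    and expand: "\<And>D. partial_derivs_on (cbox (0, z1) (1, z2)) (lower_int \<alpha>) D \<Longrightarrow>
      derivs_norm (cbox (0, z1) (1, z2)) \<alpha> D \<le> ennreal K \<Longrightarrow>
      \<exists>c. (\<forall>i. \<bar>c i\<bar> \<le> B i) \<and> (\<forall>w\<in>cbox (0, z1) (1, z2). (\<lambda>i. c i * indicator (A i) w) sums D (\<lambda>_. 0) w)"
    by (rule smooth_class_expansion[OF hull_ne \<alpha>D p1 K]) blast
  have Bs_sum: "summable (\<lambda>i. B i * s i * indicator (A i) w)" and Bs_le: "(\<Sum>i. B i * s i * indicator (A i) w) \<le> \<bar>C\<bar>" for w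
    using sums[of w] by (auto simp: sums_iff split: if_splits)
  have expansion: "\<exists>c. (\<forall>i. \<bar>c i\<bar> \<le> B i) \<and> (\<forall>w\<in>S. (\<lambda>i. c i * indicator (A i) w) sums \<delta> w)" if "\<delta> \<in> \<Delta>" for \<delta>
  proof -
    obtain D where D: "partial_derivs_on (cbox (0, z1) (1, z2)) (lower_int \<alpha>) D" "\<forall>w\<in>S. D (\<lambda>_. 0) w = \<delta> w"
      "derivs_norm (cbox (0, z1) (1, z2)) \<alpha> D \<le> ennreal K"
      using ext[OF \<open>\<delta> \<in> \<Delta>\<close>] by blast
    obtain c where c: "\<forall>i. \<bar>c i\<bar> \<le> B i"
      "\<forall>w\<in>cbox (0, z1) (1, z2). (\<lambda>i. c i * indicator (A i) w) sums D (\<lambda>_. 0) w"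
      using expand[OF D(1,3)] by blast
    have "\<forall>w\<in>S. (\<lambda>i. c i * indicator (A i) w) sums \<delta> w"
    proof
      fix w assume w: "w \<in> S"
      then have "(\<lambda>i. c i * indicator (A i) w) sums D (\<lambda>_. 0) w" using c(2) S_hull by blast
      then show "(\<lambda>i. c i * indicator (A i) w) sums \<delta> w" using D(2) w by simp
    qed
    with c(1) show ?thesis by blast
  qed
  obtain \<delta>\<^sub>0 where \<delta>\<^sub>0: "\<delta>\<^sub>0 \<in> \<Delta>" "is_regression M R X Y (\<lambda>\<omega>. \<delta>\<^sub>0 (X \<omega>, Z \<omega>)) \<tau>"
    using A4_i(3) Delta0_eq by blast
  have XZ\<delta>: "(\<lambda>\<omega>. \<delta> (X \<omega>, Z \<omega>)) \<in> borel_measurable M" if "\<delta> \<in> \<Delta>" for \<delta>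
    by (rule measurable_compose[OF XZ_meas(1) D_meas[OF that]])
  \<comment> \<open>On \<open>R = 1\<close>, \<open>\<tau>\<close> is the conditional mean of a member of the bounded class.\<close>
  have tau_bdd: "AE \<omega> in M. \<bar>R \<omega> * \<tau> (X \<omega>, Y \<omega>)\<bar> \<le> K"
  proof -
    have "AE \<omega> in M. \<bar>\<delta>\<^sub>0 (X \<omega>, Z \<omega>)\<bar> \<le> K" using S_AE by eventually_elim (rule bdd[OF \<delta>\<^sub>0(1)])
    then have "AE \<omega> in M. \<bar>cond_mean M R X Y (\<lambda>\<omega>. \<delta>\<^sub>0 (X \<omega>, Z \<omega>)) \<omega>\<bar> \<le> K"
      by (rule mo.cond_mean_bounded[OF XZ\<delta>[OF \<delta>\<^sub>0(1)]])
    moreover have "AE \<omega> in M. R \<omega> = 1 \<longrightarrow> cond_mean M R X Y (\<lambda>\<omega>. \<delta>\<^sub>0 (X \<omega>, Z \<omega>)) \<omega> = \<tau> (X \<omega>, Y \<omega>)"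
      using \<delta>\<^sub>0(2) by (simp add: is_regression_def)
    ultimately show ?thesis
      using AE_space
    proof eventually_elim
      fix \<omega> assume "\<bar>cond_mean M R X Y (\<lambda>\<omega>. \<delta>\<^sub>0 (X \<omega>, Z \<omega>)) \<omega>\<bar> \<le> K"
        "R \<omega> = 1 \<longrightarrow> cond_mean M R X Y (\<lambda>\<omega>. \<delta>\<^sub>0 (X \<omega>, Z \<omega>)) \<omega> = \<tau> (X \<omega>, Y \<omega>)" "\<omega> \<in> space M"
      then show "\<bar>R \<omega> * \<tau> (X \<omega>, Y \<omega>)\<bar> \<le> K" using R01[of \<omega>] K by (cases "R \<omega> = 1") auto
    qed
  qed
  obtain l u where l: "0 < l" and ev: "\<And>n v. eigenvalue (gram_mat M R X Y \<phi> (k n)) v \<Longrightarrow> l \<le> v \<and> v \<le> u"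
    using A5_i by blast
  let ?G = "\<lambda>i j. \<integral>\<omega>. R \<omega> * (\<phi> i (X \<omega>, Y \<omega>) * \<phi> j (X \<omega>, Y \<omega>)) \<partial>M"
  have form: "l * (\<Sum>i<k n. (v i)\<^sup>2) \<le> bilin (k n) ?G v v" "bilin (k n) ?G v v \<le> max u 1 * (\<Sum>i<k n. (v i)\<^sup>2)" for n v
  proof -
    have eq: "bilin (k n) (\<lambda>i j. gram_mat M R X Y \<phi> (k n) $$ (i, j)) v v = bilin (k n) ?G v v"
      by (simp add: bilin_def gram_mat_def mult.assoc)
    have carr: "gram_mat M R X Y \<phi> (k n) \<in> carrier_mat (k n) (k n)" by (simp add: gram_mat_def)
    have sym: "gram_mat M R X Y \<phi> (k n) $$ (i, j) = gram_mat M R X Y \<phi> (k n) $$ (j, i)" if "i < k n" "j < k n" for i j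
      using that by (simp add: gram_mat_def mult_ac)
    have kn: "0 < k n" using k_pos[of n] by simp
    note bounds = eigenvalue_bounds_imp_form_bounds[OF carr kn sym ev, where x = v, unfolded eq]
    show "l * (\<Sum>i<k n. (v i)\<^sup>2) \<le> bilin (k n) ?G v v" by (rule bounds(1))
    have "bilin (k n) ?G v v \<le> u * (\<Sum>i<k n. (v i)\<^sup>2)" by (rule bounds(2))
    also have "\<dots> \<le> max u 1 * (\<Sum>i<k n. (v i)\<^sup>2)" by (intro mult_right_mono sum_nonneg) auto
    finally show "bilin (k n) ?G v v \<le> max u 1 * (\<Sum>i<k n. (v i)\<^sup>2)" .
  qed
  have phi_sq: "integrable M (\<lambda>\<omega>. R \<omega> * (\<phi> j (X \<omega>, Y \<omega>))\<^sup>2)" if j: "j < k n" for n j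
  proof (rule ccontr)
    \<comment> \<open>A non-integrable function has integral \<open>0\<close>, which would make a diagonal entry vanish.\<close>
    assume not_int: "\<not> ?thesis"
    define e where "e i = (if i = j then 1 else 0 :: real)" for i
    have "bilin (k n) ?G e e = (\<Sum>i<k n. e i * (\<Sum>j'<k n. ?G i j' * e j'))" by (rule bilin_right)
    also have "\<dots> = ?G j j"
      using j by (simp add: e_def if_distrib[of "\<lambda>x. _ * x"] if_distrib[of "\<lambda>x. x * _"] cong: if_cong)
    also have "\<dots> = 0" using not_int by (simp add: power2_eq_square not_integrable_integral_eq)
    finally have 1: "bilin (k n) ?G e e = 0" .
    have "(\<Sum>i<k n. (e i)\<^sup>2) = (\<Sum>i<k n. if i = j then 1 else 0)" by (intro sum.cong) (auto simp: e_def)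
    then have "(\<Sum>i<k n. (e i)\<^sup>2) = 1" using j by simp
    moreover have "l * (\<Sum>i<k n. (e i)\<^sup>2) \<le> bilin (k n) ?G e e" by (rule form(1))
    ultimately show False using 1 l by simp
  qed
  interpret sr: sieve_regression M R Y Z X Rs Ys Zs Xs \<phi> k \<tau> \<Delta> S K l "max u 1" A B s "\<bar>C\<bar>"
  proof
    show "indep_vars (\<lambda>_. borel) (\<lambda>i \<omega>. (Rs i \<omega>, Xs i \<omega>, Ys i \<omega>, Zs i \<omega>)) UNIV" by (rule indep)
    show "S \<in> sets borel" by (rule borel_closed[OF S_closed])
  qed (fact ident phi_meas tau_meas S_AE D_meas bdd tau_bdd l form phi_sq A B s Bs Bs_sum Bs_le expansion | simp)+
  define \<rho> where "\<rho> n = real (k n) powr (- \<alpha> / ?D)" for n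
  have \<rho>: "0 \<le> \<rho> n" "(\<rho> n)\<^sup>2 = real (k n) powr (- 2 * \<alpha> / ?D)" for n
    by (simp_all add: \<rho>_def power2_eq_square powr_add[symmetric] add_divide_distrib[symmetric])
  have lam: "lam n = real (k n) / real n + (\<rho> n)\<^sup>2 + (\<eta> n)\<^sup>2" for n
    by (simp add: lam_eq \<rho>(2))
  have lam_pos: "0 < lam n" for n
  proof -
    have "0 < \<rho> n" using k_pos[of n] by (simp add: \<rho>_def)
    then have "0 < (\<rho> n)\<^sup>2" by simp
    then show ?thesis unfolding lam by (intro add_pos_nonneg add_nonneg_pos) auto
  qed
  obtain C1 where C1: "0 < C1" "\<forall>\<^sub>F n in sequentially. \<forall>\<delta>\<in>\<Delta>. \<forall>w\<in>S. \<bar>\<delta> w - P n \<delta> w\<bar> \<le> C1 * \<bar>\<eta> n\<bar>"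
    by (rule ennreal_bigo_sup_norm[OF A4_ii(2)])
  obtain C2 where C2: "0 < C2" "\<forall>\<^sub>F n in sequentially. \<forall>\<delta>\<in>\<Delta>. \<forall>v\<in>T.
      \<bar>m \<delta> v - scalar_prod (basis_vec \<phi> (k n) v) (\<pi> n \<delta>)\<bar> \<le> C2 * \<bar>real (k n) powr (- \<alpha> / ?D)\<bar>"
    by (rule ennreal_bigo_sup_norm[OF A5_ii(3)])
  \<comment> \<open>On \<open>R = 1\<close> the residual of \<open>\<delta>\<close> is \<open>m \<delta>\<^sub>0 - m \<delta>\<close>, whence the factor \<open>2\<close>.\<close>
  have near: "\<forall>\<^sub>F n in sequentially. \<forall>\<delta>\<in>\<Delta>. sr.near_span n \<delta> (2 * C2 * \<rho> n)"
    using C2(2)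
  proof eventually_elim
    fix n assume ap: "\<forall>\<delta>\<in>\<Delta>. \<forall>v\<in>T.
      \<bar>m \<delta> v - scalar_prod (basis_vec \<phi> (k n) v) (\<pi> n \<delta>)\<bar> \<le> C2 * \<bar>real (k n) powr (- \<alpha> / ?D)\<bar>"
    have sp: "scalar_prod (basis_vec \<phi> (k n) v) (\<pi> n \<delta>) = (\<Sum>j<k n. \<pi> n \<delta> $ j * \<phi> j v)" if "\<delta> \<in> \<Delta>" for \<delta> v
      using carrier_vecD[OF A5_ii(2)[OF that]] by (simp add: scalar_prod_def basis_vec_def lessThan_atLeast0 mult.commute)
    show "\<forall>\<delta>\<in>\<Delta>. sr.near_span n \<delta> (2 * C2 * \<rho> n)"
    proof
      fix \<delta> assume \<delta>: "\<delta> \<in> \<Delta>"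
      have m: "AE \<omega> in M. R \<omega> = 1 \<longrightarrow> cond_mean M R X Y (\<lambda>\<omega>. \<delta>' (X \<omega>, Z \<omega>)) \<omega> = m \<delta>' (X \<omega>, Y \<omega>)" if "\<delta>' \<in> \<Delta>" for \<delta>'
        using A5_ii(1)[OF that] by (simp add: is_regression_def)
      have t: "AE \<omega> in M. R \<omega> = 1 \<longrightarrow> cond_mean M R X Y (\<lambda>\<omega>. \<delta>\<^sub>0 (X \<omega>, Z \<omega>)) \<omega> = \<tau> (X \<omega>, Y \<omega>)"
        using \<delta>\<^sub>0(2) by (simp add: is_regression_def)
      show "sr.near_span n \<delta> (2 * C2 * \<rho> n)"
        unfolding sr.near_span_def
      proof (rule exI[of _ "\<lambda>j. \<pi> n \<delta>\<^sub>0 $ j - \<pi> n \<delta> $ j"])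
        show "AE \<omega> in M. R \<omega> * \<bar>\<tau> (X \<omega>, Y \<omega>) - cond_mean M R X Y (\<lambda>\<omega>. \<delta> (X \<omega>, Z \<omega>)) \<omega>
            - (\<Sum>j<k n. (\<pi> n \<delta>\<^sub>0 $ j - \<pi> n \<delta> $ j) * \<phi> j (X \<omega>, Y \<omega>))\<bar> \<le> 2 * C2 * \<rho> n"
          using m[OF \<delta>] m[OF \<delta>\<^sub>0(1)] t aeT AE_space
        proof eventually_elim
          fix \<omega> let ?v = "(X \<omega>, Y \<omega>)"
          assume m1: "R \<omega> = 1 \<longrightarrow> cond_mean M R X Y (\<lambda>\<omega>. \<delta> (X \<omega>, Z \<omega>)) \<omega> = m \<delta> ?v"
            and m2: "R \<omega> = 1 \<longrightarrow> cond_mean M R X Y (\<lambda>\<omega>. \<delta>\<^sub>0 (X \<omega>, Z \<omega>)) \<omega> = m \<delta>\<^sub>0 ?v"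
            and m3: "R \<omega> = 1 \<longrightarrow> cond_mean M R X Y (\<lambda>\<omega>. \<delta>\<^sub>0 (X \<omega>, Z \<omega>)) \<omega> = \<tau> ?v"
            and v: "?v \<in> T" and \<omega>: "\<omega> \<in> space M"
          show "R \<omega> * \<bar>\<tau> ?v - cond_mean M R X Y (\<lambda>\<omega>. \<delta> (X \<omega>, Z \<omega>)) \<omega>
            - (\<Sum>j<k n. (\<pi> n \<delta>\<^sub>0 $ j - \<pi> n \<delta> $ j) * \<phi> j ?v)\<bar> \<le> 2 * C2 * \<rho> n"
          proof (cases "R \<omega> = 1")
            case True
            have ap': "\<bar>m \<delta>' ?v - (\<Sum>j<k n. \<pi> n \<delta>' $ j * \<phi> j ?v)\<bar> \<le> C2 * \<rho> n" if "\<delta>' \<in> \<Delta>" for \<delta>'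
              using bspec[OF bspec[OF ap that] v] unfolding sp[OF that] by (simp add: \<rho>_def)
            note ap'[OF \<delta>] ap'[OF \<delta>\<^sub>0(1)]
            moreover have "(\<Sum>j<k n. (\<pi> n \<delta>\<^sub>0 $ j - \<pi> n \<delta> $ j) * \<phi> j ?v)
                = (\<Sum>j<k n. \<pi> n \<delta>\<^sub>0 $ j * \<phi> j ?v) - (\<Sum>j<k n. \<pi> n \<delta> $ j * \<phi> j ?v)"
              by (simp add: left_diff_distrib sum_subtractf)
            moreover have "\<tau> ?v = m \<delta>\<^sub>0 ?v" using m2 m3 True by simp
            ultimately show ?thesis using m1 True by simp
          next
            case False
            then have "R \<omega> = 0" using R01[OF \<omega>] by auto
            then show ?thesis using C2(1) \<rho>(1)[of n] by simp
          qed
        qed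
      qed
    qed
  qed
  note xi = squared_ratio_eventually_finite[OF A5_iii k_pos]
  have x: "\<forall>\<^sub>F n in sequentially. AE \<omega> in M. (\<Sum>j<k n. (\<phi> j (X \<omega>, Y \<omega>))\<^sup>2) \<le> (enn2real (\<xi> n))\<^sup>2"
    using xi(1)
  proof eventually_elim
    fix n assume fin: "\<xi> n < \<infinity>"
    show "AE \<omega> in M. (\<Sum>j<k n. (\<phi> j (X \<omega>, Y \<omega>))\<^sup>2) \<le> (enn2real (\<xi> n))\<^sup>2"
      using aeT
    proof eventually_elim
      fix \<omega> assume v: "(X \<omega>, Y \<omega>) \<in> T"
      define q where "q = (\<Sum>j<k n. (\<phi> j (X \<omega>, Y \<omega>))\<^sup>2)"
      have q0: "0 \<le> q" unfolding q_def by (intro sum_nonneg) auto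
      have "ennreal (sqrt q) \<le> \<xi> n" unfolding xi_eq q_def by (rule SUP_upper[OF v])
      also have "\<xi> n = ennreal (enn2real (\<xi> n))" using fin by simp
      finally have "sqrt q \<le> enn2real (\<xi> n)" by (simp add: ennreal_le_iff)
      then have "(sqrt q)\<^sup>2 \<le> (enn2real (\<xi> n))\<^sup>2" using q0 by (intro power_mono) auto
      then show "q \<le> (enn2real (\<xi> n))\<^sup>2" using q0 by simp
    qed
  qed
  show ?thesis
  proof (rule sr.consistency_and_rate[where \<Delta>s = \<Delta>s and P = P and \<eta> = \<eta> and \<rho> = \<rho> and c = c
        and x = "\<lambda>n. (enn2real (\<xi> n))\<^sup>2" and L = "K * ?D" and ?C1.0 = C1 and ?C2.0 = "2 * C2"])
    show "\<Delta>\<^sub>0 = {\<delta>\<in>\<Delta>. is_regression M R X Y (\<lambda>\<omega>. \<delta> (X \<omega>, Z \<omega>)) \<tau>}" by (rule Delta0_eq)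
    show "\<Delta>s n \<subseteq> \<Delta>" for n by (auto simp: Deltan_eq sieve_def)
    show "\<Delta>hat n \<omega> = {\<delta>\<in>\<Delta>s n. sr.crit n \<omega> \<delta> \<le> c n}" for n \<omega>
      by (simp add: Deltahat_eq sr.crit_def)
    show "\<forall>\<^sub>F n in sequentially. C' * (real (k n) / real n + (\<rho> n)\<^sup>2 + (\<eta> n)\<^sup>2) \<le> c n" for C'
      unfolding lam[symmetric] by (rule rate_dominates(1)[OF ab_pos lam_pos a_rate b_rate c_eq])
    show "c \<longlonglongrightarrow> 0" by (rule rate_dominates(2)[OF ab_pos lam_pos a_rate b_rate c_eq])
    show "0 \<le> C1" "0 \<le> 2 * C2" using C1 C2 by auto
    show "\<And>\<delta> w w'. \<delta> \<in> \<Delta> \<Longrightarrow> w \<in> S \<Longrightarrow> w' \<in> S \<Longrightarrow> \<bar>\<delta> w - \<delta> w'\<bar> \<le> K * ?D * norm (w - w')" by (rule lip)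
  qed (fact A4_i(3) A4_ii(1) S_compact Delta_dom A4_i(4) C1(2) \<rho>(1) near x xi(2) A4_ii(3))+
qed

end
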